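(* Let $A,B$ be finite-dimensional Hilbert spaces, let $\rho_A,\sigma_A\in\mathrm{S}(A)$, and let $|\psi\rangle_{AB}\in A\otimes B$ be an arbitrary purification of $\rho_A$. Then $$D(\rho_A\|\sigma_A)=\lim_{n\to\infty}\frac1n\min_{\sigma_{A_1^nB_1^n}\in\mathcal{C}^{\sigma_A}_{AB,n}}D\big(|\psi\rangle\langle\psi|^{\otimes n}\,\big\|\,\sigma_{A_1^nB_1^n}\big)=-\lim_{n\to\infty}\frac1n\max_{\sigma_{A_1^nB_1^n}\in\mathcal{C}^{\sigma_A}_{AB,n}}\langle\psi|^{\otimes n}\log(\sigma_{A_1^nB_1^n})|\psi\rangle^{\otimes n}.$$ The optimizer can be assumed to be permutation-invariant in $n$. More precisely, the optimizer has the explicit form $$\sigma_{A_1^nB_1^n}=\int_{-\infty}^{\infty}\beta_0(t)\,\big(\sigma_A^{\frac{1+\mathrm{i}t}{2}}\big)^{\otimes n}\big(\rho_A^{-\frac{1+\mathrm{i}t}{2}}\big)^{\otimes n}|\psi\rangle\langle\psi|^{\otimes n}\big(\rho_A^{-\frac{1-\mathrm{i}t}{2}}\big)^{\otimes n}\big(\sigma_A^{\frac{1-\mathrm{i}t}{2}}\big)^{\otimes n}\,\mathrm{d}t ,\qquad \beta_0(t):=\frac{\pi}{2}(\cosh(\pi t)+1)^{-1},$$ in the sense that this family of extensions of $\sigma_A^{\otimes n}$ satisfies $D(\rho_A\|\sigma_A)=\lim_{n\to\infty}\frac1n D(|\psi\rangle\langle\psi|^{\otimes n}\|\sigma_{A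_1^nB_1^n})$.
   Context: $\mathrm{S}(A)$ is the set of density matrices (positive semidefinite, trace one) on the finite-dimensional Hilbert space $A$; $A_1^n=A^{\otimes n}$, $B_1^n=B^{\otimes n}$. $\mathcal{C}^{\sigma_A}_{AB,n}:=\{\sigma'\in\mathrm{S}(A_1^n\otimes B_1^n):\mathrm{tr}_{B_1^n}[\sigma']=\sigma_A^{\otimes n}\}$ is the set of extensions of $\sigma_A^{\otimes n}$. A purification of $\rho_A$ is a unit vector $|\psi\rangle_{AB}$ with $\mathrm{tr}_B[|\psi\rangle\langle\psi|]=\rho_A$. A state on $(A\otimes B)^{\otimes n}$ is permutation-invariant if it is invariant under conjugation by the unitaries permuting the $n$ tensor factors $A\otimes B$. Operators on $A_1^n$ act on $A_1^n\otimes B_1^n$ as $X\otimes\mathbb{1}_{B_1^n}$. The inverse (in the negative powers of $\rho_A$) is only relevant on the support of $\rho_A^{\otimes n}$. The function $\beta_0$ is a probability distribution on $\mathbb{R}$. The relative entropy is $D(\rho\|\sigma):=\mathrm{tr}[\rho(\log\rho-\log\sigma)]$ if $\mathrm{supp}\,\rho\subseteq\mathrm{supp}\,\sigma$, and $+\infty$ otherwise. Accordingly, $\langle\phi|\log(\sigma)|\phi\rangle$ is interpreted as $-\infty$ if $|\phi\rangle\notin\mathrm{supp}\,\sigma$, and otherwise is evaluated with $\log\sigma$ taken on the support of $\sigma$.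
   Formalization: The explicit operators are claimed to be extensions of σ_A^{⊗n} only when supp σ_A ⊆ supp ρ_A; otherwise their trace is below 1 (e.g. ρ_A=|0⟩⟨0|, σ_A=1/2 gives trace 2^{-n}). Their positivity, permutation invariance and entropy limit are claimed in all cases. *)

theory Defs
  imports
    "HOL-Analysis.Analysis"
    "HOL-Combinatorics.Permutations"
    "Jordan_Normal_Form.Schur_Decomposition"
    "Jordan_Normal_Form.Matrix_Kernel"
begin

unbundle no vec_syntax
hide_const (open) Finite_Cartesian_Product.vec Finite_Cartesian_Product.mat
no_notation Inner_Product.real_inner_class.inner (infix "\<bullet>" 70)

text \<open>
  The Hilbert spaces are \<open>A = \<complex>^dA\<close> and \<open>B = \<complex>^dB\<close>, operators are complex matrices.
  The product basis vector \<open>|a\<rangle> \<otimes> |b\<rangle>\<close> of \<open>X \<otimes> Y\<close> has index \<open>a * dim Y + b\<close>, and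
  \<open>|i\<^sub>0\<rangle> \<otimes> \<dots> \<otimes> |i\<^sub>n\<^sub>-\<^sub>1\<rangle>\<close> in \<open>X^n\<close> has the index with base-\<open>dim X\<close> digits
  \<open>i\<^sub>0, \<dots>, i\<^sub>n\<^sub>-\<^sub>1\<close>.  The space \<open>(A \<otimes> B)^n\<close> is always identified with \<open>A^n \<otimes> B^n\<close>.
\<close>

subsection \<open>Linear algebra\<close>

definition mtrace :: "complex mat \<Rightarrow> complex" where
  "mtrace X = (\<Sum>i<dim_row X. X $$ (i, i))"

definition psd :: "nat \<Rightarrow> complex mat \<Rightarrow> bool" where
  "psd d X \<longleftrightarrow> X \<in> carrier_mat d d \<and> mat_adjoint X = X \<and>
     (\<forall>v\<in>carrier_vec d. 0 \<le> Re ((X *\<^sub>v v) \<bullet>c v))"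

definition density_matrices :: "nat \<Rightarrow> complex mat set" where
  "density_matrices d = {X. psd d X \<and> mtrace X = 1}"

definition supp :: "complex mat \<Rightarrow> complex vec set" where
  "supp X = {v \<in> carrier_vec (dim_col X). \<forall>w\<in>mat_kernel X. v \<bullet>c w = 0}"

definition ket_bra :: "complex vec \<Rightarrow> complex mat" where
  "ket_bra v = Matrix.mat (dim_vec v) (dim_vec v) (\<lambda>(i, j). v $ i * cnj (v $ j))"

definition unitary_mat :: "nat \<Rightarrow> complex mat \<Rightarrow> bool" where
  "unitary_mat d U \<longleftrightarrow> U \<in> carrier_mat d d \<and> mat_adjoint U * U = 1\<^sub>m d"

text \<open>
  Functional calculus \<open>f(X)\<close> for Hermitian \<open>X\<close>; the result does not depend on the chosen
  diagonalisation (see \<open>mat_fun_diag\<close> below).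
\<close>

definition mat_fun :: "(real \<Rightarrow> complex) \<Rightarrow> complex mat \<Rightarrow> complex mat" where
  "mat_fun f X = (THE Y. \<exists>U l. unitary_mat (dim_row X) U \<and>
     X = U * mat_diag (dim_row X) (\<lambda>i. complex_of_real (l i)) * mat_adjoint U \<and>
     Y = U * mat_diag (dim_row X) (\<lambda>i. f (l i)) * mat_adjoint U)"

text \<open>The logarithm is taken on the support: the eigenvalue 0 is sent to 0.\<close>

definition mat_log :: "complex mat \<Rightarrow> complex mat" where
  "mat_log X = mat_fun (\<lambda>x. if x = 0 then 0 else complex_of_real (ln x)) X"

text \<open>
  Complex powers of a positive semidefinite matrix, likewise taken on the support, so that for
  negative real part of \<open>z\<close> this is a power of the inverse on the support.
\<close>

definition mat_cpow :: "complex mat \<Rightarrow> complex \<Rightarrow> complex mat" where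
  "mat_cpow X z = mat_fun (\<lambda>x. if x = 0 then 0 else complex_of_real x powr z) X"

subsection \<open>Tensor products\<close>

definition kron :: "complex mat \<Rightarrow> complex mat \<Rightarrow> complex mat" where
  "kron X Y = Matrix.mat (dim_row X * dim_row Y) (dim_col X * dim_col Y)
     (\<lambda>(i, j). X $$ (i div dim_row Y, j div dim_col Y) * Y $$ (i mod dim_row Y, j mod dim_col Y))"

definition ptrace_B :: "nat \<Rightarrow> nat \<Rightarrow> complex mat \<Rightarrow> complex mat" where
  "ptrace_B dA dB X = Matrix.mat dA dA (\<lambda>(i, j). \<Sum>k<dB. X $$ (i * dB + k, j * dB + k))"

definition digit :: "nat \<Rightarrow> nat \<Rightarrow> nat \<Rightarrow> nat" where
  "digit d i k = i div d ^ k mod d"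

definition tensor_power :: "nat \<Rightarrow> complex mat \<Rightarrow> complex mat" where
  "tensor_power n X = Matrix.mat (dim_row X ^ n) (dim_col X ^ n)
     (\<lambda>(i, j). \<Prod>k<n. X $$ (digit (dim_row X) i k, digit (dim_col X) j k))"

text \<open>
  \<open>\<psi>^n\<close> for \<open>\<psi> \<in> A \<otimes> B\<close>, as a vector in \<open>A^n \<otimes> B^n\<close>: the coefficient at
  \<open>|a\<^sub>0 \<dots> a\<^sub>n\<^sub>-\<^sub>1\<rangle> \<otimes> |b\<^sub>0 \<dots> b\<^sub>n\<^sub>-\<^sub>1\<rangle>\<close> is the product of the coefficients of \<open>\<psi>\<close> at \<open>|a\<^sub>k\<rangle> \<otimes> |b\<^sub>k\<rangle>\<close>.
\<close>

definition tensor_power_AB :: "nat \<Rightarrow> nat \<Rightarrow> nat \<Rightarrow> complex vec \<Rightarrow> complex vec" where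
  "tensor_power_AB dA dB n \<psi> = Matrix.vec (dA ^ n * dB ^ n)
     (\<lambda>i. \<Prod>k<n. \<psi> $ (digit dA (i div dB ^ n) k * dB + digit dB (i mod dB ^ n) k))"

subsection \<open>Permutation invariance\<close>

definition perm_index :: "nat \<Rightarrow> nat \<Rightarrow> (nat \<Rightarrow> nat) \<Rightarrow> nat \<Rightarrow> nat" where
  "perm_index d n p i = (\<Sum>k<n. digit d i (p k) * d ^ k)"

text \<open>The unitary on \<open>A^n \<otimes> B^n\<close> that permutes the \<open>n\<close> factors \<open>A \<otimes> B\<close>.\<close>

definition perm_unitary :: "nat \<Rightarrow> nat \<Rightarrow> nat \<Rightarrow> (nat \<Rightarrow> nat) \<Rightarrow> complex mat" where
  "perm_unitary dA dB n p = Matrix.mat (dA ^ n * dB ^ n) (dA ^ n * dB ^ n)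
     (\<lambda>(i, j). if i = perm_index dA n p (j div dB ^ n) * dB ^ n + perm_index dB n p (j mod dB ^ n)
               then 1 else 0)"

definition perm_invariant :: "nat \<Rightarrow> nat \<Rightarrow> nat \<Rightarrow> complex mat \<Rightarrow> bool" where
  "perm_invariant dA dB n X \<longleftrightarrow> (\<forall>p. p permutes {..<n} \<longrightarrow>
     perm_unitary dA dB n p * X * mat_adjoint (perm_unitary dA dB n p) = X)"

subsection \<open>Relative entropy, purifications and extensions\<close>

definition rel_entropy :: "complex mat \<Rightarrow> complex mat \<Rightarrow> ereal" where
  "rel_entropy \<rho> \<sigma> =
     (if supp \<rho> \<subseteq> supp \<sigma> then ereal (Re (mtrace (\<rho> * (mat_log \<rho> - mat_log \<sigma>)))) else \<infinity>)"

text \<open>\<open>\<langle>\<phi>|log \<sigma>|\<phi>\<rangle>\<close>; recall that \<open>\<bullet>c\<close> is conjugate-linear in its second argument.\<close>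

definition log_expectation :: "complex mat \<Rightarrow> complex vec \<Rightarrow> ereal" where
  "log_expectation \<sigma> \<phi> =
     (if \<phi> \<in> supp \<sigma> then ereal (Re ((mat_log \<sigma> *\<^sub>v \<phi>) \<bullet>c \<phi>)) else -\<infinity>)"

definition purification :: "nat \<Rightarrow> nat \<Rightarrow> complex vec \<Rightarrow> complex mat \<Rightarrow> bool" where
  "purification dA dB \<psi> \<rho> \<longleftrightarrow>
     \<psi> \<in> carrier_vec (dA * dB) \<and> \<psi> \<bullet>c \<psi> = 1 \<and> ptrace_B dA dB (ket_bra \<psi>) = \<rho>"

definition extensions :: "nat \<Rightarrow> nat \<Rightarrow> nat \<Rightarrow> complex mat \<Rightarrow> complex mat set" where
  "extensions dA dB n \<sigma> = {\<tau> \<in> density_matrices (dA ^ n * dB ^ n).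
     ptrace_B (dA ^ n) (dB ^ n) \<tau> = tensor_power n \<sigma>}"

subsection \<open>The explicit optimizer\<close>

definition beta0 :: "real \<Rightarrow> real" where
  "beta0 t = pi / 2 * inverse (cosh (pi * t) + 1)"

text \<open>Operators on \<open>A^n\<close> act on \<open>A^n \<otimes> B^n\<close> by tensoring with the identity.\<close>

definition on_A :: "nat \<Rightarrow> nat \<Rightarrow> complex mat \<Rightarrow> complex mat" where
  "on_A dB n X = kron (tensor_power n X) (1\<^sub>m (dB ^ n))"

definition opt_integrand ::
  "nat \<Rightarrow> nat \<Rightarrow> nat \<Rightarrow> complex mat \<Rightarrow> complex mat \<Rightarrow> complex vec \<Rightarrow> real \<Rightarrow> complex mat" where
  "opt_integrand dA dB n \<rho> \<sigma> \<psi> t =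
     on_A dB n (mat_cpow \<sigma> ((1 + \<i> * complex_of_real t) / 2)) *
     on_A dB n (mat_cpow \<rho> (- ((1 + \<i> * complex_of_real t) / 2))) *
     ket_bra (tensor_power_AB dA dB n \<psi>) *
     on_A dB n (mat_cpow \<rho> (- ((1 - \<i> * complex_of_real t) / 2))) *
     on_A dB n (mat_cpow \<sigma> ((1 - \<i> * complex_of_real t) / 2))"

text \<open>The integral of a matrix-valued function is taken entrywise.\<close>

definition opt_state ::
  "nat \<Rightarrow> nat \<Rightarrow> nat \<Rightarrow> complex mat \<Rightarrow> complex mat \<Rightarrow> complex vec \<Rightarrow> complex mat" where
  "opt_state dA dB n \<rho> \<sigma> \<psi> = Matrix.mat (dA ^ n * dB ^ n) (dA ^ n * dB ^ n)
     (\<lambda>(i, j). LINT t|lborel. complex_of_real (beta0 t) * opt_integrand dA dB n \<rho> \<sigma> \<psi> t $$ (i, j))"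

subsection \<open>Well-definedness of the functional calculus\<close>

lemma mat_adjoint_carrier: "X \<in> carrier_mat n m \<Longrightarrow> mat_adjoint X \<in> carrier_mat m n"
  unfolding mat_adjoint_def by (auto simp: mat_of_rows_def)

lemma mat_fun_aux:
  assumes U: "unitary_mat d U" and V: "unitary_mat d V"
    and eq: "U * mat_diag d (\<lambda>i. complex_of_real (l i)) * mat_adjoint U =
             V * mat_diag d (\<lambda>i. complex_of_real (m i)) * mat_adjoint V"
  shows "U * mat_diag d (\<lambda>i. f (l i)) * mat_adjoint U =
         V * mat_diag d (\<lambda>i. f (m i)) * mat_adjoint V"
proof -
  define U' where "U' = mat_adjoint U"
  define V' where "V' = mat_adjoint V"
  have c: "U \<in> carrier_mat d d" "V \<in> carrier_mat d d" "U' \<in> carrier_mat d d" "V' \<in> carrier_mat d d"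
    using U V mat_adjoint_carrier unfolding unitary_mat_def U'_def V'_def by auto
  have u: "U' * U = 1\<^sub>m d" "V' * V = 1\<^sub>m d"
    using U V unfolding unitary_mat_def U'_def V'_def by auto
  have u': "U * U' = 1\<^sub>m d" "V * V' = 1\<^sub>m d"
    using u c by (auto intro: mat_mult_left_right_inverse)
  define W where "W = V' * U"
  have Wc: "W \<in> carrier_mat d d" using c W_def by auto
  have conj: "V' * (U * D * U') * U = W * D" if "D \<in> carrier_mat d d" for D
  proof -
    have "V' * (U * D * U') * U = V' * (U * D * (U' * U))"
      using c that by (simp add: assoc_mult_mat[of _ d d _ d _ d])
    also have "\<dots> = W * D"
      using c that by (simp add: u W_def assoc_mult_mat[of _ d d _ d _ d])
    finally show ?thesis .
  qed
  have conj2: "V' * (V * E * V') * U = E * W" if "E \<in> carrier_mat d d" for E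
  proof -
    have "V' * (V * E * V') * U = (V' * V) * (E * (V' * U))"
      using c that by (simp add: assoc_mult_mat[of _ d d _ d _ d])
    also have "\<dots> = E * W" using c that by (simp add: u W_def)
    finally show ?thesis .
  qed
  have e: "W * mat_diag d (\<lambda>i. complex_of_real (l i)) = mat_diag d (\<lambda>i. complex_of_real (m i)) * W"
    using eq conj[of "mat_diag d (\<lambda>i. complex_of_real (l i))"]
      conj2[of "mat_diag d (\<lambda>i. complex_of_real (m i))"] by (simp add: U'_def V'_def)
  have ent: "W $$ (i, j) * complex_of_real (l j) = complex_of_real (m i) * W $$ (i, j)"
    if "i < d" "j < d" for i j
    using arg_cong[OF e, of "\<lambda>M. M $$ (i, j)"] that
    by (simp add: mat_diag_mult_left[OF Wc] mat_diag_mult_right[OF Wc] mult.commute)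
  have "W * mat_diag d (\<lambda>i. f (l i)) = mat_diag d (\<lambda>i. f (m i)) * W"
  proof (rule eq_matI)
    fix i j assume "i < dim_row (mat_diag d (\<lambda>i. f (m i)) * W)" "j < dim_col (mat_diag d (\<lambda>i. f (m i)) * W)"
    then have ij: "i < d" "j < d" using Wc by (simp_all add: mat_diag_def)
    have "W $$ (i, j) = 0 \<or> l j = m i" using ent[OF ij] by auto
    then show "(W * mat_diag d (\<lambda>i. f (l i))) $$ (i, j) = (mat_diag d (\<lambda>i. f (m i)) * W) $$ (i, j)"
      using ij by (auto simp: mat_diag_mult_left[OF Wc] mat_diag_mult_right[OF Wc])
  qed (use Wc in \<open>auto simp: mat_diag_def\<close>)
  then have "V * (W * mat_diag d (\<lambda>i. f (l i))) * U' = V * (mat_diag d (\<lambda>i. f (m i)) * W) * U'"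
    by simp
  moreover have "V * (W * D) * U' = U * D * U'" if "D \<in> carrier_mat d d" for D
  proof -
    have "V * (W * D) * U' = (V * V') * (U * D * U')"
      unfolding W_def using c that by (simp add: assoc_mult_mat[of _ d d _ d _ d])
    then show ?thesis using c that by (simp add: u')
  qed
  moreover have "V * (E * W) * U' = V * E * V'" if "E \<in> carrier_mat d d" for E
  proof -
    have "V * (E * W) * U' = (V * E * V') * (U * U')"
      unfolding W_def using c that by (simp add: assoc_mult_mat[of _ d d _ d _ d])
    then show ?thesis using c that by (simp add: u')
  qed
  ultimately show ?thesis by (simp add: U'_def V'_def)
qed

lemma mat_fun_diag:
  assumes U: "unitary_mat d U"
    and X: "X = U * mat_diag d (\<lambda>i. complex_of_real (l i)) * mat_adjoint U"
  shows "mat_fun f X = U * mat_diag d (\<lambda>i. f (l i)) * mat_adjoint U"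
proof -
  have d: "dim_row X = d" using U unfolding X unitary_mat_def by auto
  show ?thesis
    unfolding mat_fun_def d
  proof (rule the_equality)
    show "\<exists>U' l'. unitary_mat d U' \<and>
       X = U' * mat_diag d (\<lambda>i. complex_of_real (l' i)) * mat_adjoint U' \<and>
       U * mat_diag d (\<lambda>i. f (l i)) * mat_adjoint U =
       U' * mat_diag d (\<lambda>i. f (l' i)) * mat_adjoint U'"
      using U X by blast
  next
    fix Y assume "\<exists>V m. unitary_mat d V \<and>
       X = V * mat_diag d (\<lambda>i. complex_of_real (m i)) * mat_adjoint V \<and>
       Y = V * mat_diag d (\<lambda>i. f (m i)) * mat_adjoint V"
    then show "Y = U * mat_diag d (\<lambda>i. f (l i)) * mat_adjoint U"
      using mat_fun_aux[OF _ U] X by metis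
  qed
qed

end

(*
  In orthonormal eigenbases of \<rho>, \<sigma> and a Schmidt decomposition of \<psi>, everything is governed by
  the relative modular operator \<Delta> = \<sigma> \<otimes> (tr\<^sub>A \<psi>)\<^sup>-\<^sup>1: D(\<rho>||\<sigma>) = - \<langle>\<psi>|log \<Delta>|\<psi>\<rangle>, and the
  integrand of the optimizer is the projection onto \<Delta>\<^bsup>(1 + it)/2\<^esup> \<psi>.

  Lower bound: an extension \<tau> of \<sigma> satisfies \<tau> \<le> \<Delta> on the support, because a vector
  v = (X \<otimes> 1) \<psi> has \<langle>v|\<tau>|v\<rangle> \<le> tr (X\<^sup>* \<sigma> X); operator monotonicity of the logarithm, tested
  on \<psi> through resolvents, gives D(\<psi>||\<tau>) \<ge> D(\<rho>||\<sigma>).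

  Upper bound: let \<lambda>, u run through the eigenpairs of the optimizer and N be the number of distinct
  eigenvalues of \<Delta>.  With \<omega> = \<Sum> |u\<rangle>\<langle>u| / (N (\<lambda> + \<epsilon>)), the function
  g(z) = \<langle>\<psi>|\<omega>\<^bsup>z/2\<^esup> \<Delta>\<^bsup>z/2\<^esup>|\<psi>\<rangle> has g(0) = 1, |g| \<le> 1 on Re z = 0, and \<integral> beta0 |g(1 + it)|\<^sup>2 dt \<le> 1
  since the optimizer has rank at most N.  The infinitesimal form of Hirschman's three lines theorem
  for g\<^sup>2 yields Re g'(0) \<le> 0, that is D(\<psi>||optimizer) \<le> D(\<rho>||\<sigma>) + ln N.  For n-th tensor powers
  N is polynomial in n.

  A maximizer exists because eigenvalues and eigenbases vary in a compact set; averaging over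
  permutations does not decrease the expectation of the logarithm.
*)

theory Submission
  imports
    Defs
    "HOL-Complex_Analysis.Cauchy_Integral_Formula"
    "HOL-Real_Asymp.Real_Asymp"
    "Jordan_Normal_Form.Spectral_Radius"
begin

unbundle no vec_syntax
no_notation Inner_Product.real_inner_class.inner (infix "\<bullet>" 70)

subsection \<open>The weight \<open>beta0\<close> and its Fourier transform\<close>

text \<open>The explicit operator is an extension only if supp \<sigma> lies in supp \<rho>;
  otherwise part of \<sigma> is missing from its marginal. The estimates are therefore made for a
  positive operator of possibly smaller trace. Adding the missing marginal, tensored with the
  maximally mixed state of B, gives a genuine extension with no smaller log expectation, so the
  operator, the maximum and -n D(\<rho>||\<sigma>) fit into one sandwich. The function g enters
  squared because the optimizer, an average of projections, controls a second moment: on the line Re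
  z = 1 Cauchy-Schwarz bounds |g|^2 by a quadratic form of \<omega>, whose average is the trace of
  \<omega> times the optimizer. The factor 1 / N brings this trace below 1. As g^2 is a finite
  exponential sum, Hirschman's theorem becomes a statement about its coefficients: exp (i c t)
  integrates against \<open>beta0\<close> to k(c) = c / sinh c, and c = exp c k(c) - c coth c splits
  the derivative at 0 into one contribution of each boundary line. The shift \<epsilon> keeps
  \<omega> finite on the kernel of the optimizer; letting it tend to 0 also shows that \<psi> lies
  in the support when D(\<rho>||\<sigma>) is finite.\<close>

lemma beta0_cosh: "beta0 t = pi / 4 / (cosh (pi * t / 2))\<^sup>2"
  using cosh_double_cosh[of "pi * t / 2"] by (simp add: beta0_def field_simps)

lemma beta0_pos: "beta0 t > 0"
  by (simp add: beta0_cosh)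

lemma beta0_nonneg [simp]: "beta0 t \<ge> 0"
  using beta0_pos[of t] by linarith

lemma continuous_on_beta0 [continuous_intros]: "continuous_on S beta0"
  unfolding beta0_cosh by (intro continuous_intros) auto

lemma borel_measurable_beta0 [measurable]: "beta0 \<in> borel_measurable borel"
  by (intro borel_measurable_continuous_onI continuous_intros)

lemma DERIV_beta0_primitive: "((\<lambda>t. tanh (pi * t / 2) / 2) has_real_derivative beta0 x) (at x)"
proof -
  have "cosh (pi * x / 2) \<noteq> (0::real)" by simp
  then show ?thesis
    using cosh_square_eq[of "pi * x / 2"]
    by (auto intro!: derivative_eq_intros simp: beta0_cosh tanh_def field_simps power2_eq_square)
qed

lemma
  shows integrable_beta0: "integrable lborel beta0"
    and integral_beta0: "(LINT t|lborel. beta0 t) = 1"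
proof -
  have lim: "((\<lambda>t. tanh (pi * t / 2) / 2) \<longlongrightarrow> (1/2::real)) at_top"
    by (rule tendsto_eq_rhs[OF tendsto_divide[OF filterlim_compose[OF tanh_real_at_top] tendsto_const]])
      (real_asymp, auto)
  have lim2: "((\<lambda>t. tanh (pi * t / 2) / 2) \<longlongrightarrow> (-1/2::real)) at_bot"
    by (rule tendsto_eq_rhs[OF tendsto_divide[OF filterlim_compose[OF tanh_real_at_bot] tendsto_const]])
      (real_asymp, auto)
  have c: "isCont beta0 x" for x
    using continuous_on_beta0[of UNIV] continuous_on_eq_continuous_at by blast
  have "set_integrable lborel (einterval (-\<infinity>) \<infinity>) beta0"
    "(LBINT t=-\<infinity>..\<infinity>. beta0 t) = 1/2 - (-1/2)"
    using interval_integral_FTC_nonneg[of "-\<infinity>" \<infinity> "\<lambda>t. tanh (pi * t / 2) / 2" beta0 "-1/2" "1/2",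
        OF _ DERIV_beta0_primitive c] lim lim2 by (simp_all add: ereal_tendsto_simps)
  then show "integrable lborel beta0" "(LINT t|lborel. beta0 t) = 1"
    by (simp_all add: set_integrable_def interval_lebesgue_integral_def set_lebesgue_integral_def)
qed

lemma integrable_beta0_times:
  fixes f :: "real \<Rightarrow> 'a :: {banach, second_countable_topology, real_normed_algebra_1}"
  assumes "continuous_on UNIV f" and "\<And>t. norm (f t) \<le> B"
  shows "integrable lborel (\<lambda>t. of_real (beta0 t) * f t)"
proof (rule Bochner_Integration.integrable_bound)
  show "integrable lborel (\<lambda>t. B * beta0 t)" using integrable_beta0 by simp
  show "(\<lambda>t. of_real (beta0 t) * f t) \<in> borel_measurable lborel"
    using borel_measurable_continuous_onI[OF assms(1)] by measurable
  have "0 \<le> B" using assms(2)[of 0] norm_ge_zero order_trans by blast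
  have "norm (of_real (beta0 t) * f t) \<le> beta0 t * B" for t
    by (rule order_trans[OF norm_mult_ineq]) (use assms(2) in \<open>auto intro: mult_left_mono\<close>)
  then show "AE t in lborel. norm (of_real (beta0 t) * f t) \<le> norm (B * beta0 t)"
    using \<open>0 \<le> B\<close> by (intro AE_I2) (simp add: mult.commute abs_mult)
qed

section \<open>The Fourier transform of \<open>beta0\<close> by shifting the contour through one
  period of the kernel\<close>

lemma norm_cosh_ge:
  assumes "Re z \<ge> 0" shows "norm (cosh z) \<ge> sinh (Re z)"
proof -
  have "exp (Re z) - exp (- Re z) \<le> norm (exp z + exp (-z))"
    using norm_diff_ineq[of "exp z" "exp (-z)"] by simp
  then show ?thesis by (simp add: cosh_field_def sinh_field_def norm_divide)
qed

text \<open>The zeros of cosh (\<pi> z / 2) are the odd multiples of \<i>, and the open strip stops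
  short of -\<i> and 3 \<i>.\<close>

lemma cosh_eq_0_strip:
  assumes "cosh (of_real pi * z / 2) = 0" "-1 < Im z" "Im z < 3"
  shows "z = \<i>"
proof -
  have "exp (of_real pi * z / 2) = - exp (- (of_real pi * z / 2))"
    using assms(1) by (simp add: cosh_field_def eq_neg_iff_add_eq_0)
  then have "exp (of_real pi * z / 2) * exp (of_real pi * z / 2) = - 1"
    by (metis exp_not_eq_zero mult_minus_right exp_minus right_inverse)
  then have "exp (of_real pi * z) = exp (\<i> * of_real pi)"
    by (simp add: exp_add[symmetric] field_simps)
  then obtain n :: int where "of_real pi * z = \<i> * of_real pi + (of_int (2 * n) * pi) * \<i>"
    unfolding exp_eq by auto
  then have "of_real pi * z = of_real pi * (\<i> * (1 + 2 * of_int n))"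
    by (simp add: algebra_simps)
  then have z: "z = \<i> * (1 + 2 * of_int n)" by simp
  then have "Im z = 1 + 2 * of_int n" by simp
  with assms have "-1 < 1 + 2 * real_of_int n" "1 + 2 * real_of_int n < 3" by auto
  then have "n = 0" by linarith
  with z show ?thesis by simp
qed

text \<open>The zero of the denominator at \<i> is divided out and the removable singularity filled
  in, so that this entire function can be inverted in the whole strip.\<close>

definition cosh_quot :: "complex \<Rightarrow> complex" where
  "cosh_quot z = (if z = \<i> then deriv (\<lambda>z. cosh (of_real pi * z / 2)) \<i>
     else (cosh (of_real pi * z / 2) - cosh (of_real pi * \<i> / 2)) / (z - \<i>))"

lemma cosh_half_pi_i: "cosh (of_real pi * \<i> / 2) = 0"
proof -
  have "\<i> * (of_real pi * \<i> / 2) = of_real (- pi / 2)" by (simp add: mult.left_commute[of \<i>])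
  then show ?thesis by (simp only: cosh_conv_cos cos_of_real) simp
qed

lemma cosh_quot_holomorphic: "cosh_quot holomorphic_on S"
proof -
  have "(\<lambda>z. cosh (of_real pi * z / 2)) holomorphic_on UNIV"
    unfolding cosh_field_def by (intro holomorphic_intros) auto
  from pole_lemma_open[OF this open_UNIV, of \<i>] have "cosh_quot holomorphic_on UNIV"
    by (simp add: cosh_quot_def[abs_def])
  then show ?thesis by (rule holomorphic_on_subset) auto
qed

lemma cosh_quot_mult: "cosh_quot z * (z - \<i>) = cosh (of_real pi * z / 2)"
  by (auto simp: cosh_quot_def cosh_half_pi_i)

text \<open>The zero at \<i> is simple: where cosh vanishes, the square of sinh is -1.\<close>

lemma cosh_quot_nonzero:
  assumes "-1 < Im z" "Im z < 3" shows "cosh_quot z \<noteq> 0"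
proof (cases "z = \<i>")
  case True
  have "((\<lambda>z. cosh (of_real pi * z / 2)) has_field_derivative sinh (of_real pi * \<i> / 2) * (of_real pi / 2)) (at \<i>)"
    by (auto intro!: derivative_eq_intros)
  then have "cosh_quot z = sinh (of_real pi * \<i> / 2) * (of_real pi / 2)"
    unfolding cosh_quot_def using True by (simp add: DERIV_imp_deriv)
  moreover have "(sinh (of_real pi * \<i> / 2))\<^sup>2 = -1"
    using cosh_square_eq[of "of_real pi * \<i> / 2"] by (simp add: cosh_half_pi_i eq_neg_iff_add_eq_0)
  ultimately show ?thesis by auto
next
  case False
  then show ?thesis using cosh_eq_0_strip[of z] assms by (auto simp: cosh_quot_def cosh_half_pi_i)
qed

text \<open>The kernel \<open>beta0\<close> has double poles at odd multiples of \<open>\<i>\<close>; subtracting the Taylor polynomial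
  of \<open>e\<^sup>i\<^sup>c\<^sup>z\<close> at \<open>\<i>\<close> removes the one between the lines \<open>Im z = 0\<close> and \<open>Im z = 2\<close>.\<close>

definition exp_remainder :: "real \<Rightarrow> complex \<Rightarrow> complex" where
  "exp_remainder c z = exp (\<i> * c * z) - exp (- of_real c) * (1 + \<i> * c * (z - \<i>))"

text \<open>Two removable singularities are filled in one after the other, one for each order of the
  zero at \<i>.\<close>

lemma exp_remainder_factor:
  obtains G where "G holomorphic_on UNIV" "\<And>z. exp_remainder c z = G z * (z - \<i>)\<^sup>2"
proof -
  define n1 where "n1 z = (if z = \<i> then deriv (exp_remainder c) \<i> else (exp_remainder c z - exp_remainder c \<i>) / (z - \<i>))" for z
  define n2 where "n2 z = (if z = \<i> then deriv n1 \<i> else (n1 z - n1 \<i>) / (z - \<i>))" for z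
  have "exp_remainder c holomorphic_on UNIV"
    unfolding exp_remainder_def by (intro holomorphic_intros)
  then have "n1 holomorphic_on UNIV" unfolding n1_def by (intro pole_lemma_open) auto
  then have n2: "n2 holomorphic_on UNIV" unfolding n2_def by (intro pole_lemma_open) auto
  have ii: "\<i> * complex_of_real c * \<i> = - of_real c" by (simp add: complex_eq_iff)
  then have 0: "exp_remainder c \<i> = 0"
    by (simp add: exp_remainder_def)
  have "(exp_remainder c has_field_derivative exp (\<i> * c * \<i>) * (\<i> * c) - exp (- of_real c) * (\<i> * c)) (at \<i>)"
    unfolding exp_remainder_def by (auto intro!: derivative_eq_intros)
  from DERIV_imp_deriv[OF this] have "n1 \<i> = 0"
    by (simp add: n1_def ii)
  then have "exp_remainder c z = n2 z * (z - \<i>)\<^sup>2" for z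
    by (cases "z = \<i>") (simp_all add: 0 n2_def n1_def power2_eq_square)
  with n2 show thesis using that by blast
qed


text \<open>Growth at most linear in Re z on the closed strip loses against the exponential decay of
  the kernel; this makes the vertical sides of the contour vanish.\<close>

lemma norm_exp_remainder_le:
  assumes "0 \<le> Im z" "Im z \<le> 2"
  shows "norm (exp_remainder c z) \<le> exp (2 * \<bar>c\<bar>) * (2 + 3 * \<bar>c\<bar> + \<bar>c\<bar> * \<bar>Re z\<bar>)"
proof -
  have "norm (exp (\<i> * c * z)) = exp (- c * Im z)" by simp
  also have "- c * Im z \<le> \<bar>c\<bar> * 2"
    using assms by (metis abs_ge_minus_self abs_ge_zero mult_mono mult_minus_left)
  finally have 1: "norm (exp (\<i> * c * z)) \<le> exp (2 * \<bar>c\<bar>)" by (simp add: mult.commute)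
  have "norm (z - \<i>) \<le> \<bar>Re z\<bar> + \<bar>Im z - 1\<bar>" using cmod_le[of "z - \<i>"] by simp
  then have "norm (z - \<i>) \<le> \<bar>Re z\<bar> + 3" using assms by linarith
  then have "norm (\<i> * c * (z - \<i>)) \<le> \<bar>c\<bar> * (\<bar>Re z\<bar> + 3)"
    by (simp add: norm_mult mult_left_mono)
  then have "norm (1 + \<i> * c * (z - \<i>)) \<le> 1 + \<bar>c\<bar> * (\<bar>Re z\<bar> + 3)"
    using norm_triangle_ineq[of 1 "\<i> * c * (z - \<i>)"] by simp
  moreover have "norm (exp (- complex_of_real c)) \<le> exp (2 * \<bar>c\<bar>)" by simp
  ultimately have "norm (exp (- complex_of_real c) * (1 + \<i> * c * (z - \<i>)))
      \<le> exp (2 * \<bar>c\<bar>) * (1 + \<bar>c\<bar> * (\<bar>Re z\<bar> + 3))"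
    unfolding norm_mult by (intro mult_mono) auto
  with 1 have "norm (exp_remainder c z) \<le> exp (2 * \<bar>c\<bar>) + exp (2 * \<bar>c\<bar>) * (1 + \<bar>c\<bar> * (\<bar>Re z\<bar> + 3))"
    unfolding exp_remainder_def by (intro order_trans[OF norm_triangle_ineq4]) linarith
  then show ?thesis by (simp add: algebra_simps)
qed

lemma norm_cosh_ge_abs: "norm (cosh z) \<ge> sinh \<bar>Re z\<bar>"
  using norm_cosh_ge[of z] norm_cosh_ge[of "-z"] by (cases "Re z \<ge> 0") (auto simp: abs_if)

lemma cosh_shift: "cosh (z + \<i> * of_real pi) = - cosh z"
  by (simp add: cosh_field_def exp_add exp_diff exp_minus[of "\<i> * _"] field_simps)

lemma cosh_complex_of_real: "cosh (complex_of_real x) = of_real (cosh x)"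
  by (simp add: cosh_field_def exp_of_real[symmetric])

lemma integrable_beta0_exp: "integrable lborel (\<lambda>t. of_real (beta0 t) * exp (\<i> * complex_of_real c * of_real t))"
  by (rule integrable_beta0_times[where B = 1]) (auto intro!: continuous_intros)

text \<open>Once the pole is removed, the integrand \<open>F\<close> is holomorphic in a convex
  strip and has a primitive \<open>P\<close> there. The difference of \<open>F\<close> on the lines
  Im z = 0 and Im z = 2 has the primitive \<open>Q\<close>, which tends to 0 at both ends. Its
  integral therefore vanishes, and this is a linear equation for the Fourier integral.\<close>

lemma fourier_beta0:
  assumes "c \<noteq> 0"
  shows "(LINT t|lborel. of_real (beta0 t) * exp (\<i> * complex_of_real c * of_real t)) = of_real (c / sinh c)"
proof -
  define S where "S = {z. -1 < Im z \<and> Im z < 3}"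
  have S: "open S" "convex S"
    unfolding S_def using open_halfspace_Im_gt[of "-1"] open_halfspace_Im_lt[of 3]
      convex_halfspace_Im_gt[of "-1"] convex_halfspace_Im_lt[of 3]
    by (auto simp: Collect_conj_eq intro!: open_Int convex_Int)
  obtain G where G: "G holomorphic_on UNIV" and G_eq: "\<And>z. exp_remainder c z = G z * (z - \<i>)\<^sup>2"
    using exp_remainder_factor[of c] by blast
  define F where "F z = of_real (pi / 4) * G z / (cosh_quot z)\<^sup>2" for z
  have hol: "F holomorphic_on S"
    unfolding F_def using cosh_quot_nonzero
    by (intro holomorphic_intros cosh_quot_holomorphic holomorphic_on_subset[OF G]) (auto simp: S_def)
  have "\<exists>P. \<forall>x\<in>S. (P has_field_derivative F x) (at x within S)"
  proof (rule holomorphic_convex_primitive'[OF S(2,1) hol])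
    fix g assume "\<And>x. x \<in> S \<Longrightarrow> (g has_field_derivative F x) (at x within S)"
    then show ?thesis by (intro exI[of _ g] ballI)
  qed
  then obtain P where P0: "\<forall>x\<in>S. (P has_field_derivative F x) (at x within S)" ..
  have P: "(P has_field_derivative F x) (at x)" if "x \<in> S" for x
    using bspec[OF P0 that] unfolding at_within_open[OF that S(1)] .
  have F_eq: "F z = of_real (pi / 4) * exp_remainder c z / (cosh (of_real pi * z / 2))\<^sup>2" if "z \<noteq> \<i>" for z
    using that by (simp add: F_def G_eq cosh_quot_mult[symmetric] power_mult_distrib)
  define Q where "Q t = P (of_real t) - P (of_real t + 2 * \<i>)" for t :: real
  \<comment> \<open>The shift by 2 \<i> preserves the kernel, multiplies the exponential by exp (-2
    c) and changes the Taylor polynomial by a constant, so only the Fourier integrand and a multiple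
    of \<open>beta0\<close> remain.\<close>
  define q where "q t = of_real (beta0 t) * ((1 - exp (- 2 * complex_of_real c)) * exp (\<i> * complex_of_real c * of_real t)
      - 2 * of_real c * exp (- complex_of_real c))" for t :: real
  have q: "F (of_real t) - F (of_real t + 2 * \<i>) = q t" for t
  proof -
    have "complex_of_real t \<noteq> \<i>" "complex_of_real t + 2 * \<i> \<noteq> \<i>" by (auto simp: complex_eq_iff)
    moreover have "of_real pi * complex_of_real t / 2 = of_real (pi * t / 2)" by simp
    then have c1: "cosh (of_real pi * complex_of_real t / 2) = of_real (cosh (pi * t / 2))"
      by (simp only: cosh_complex_of_real)
    moreover have "of_real pi * (complex_of_real t + 2 * \<i>) / 2 = of_real pi * complex_of_real t / 2 + \<i> * of_real pi"
      by (simp add: field_simps)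
    then have "cosh (of_real pi * (complex_of_real t + 2 * \<i>) / 2) = - of_real (cosh (pi * t / 2))"
      by (simp only: cosh_shift c1)
    ultimately have 1: "F (of_real t) - F (of_real t + 2 * \<i>)
        = of_real (beta0 t) * (exp_remainder c (of_real t) - exp_remainder c (of_real t + 2 * \<i>))"
      by (simp add: F_eq beta0_cosh diff_divide_distrib right_diff_distrib)
    have "\<i> * complex_of_real c * (of_real t + 2 * \<i>) = \<i> * c * of_real t + - 2 * of_real c"
      by (simp add: algebra_simps)
    then have "exp_remainder c (of_real t) - exp_remainder c (of_real t + 2 * \<i>)
      = (1 - exp (- 2 * complex_of_real c)) * exp (\<i> * c * of_real t) - 2 * of_real c * exp (- complex_of_real c)"
      unfolding exp_remainder_def by (simp only: exp_add) (simp add: algebra_simps)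
    with 1 show ?thesis by (simp add: q_def)
  qed
  have DQ: "(Q has_vector_derivative q t) (at t within A)" for t A
  proof -
    have "(P has_field_derivative F (of_real t)) (at (of_real t))"
      "(P has_field_derivative F (of_real t + 2 * \<i>)) (at (of_real t + 2 * \<i>))"
      by (auto intro!: P simp: S_def)
    then have "((\<lambda>z. P z - P (z + 2 * \<i>)) has_field_derivative F (of_real t) - F (of_real t + 2 * \<i>)) (at (of_real t))"
      by (auto intro!: derivative_eq_intros DERIV_chain2[of P])
    from has_vector_derivative_real_field[OF this] show ?thesis
      by (simp add: Q_def[abs_def] q o_def has_vector_derivative_at_within)
  qed
  have cont_q: "continuous_on A q" for A
    unfolding q_def by (intro continuous_intros)
  have int_e: "integrable lborel (\<lambda>t. of_real (beta0 t) * exp (\<i> * complex_of_real c * of_real t))"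
    by (rule integrable_beta0_exp)
  have int_b: "integrable lborel (\<lambda>t. complex_of_real (beta0 t))"
    using integrable_beta0 by (rule integrable_of_real)
  have q': "q = (\<lambda>t. (1 - exp (- 2 * complex_of_real c)) * (of_real (beta0 t) * exp (\<i> * complex_of_real c * of_real t))
      - 2 * of_real c * exp (- complex_of_real c) * of_real (beta0 t))"
    by (auto simp: q_def algebra_simps)
  have int_q: "integrable lborel q"
    unfolding q' by (intro Bochner_Integration.integrable_diff integrable_mult_right int_e int_b)
  have "(\<lambda>m. LINT t|lborel. indicator {- real m..real m} t *\<^sub>R q t) \<longlonglongrightarrow> (LINT t|lborel. q t)"
  proof (rule integral_dominated_convergence[where w = "\<lambda>t. norm (q t)"])
    show "AE t in lborel. (\<lambda>m. indicator {- real m..real m} t *\<^sub>R q t) \<longlonglongrightarrow> q t"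
    proof (rule AE_I2)
      fix t :: real
      obtain m0 :: nat where "\<bar>t\<bar> \<le> real m0" using real_arch_simple by blast
      then have "indicator {- real m..real m} t *\<^sub>R q t = q t" if "m \<ge> m0" for m
        using that by (simp add: indicator_def) linarith
      then have "\<forall>\<^sub>F m in sequentially. indicator {- real m..real m} t *\<^sub>R q t = q t"
        unfolding eventually_sequentially by blast
      then show "(\<lambda>m. indicator {- real m..real m} t *\<^sub>R q t) \<longlonglongrightarrow> q t"
        by (rule tendsto_eventually)
    qed
  qed (use int_q in \<open>auto simp: indicator_def intro!: AE_I2 integrable_norm\<close>)
  also have "(\<lambda>m. LINT t|lborel. indicator {- real m..real m} t *\<^sub>R q t) = (\<lambda>m. Q (real m) - Q (- real m))"
    by (intro ext integral_FTC_atLeastAtMost DQ cont_q) auto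
  finally have lim1: "(\<lambda>m. Q (real m) - Q (- real m)) \<longlonglongrightarrow> (LINT t|lborel. q t)" .
  define a b where "a = exp (2 * \<bar>c\<bar>) * (2 + 3 * \<bar>c\<bar>)" and "b = exp (2 * \<bar>c\<bar>) * \<bar>c\<bar>"
  \<comment> \<open>The mean value estimate for \<open>P\<close> on the vertical segment of length 2
    from x to x + 2 \<i>.\<close>
  have Q_bound: "norm (Q x) \<le> pi / 2 * (a * (1 / (sinh (pi * \<bar>x\<bar> / 2))\<^sup>2) + b * (\<bar>x\<bar> / (sinh (pi * \<bar>x\<bar> / 2))\<^sup>2))"
    if "x \<noteq> 0" for x
  proof -
    have "norm (P (of_real x) - P (of_real x + 2 * \<i>))
      \<le> (pi / 4 * ((a + b * \<bar>x\<bar>) / (sinh (pi * \<bar>x\<bar> / 2))\<^sup>2)) * norm (of_real x - (of_real x + 2 * \<i>))"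
    proof (rule field_differentiable_bound[of "{z. Re z = x \<and> 0 \<le> Im z \<and> Im z \<le> 2}" P F])
      show "convex {z. Re z = x \<and> 0 \<le> Im z \<and> Im z \<le> 2}"
        using convex_halfspace_Im_ge[of 0] convex_halfspace_Im_le[of 2] convex_halfspace_Re_ge[of x] convex_halfspace_Re_le[of x]
        by (auto simp: Collect_conj_eq order_eq_iff intro!: convex_Int)
      fix z assume z: "z \<in> {z. Re z = x \<and> 0 \<le> Im z \<and> Im z \<le> 2}"
      then show "(P has_field_derivative F z) (at z within {z. Re z = x \<and> 0 \<le> Im z \<and> Im z \<le> 2})"
        by (intro has_field_derivative_at_within[OF P]) (auto simp: S_def)
      have "z \<noteq> \<i>" using z that by auto
      have pos: "0 < sinh (pi * \<bar>x\<bar> / 2)" using that by simp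
      have "sinh (pi * \<bar>x\<bar> / 2) \<le> norm (cosh (of_real pi * z / 2))"
        using norm_cosh_ge_abs[of "of_real pi * z / 2"] z by (simp add: abs_mult)
      then have "(sinh (pi * \<bar>x\<bar> / 2))\<^sup>2 \<le> (norm (cosh (of_real pi * z / 2)))\<^sup>2"
        using pos by (intro power_mono) auto
      moreover have "norm (exp_remainder c z) \<le> a + b * \<bar>x\<bar>"
        using norm_exp_remainder_le[of z c] z by (simp add: a_def b_def algebra_simps)
      moreover have "0 < (sinh (pi * \<bar>x\<bar> / 2))\<^sup>2" using pos by (rule zero_less_power)
      ultimately have "norm (exp_remainder c z) / (norm (cosh (of_real pi * z / 2)))\<^sup>2
          \<le> (a + b * \<bar>x\<bar>) / (sinh (pi * \<bar>x\<bar> / 2))\<^sup>2"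
        by (intro frac_le) (auto intro: order_trans[OF norm_ge_zero])
      then have "pi / 4 * (norm (exp_remainder c z) / (norm (cosh (of_real pi * z / 2)))\<^sup>2)
          \<le> pi / 4 * ((a + b * \<bar>x\<bar>) / (sinh (pi * \<bar>x\<bar> / 2))\<^sup>2)"
        by (intro mult_left_mono) auto
      then show "norm (F z) \<le> pi / 4 * ((a + b * \<bar>x\<bar>) / (sinh (pi * \<bar>x\<bar> / 2))\<^sup>2)"
        using \<open>z \<noteq> \<i>\<close> by (simp add: F_eq norm_mult norm_divide norm_power)
    qed auto
    then show ?thesis by (simp add: Q_def norm_mult algebra_simps add_divide_distrib)
  qed
  have lim0: "(\<lambda>m::nat. pi / 2 * (a * (1 / (sinh (pi * \<bar>real m\<bar> / 2))\<^sup>2) + b * (\<bar>real m\<bar> / (sinh (pi * \<bar>real m\<bar> / 2))\<^sup>2))) \<longlonglongrightarrow> 0"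
  proof -
    have "(\<lambda>m::nat. 1 / (sinh (pi * \<bar>real m\<bar> / 2))\<^sup>2) \<longlonglongrightarrow> 0"
      "(\<lambda>m::nat. \<bar>real m\<bar> / (sinh (pi * \<bar>real m\<bar> / 2))\<^sup>2) \<longlonglongrightarrow> 0"
      by real_asymp+
    from tendsto_mult_left[OF tendsto_add[OF tendsto_mult_left[OF this(1), of a] tendsto_mult_left[OF this(2), of b]], of "pi / 2"]
    show ?thesis by simp
  qed
  have Q_le: "norm (Q (real m)) \<le> pi / 2 * (a * (1 / (sinh (pi * \<bar>real m\<bar> / 2))\<^sup>2) + b * (\<bar>real m\<bar> / (sinh (pi * \<bar>real m\<bar> / 2))\<^sup>2))"
    "norm (Q (- real m)) \<le> pi / 2 * (a * (1 / (sinh (pi * \<bar>real m\<bar> / 2))\<^sup>2) + b * (\<bar>real m\<bar> / (sinh (pi * \<bar>real m\<bar> / 2))\<^sup>2))"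
    if "1 \<le> m" for m :: nat
    using Q_bound[of "real m"] Q_bound[of "- real m"] that by simp_all
  have lim2: "(\<lambda>m. Q (real m)) \<longlonglongrightarrow> 0"
    by (rule Lim_null_comparison[OF eventually_sequentiallyI[of 1] lim0]) (rule Q_le(1))
  have lim3: "(\<lambda>m. Q (- real m)) \<longlonglongrightarrow> 0"
    by (rule Lim_null_comparison[OF eventually_sequentiallyI[of 1] lim0]) (rule Q_le(2))
  have "(LINT t|lborel. q t) = 0"
    using LIMSEQ_unique[OF lim1 tendsto_diff[OF lim2 lim3]] by simp
  moreover have "(LINT t|lborel. q t) = (1 - exp (- 2 * complex_of_real c)) *
      (LINT t|lborel. of_real (beta0 t) * exp (\<i> * complex_of_real c * of_real t)) - 2 * of_real c * exp (- complex_of_real c)"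
    unfolding q' using int_e int_b
    by (simp add: integral_beta0 del: of_real_minus exp_of_real of_real_mult)
  moreover have "(1 - exp (- 2 * complex_of_real c)) = exp (- of_real c) * (2 * of_real (sinh c))"
    by (simp add: sinh_field_def exp_of_real[symmetric] algebra_simps exp_add[symmetric])
  moreover have "exp (- complex_of_real c) \<noteq> 0" by simp
  ultimately have "exp (- complex_of_real c) * (2 * (of_real (sinh c) *
      (LINT t|lborel. of_real (beta0 t) * exp (\<i> * complex_of_real c * of_real t))))
      = exp (- complex_of_real c) * (2 * of_real c)"
    by (simp only: mult_ac) simp
  then have "of_real (sinh c) * (LINT t|lborel. of_real (beta0 t) * exp (\<i> * complex_of_real c * of_real t)) = of_real c"
    by simp
  then show ?thesis using assms by (simp add: field_simps)
qed

section \<open>Hirschman's inequality for finite exponential sums\<close>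

lemma integral_beta0_exp_polynomial:
  fixes b :: "'i \<Rightarrow> complex" and c :: "'i \<Rightarrow> real"
  assumes "finite I"
  shows "(LINT t|lborel. of_real (beta0 t) * (\<Sum>i\<in>I. b i * exp (\<i> * of_real (c i) * of_real t)))
    = (\<Sum>i\<in>I. b i * of_real (if c i = 0 then 1 else c i / sinh (c i)))"
proof -
  have int_b: "integrable lborel (\<lambda>t. complex_of_real (beta0 t))"
    using integrable_beta0 by (rule integrable_of_real)
  have e: "(LINT t|lborel. of_real (beta0 t) * exp (\<i> * complex_of_real x * of_real t))
      = of_real (if x = 0 then 1 else x / sinh x)" for x
    using fourier_beta0[of x] int_b by (simp add: integral_beta0)
  have "(LINT t|lborel. of_real (beta0 t) * (\<Sum>i\<in>I. b i * exp (\<i> * of_real (c i) * of_real t)))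
    = (LINT t|lborel. (\<Sum>i\<in>I. b i * (of_real (beta0 t) * exp (\<i> * complex_of_real (c i) * of_real t))))"
    by (simp add: sum_distrib_left mult_ac)
  also have "\<dots> = (\<Sum>i\<in>I. LINT t|lborel. b i * (of_real (beta0 t) * exp (\<i> * complex_of_real (c i) * of_real t)))"
    by (intro Bochner_Integration.integral_sum integrable_mult_right integrable_beta0_exp)
  also have "\<dots> = (\<Sum>i\<in>I. b i * of_real (if c i = 0 then 1 else c i / sinh (c i)))"
    by (simp only: integral_mult_right_zero e)
  finally show ?thesis .
qed

lemma norm_exp_polynomial_le:
  "norm (\<Sum>i\<in>I. b i * exp (\<i> * complex_of_real (c i) * of_real t)) \<le> (\<Sum>i\<in>I. norm (b i))"
  by (rule order_trans[OF norm_sum]) (simp add: norm_mult)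

lemma norm_integral_beta0_le:
  fixes f :: "real \<Rightarrow> complex"
  shows "norm (LINT t|lborel. of_real (beta0 t) * f t) \<le> (LINT t|lborel. beta0 t * norm (f t))"
proof -
  have "norm (LINT t|lborel. of_real (beta0 t) * f t) \<le> (LINT t|lborel. norm (of_real (beta0 t) * f t))"
    by (rule integral_norm_bound)
  then show ?thesis by (simp add: norm_mult)
qed

text \<open>Iterating this at \<open>c/2, c/4, \<dots>\<close> writes \<open>c coth c - 1\<close> as a series of terms \<open>1 - x / sinh x\<close>, which
  are integrals of \<open>1 - cos (x t)\<close> against \<open>beta0\<close>.\<close>

lemma coth_duplication:
  assumes "c \<noteq> (0::real)"
  shows "c * cosh c / sinh c = 2 * ((c / 2) * cosh (c / 2) / sinh (c / 2)) - c / sinh c"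
proof -
  define x where "x = c / 2"
  have x: "c = 2 * x" "sinh x \<noteq> 0" "cosh x \<noteq> 0" using assms by (auto simp: x_def)
  have "cosh (2 * x) + 1 = 2 * (cosh x)\<^sup>2" by (simp add: cosh_double_cosh)
  then have "(cosh c + 1) / sinh c = cosh x / sinh x"
    using x by (simp add: sinh_double power2_eq_square)
  then have "c * ((cosh c + 1) / sinh c) = c * (cosh x / sinh x)" by simp
  then show ?thesis unfolding x_def by (simp add: algebra_simps add_divide_distrib)
qed

lemma coth_telescope:
  fixes c :: real
  defines "k \<equiv> \<lambda>x::real. if x = 0 then 1 else x / sinh x"
    and "C \<equiv> \<lambda>x::real. if x = 0 then 1 else x * cosh x / sinh x"
  shows "C c - 1 = (\<Sum>j<m. 2 ^ j * (1 - k (c / 2 ^ j))) + 2 ^ m * (C (c / 2 ^ m) - 1)"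
proof (induction m)
  case (Suc m)
  have "C x - 1 = (1 - k x) + 2 * (C (x / 2) - 1)" for x
    using coth_duplication[of x] by (simp add: C_def k_def)
  then have "2 ^ m * (C (c / 2 ^ m) - 1) = 2 ^ m * ((1 - k (c / 2 ^ m)) + 2 * (C (c / 2 ^ m / 2) - 1))"
    by metis
  also have "\<dots> = 2 ^ m * (1 - k (c / 2 ^ m)) + 2 ^ Suc m * (C (c / 2 ^ Suc m) - 1)"
    by (simp add: algebra_simps)
  finally show ?case
    using Suc by simp
qed simp

text \<open>Near 0, x coth x - 1 is of order x^2, which beats the factor 2^m.\<close>

lemma coth_telescope_limit:
  fixes c :: real
  shows "(\<lambda>m. 2 ^ m * ((if c / 2 ^ m = 0 then 1 else c / 2 ^ m * cosh (c / 2 ^ m) / sinh (c / 2 ^ m)) - 1)) \<longlonglongrightarrow> 0"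
proof (cases "c = 0")
  case False
  have "((\<lambda>x. (1 / x) * ((if c * x = 0 then 1 else c * x * cosh (c * x) / sinh (c * x)) - 1)) \<longlongrightarrow> 0) (at_right 0)"
  proof -
    have "((\<lambda>x. (1 / x) * ((c * x * cosh (c * x) / sinh (c * x)) - 1)) \<longlongrightarrow> 0) (at_right 0)"
    proof (cases "c > 0")
      case True then show ?thesis by real_asymp
    next
      case False with \<open>c \<noteq> 0\<close> have "c < 0" by simp
      then show ?thesis by real_asymp
    qed
    then show ?thesis
      by (rule Lim_transform_eventually) (use False in \<open>auto intro!: eventually_at_right_less eventually_mono[OF eventually_at_right_less]\<close>)
  qed
  moreover have "filterlim (\<lambda>m. 1 / 2 ^ m :: real) (at_right 0) sequentially" by real_asymp
  ultimately have "(\<lambda>m. 1 / (1 / 2 ^ m) * ((if c * (1 / 2 ^ m) = 0 then 1 else c * (1 / 2 ^ m) * cosh (c * (1 / 2 ^ m)) / sinh (c * (1 / 2 ^ m))) - 1)) \<longlonglongrightarrow> 0"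
    by (rule filterlim_compose)
  then show ?thesis by (simp only: times_divide_eq_right mult_1_right divide_divide_eq_right mult_1_left div_by_1)
qed simp

text \<open>The infinitesimal form at \<open>z = 0\<close> of Hirschman's three lines theorem in the strip
  \<open>0 \<le> Re z \<le> 1\<close>; \<open>beta0\<close> is the limit of the harmonic measure of the line \<open>Re z = 1\<close>.\<close>

lemma Re_derivative_le_0:
  fixes b :: "'i \<Rightarrow> complex" and c :: "'i \<Rightarrow> real"
  assumes fin: "finite I" and b1: "(\<Sum>i\<in>I. b i) = 1"
    and bd: "\<And>t. norm (\<Sum>i\<in>I. b i * exp (\<i> * of_real (c i) * of_real t)) \<le> 1"
    and int1: "(LINT t|lborel. beta0 t * norm (\<Sum>i\<in>I. b i * exp (of_real (c i) * (1 + \<i> * of_real t)))) \<le> 1"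
  shows "Re (\<Sum>i\<in>I. b i * c i) \<le> 0"
proof -
  define k where "k x = (if x = 0 then 1 else x / sinh x)" for x :: real
  define C where "C x = (if x = 0 then 1 else x * cosh x / sinh x)" for x :: real
  \<comment> \<open>This is exp x - cosh x = sinh x multiplied by x / sinh x. The term exp x * k x
    is controlled by the line Re z = 1, and \<open>C\<close>, through its series, by the line Re z =
    0.\<close>
  have ck: "x = exp x * k x - C x" for x
  proof (cases "x = 0")
    case False
    then have "exp x - cosh x = sinh x" "sinh x \<noteq> 0" by (simp_all add: cosh_field_def sinh_field_def field_simps)
    then have "exp x * k x - C x = x * sinh x / sinh x"
      using False by (simp add: k_def C_def diff_divide_distrib[symmetric] right_diff_distrib[symmetric] mult.commute)
    with False show ?thesis by simp
  qed (simp add: k_def C_def)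
  have A: "Re (\<Sum>i\<in>I. b i * of_real (exp (c i) * k (c i))) \<le> 1"
  proof -
    have "(\<Sum>i\<in>I. b i * of_real (exp (c i) * k (c i))) =
        (LINT t|lborel. of_real (beta0 t) * (\<Sum>i\<in>I. (b i * exp (of_real (c i))) * exp (\<i> * of_real (c i) * of_real t)))"
      by (subst integral_beta0_exp_polynomial[OF fin]) (simp add: k_def exp_of_real mult.assoc)
    also have "norm \<dots> \<le> (LINT t|lborel. beta0 t * norm (\<Sum>i\<in>I. (b i * exp (of_real (c i))) * exp (\<i> * of_real (c i) * of_real t)))"
      by (rule norm_integral_beta0_le)
    also have "\<dots> \<le> 1"
      using int1 by (simp add: ring_distribs exp_add mult_ac)
    finally show ?thesis using complex_Re_le_cmod order_trans by blast
  qed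
  \<comment> \<open>The bound on the line Re z = 0 is used at t / 2^j; the number 1 comes from the
    normalization of \<open>beta0\<close>.\<close>
  have B: "Re (\<Sum>i\<in>I. b i * of_real (1 - k (c i / 2 ^ j))) \<ge> 0" for j
  proof -
    have "(\<Sum>i\<in>I. b i * of_real (k (c i / 2 ^ j))) =
        (LINT t|lborel. of_real (beta0 t) * (\<Sum>i\<in>I. b i * exp (\<i> * of_real (c i / 2 ^ j) * of_real t)))"
      by (subst integral_beta0_exp_polynomial[OF fin]) (simp add: k_def)
    also have "norm \<dots> \<le> (LINT t|lborel. beta0 t * norm (\<Sum>i\<in>I. b i * exp (\<i> * of_real (c i / 2 ^ j) * of_real t)))"
      by (rule norm_integral_beta0_le)
    also have "\<dots> \<le> (LINT t|lborel. beta0 t)"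
    proof (rule integral_mono)
      show "integrable lborel (\<lambda>t. beta0 t * norm (\<Sum>i\<in>I. b i * exp (\<i> * of_real (c i / 2 ^ j) * of_real t)))"
        using integrable_beta0_times[of "\<lambda>t. norm (\<Sum>i\<in>I. b i * exp (\<i> * of_real (c i / 2 ^ j) * of_real t))" "\<Sum>i\<in>I. norm (b i)"]
          norm_exp_polynomial_le[where b = b and c = "\<lambda>i. c i / 2 ^ j" and I = I]
        by (simp add: continuous_intros)
      fix t
      have "norm (\<Sum>i\<in>I. b i * exp (\<i> * of_real (c i / 2 ^ j) * of_real t)) \<le> 1"
        using bd[of "t / 2 ^ j"] by simp
      then show "beta0 t * norm (\<Sum>i\<in>I. b i * exp (\<i> * of_real (c i / 2 ^ j) * of_real t)) \<le> beta0 t"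
        by (simp add: mult_left_le)
    qed (rule integrable_beta0)
    finally have "Re (\<Sum>i\<in>I. b i * of_real (k (c i / 2 ^ j))) \<le> 1"
      using complex_Re_le_cmod order_trans integral_beta0 by metis
    then show ?thesis using b1 by (simp add: algebra_simps sum_subtractf)
  qed
  \<comment> \<open>By \<open>B\<close> the terms of the telescoped series are nonnegative. Dropping
    them leaves a remainder that tends to 0, which bounds the left side from below by 0.\<close>
  have C_eq: "Re (\<Sum>i\<in>I. b i * of_real (C (c i) - 1)) =
      (\<Sum>j<m. 2 ^ j * Re (\<Sum>i\<in>I. b i * of_real (1 - k (c i / 2 ^ j)))) + (\<Sum>i\<in>I. Re (b i) * (2 ^ m * (C (c i / 2 ^ m) - 1)))" for m
  proof -
    have "Re (\<Sum>i\<in>I. b i * of_real (C (c i) - 1)) = (\<Sum>i\<in>I. Re (b i) * (C (c i) - 1))" by simp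
    also have "\<dots> = (\<Sum>i\<in>I. Re (b i) * ((\<Sum>j<m. 2 ^ j * (1 - k (c i / 2 ^ j))) + 2 ^ m * (C (c i / 2 ^ m) - 1)))"
      using coth_telescope[of _ m] unfolding k_def C_def by (intro sum.cong refl arg_cong2[of _ _ _ _ "(*)"]) blast
    also have "\<dots> = (\<Sum>i\<in>I. \<Sum>j<m. Re (b i) * (2 ^ j * (1 - k (c i / 2 ^ j)))) + (\<Sum>i\<in>I. Re (b i) * (2 ^ m * (C (c i / 2 ^ m) - 1)))"
      by (simp add: distrib_left sum.distrib sum_distrib_left)
    also have "(\<Sum>i\<in>I. \<Sum>j<m. Re (b i) * (2 ^ j * (1 - k (c i / 2 ^ j)))) = (\<Sum>j<m. 2 ^ j * Re (\<Sum>i\<in>I. b i * of_real (1 - k (c i / 2 ^ j))))"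
      by (subst sum.swap) (simp add: sum_distrib_left mult_ac)
    finally show ?thesis .
  qed
  have "(\<lambda>m. \<Sum>i\<in>I. Re (b i) * (2 ^ m * (C (c i / 2 ^ m) - 1))) \<longlonglongrightarrow> (\<Sum>i\<in>I. Re (b i) * 0)"
    unfolding C_def by (intro tendsto_sum tendsto_mult tendsto_const coth_telescope_limit)
  moreover have "(\<Sum>i\<in>I. Re (b i) * (2 ^ m * (C (c i / 2 ^ m) - 1))) \<le> Re (\<Sum>i\<in>I. b i * of_real (C (c i) - 1))" for m
    unfolding C_eq[of m] using B by (simp add: sum_nonneg del: of_real_diff Re_sum)
  ultimately have "(\<Sum>i\<in>I. Re (b i) * 0) \<le> Re (\<Sum>i\<in>I. b i * of_real (C (c i) - 1))"
    by (intro LIMSEQ_le_const2) auto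
  then have "0 \<le> Re (\<Sum>i\<in>I. b i * of_real (C (c i) - 1))" by simp
  also have "(\<Sum>i\<in>I. b i * of_real (C (c i) - 1)) = (\<Sum>i\<in>I. b i * of_real (C (c i))) - 1"
    using b1 by (simp add: algebra_simps sum_subtractf)
  finally have "1 \<le> Re (\<Sum>i\<in>I. b i * of_real (C (c i)))" by simp
  moreover have "(\<Sum>i\<in>I. b i * c i) = (\<Sum>i\<in>I. b i * of_real (exp (c i) * k (c i) - C (c i)))"
    using ck by simp
  then have "(\<Sum>i\<in>I. b i * c i) = (\<Sum>i\<in>I. b i * of_real (exp (c i) * k (c i))) - (\<Sum>i\<in>I. b i * of_real (C (c i)))"
    by (simp only: of_real_diff right_diff_distrib sum_subtractf)
  ultimately show ?thesis using A by simp
qed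

subsection \<open>Diagonalisation of Hermitian matrices\<close>

text \<open>Plain index functions keep all later computations inside finite sums. The columns play
  the part of an orthonormal basis, and the rows give its completeness relation.\<close>

definition unitary_fun :: "nat \<Rightarrow> (nat \<Rightarrow> nat \<Rightarrow> complex) \<Rightarrow> bool" where
  "unitary_fun d U \<longleftrightarrow>
     (\<forall>k<d. \<forall>l<d. (\<Sum>i<d. U i k * cnj (U i l)) = (if k = l then 1 else 0)) \<and>
     (\<forall>i<d. \<forall>j<d. (\<Sum>k<d. U i k * cnj (U j k)) = (if i = j then 1 else 0))"

definition spectral :: "nat \<Rightarrow> complex mat \<Rightarrow> (nat \<Rightarrow> nat \<Rightarrow> complex) \<Rightarrow> (nat \<Rightarrow> real) \<Rightarrow> bool" where
  "spectral d X U l \<longleftrightarrow> X \<in> carrier_mat d d \<and> unitary_fun d U \<and>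
     (\<forall>i<d. \<forall>j<d. X $$ (i, j) = (\<Sum>k<d. of_real (l k) * U i k * cnj (U j k)))"

lemma unitary_fun_col: "unitary_fun d U \<Longrightarrow> k < d \<Longrightarrow> l < d \<Longrightarrow> (\<Sum>i<d. U i k * cnj (U i l)) = (if k = l then 1 else 0)"
  and unitary_fun_row: "unitary_fun d U \<Longrightarrow> i < d \<Longrightarrow> j < d \<Longrightarrow> (\<Sum>k<d. U i k * cnj (U j k)) = (if i = j then 1 else 0)"
  by (auto simp: unitary_fun_def)

lemma mat_adjoint_eq: "mat_adjoint X = Matrix.mat (dim_col X) (dim_row X) (\<lambda>(i, j). cnj (X $$ (j, i)))"
  by (rule eq_matI) (auto simp: mat_adjoint_def mat_of_rows_def conjugate_vec_def)

text \<open>A left inverse of a square matrix is a right inverse, so orthonormal columns have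
  orthonormal rows.\<close>

lemma unitary_funI:
  assumes "\<And>k l. k < d \<Longrightarrow> l < d \<Longrightarrow> (\<Sum>i<d. U i k * cnj (U i l)) = (if k = l then 1 else 0)"
  shows "unitary_fun d U"
proof -
  define M where "M = Matrix.mat d d (\<lambda>(i, j). U i j)"
  define M' where "M' = Matrix.mat d d (\<lambda>(i, j). cnj (U j i))"
  have c: "M \<in> carrier_mat d d" "M' \<in> carrier_mat d d" by (auto simp: M_def M'_def)
  have "M' * M = 1\<^sub>m d"
    by (rule eq_matI) (auto simp: M_def M'_def scalar_prod_def lessThan_atLeast0[symmetric] assms mult.commute[of "cnj _"])
  then have "M * M' = 1\<^sub>m d" by (rule mat_mult_left_right_inverse[OF c(2,1)])
  have "(\<Sum>k<d. U i k * cnj (U j k)) = (if i = j then 1 else 0)" if "i < d" "j < d" for i j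
    using arg_cong[OF \<open>M * M' = 1\<^sub>m d\<close>, of "\<lambda>X. X $$ (i, j)"] that
    by (simp add: M_def M'_def scalar_prod_def lessThan_atLeast0[symmetric])
  with assms show ?thesis by (auto simp: unitary_fun_def)
qed

lemma unitary_fun_conj:
  assumes "unitary_fun d U" shows "unitary_fun d (\<lambda>i j. cnj (U i j))"
proof (rule unitary_funI)
  fix k l assume "k < d" "l < d"
  then show "(\<Sum>i<d. cnj (U i k) * cnj (cnj (U i l))) = (if k = l then 1 else 0)"
    using unitary_fun_col[OF assms, of l k] by (simp add: mult.commute)
qed

lemma unitary_fun_expand:
  assumes "unitary_fun d U" "i < d"
  shows "v i = (\<Sum>k<d. U i k * (\<Sum>j<d. cnj (U j k) * v j))"
proof -
  have "(\<Sum>k<d. U i k * (\<Sum>j<d. cnj (U j k) * v j)) = (\<Sum>j<d. (\<Sum>k<d. U i k * cnj (U j k)) * v j)"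
    by (simp add: sum_distrib_left sum_distrib_right mult.assoc) (rule sum.swap)
  also have "\<dots> = (\<Sum>j<d. if i = j then v j else 0)"
    by (rule sum.cong) (use assms unitary_fun_row in auto)
  finally show ?thesis using assms(2) by simp
qed

lemma unitary_fun_expand_col:
  assumes "unitary_fun d U" "k < d"
  shows "y k = (\<Sum>j<d. cnj (U j k) * (\<Sum>l<d. U j l * y l))"
proof -
  have "(\<Sum>j<d. cnj (U j k) * (\<Sum>l<d. U j l * y l)) = (\<Sum>l<d. (\<Sum>j<d. U j l * cnj (U j k)) * y l)"
    by (simp add: sum_distrib_left sum_distrib_right mult_ac) (rule sum.swap)
  also have "\<dots> = (\<Sum>l<d. if k = l then y l else 0)"
    by (rule sum.cong) (use assms unitary_fun_col in auto)
  finally show ?thesis using assms(2) by simp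
qed

lemma unitary_fun_parseval:
  assumes "unitary_fun d U"
  shows "(\<Sum>k<d. (\<Sum>j<d. cnj (U j k) * v j) * cnj (\<Sum>j<d. cnj (U j k) * w j)) = (\<Sum>i<d. v i * cnj (w i))"
proof -
  have "(\<Sum>i<d. v i * cnj (w i)) = (\<Sum>i<d. v i * cnj (\<Sum>k<d. U i k * (\<Sum>j<d. cnj (U j k) * w j)))"
    by (rule sum.cong[OF refl]) (subst unitary_fun_expand[OF assms, of _ w], auto)
  also have "\<dots> = (\<Sum>i<d. \<Sum>k<d. cnj (U i k) * v i * cnj (\<Sum>j<d. cnj (U j k) * w j))"
    by (simp add: sum_distrib_left mult_ac)
  also have "\<dots> = (\<Sum>k<d. (\<Sum>i<d. cnj (U i k) * v i) * cnj (\<Sum>j<d. cnj (U j k) * w j))"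
    by (subst sum.swap) (simp add: sum_distrib_right)
  finally show ?thesis by simp
qed

text \<open>The Householder reflection along \<open>w\<close> = e_0 - x swaps e_0 and x. The phase
  convention on \<open>x 0\<close> keeps the denominator \<open>s\<close> = 1 + r real and at least
  1.\<close>

lemma unitary_fun_extend:
  assumes x: "(\<Sum>i<Suc n. x i * cnj (x i)) = 1" and x0: "x 0 = - of_real r" "r \<ge> 0"
  obtains H where "unitary_fun (Suc n) H" "\<And>i. i < Suc n \<Longrightarrow> H i 0 = x i"
proof -
  define w where "w i = (if i = 0 then 1 else 0) - x i" for i
  define s where "s = 1 + complex_of_real r"
  have s: "s \<noteq> 0" "cnj s = s" using x0(2) by (auto simp: s_def complex_eq_iff)
  have w0: "w 0 = s" by (simp add: w_def s_def x0)
  have "(\<Sum>i<n. x (Suc i) * cnj (x (Suc i))) = 1 - of_real r * of_real r"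
    using x unfolding sum.lessThan_Suc_shift by (simp add: x0 algebra_simps)
  then have ww: "(\<Sum>i<Suc n. w i * cnj (w i)) = 2 * s"
    unfolding sum.lessThan_Suc_shift by (simp add: w_def s_def x0 algebra_simps)
  define H where "H i j = (if i = j then 1 else 0) - w i * cnj (w j) / s" for i j
  have "(\<Sum>i<Suc n. H i k * cnj (H i l)) = (if k = l then 1 else 0)" if "k < Suc n" "l < Suc n" for k l
  proof -
    have "(\<Sum>i<Suc n. H i k * cnj (H i l)) = (\<Sum>i<Suc n. (if i = k then (if k = l then 1 else 0) else 0)
        - (if i = k then cnj (w k) * w l / s else 0) + (if i = l then - cnj (w k) * w l / s else 0)
        + cnj (w k) * w l / s / s * (w i * cnj (w i)))"
      by (rule sum.cong[OF refl]) (auto simp: H_def s field_simps)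
    also have "\<dots> = (if k = l then 1 else 0) - cnj (w k) * w l / s - cnj (w k) * w l / s
        + cnj (w k) * w l / s / s * (2 * s)"
      unfolding sum.distrib sum_subtractf sum_distrib_left[symmetric] ww using that by simp
    finally show ?thesis using s by simp
  qed
  then have "unitary_fun (Suc n) H" by (rule unitary_funI)
  moreover have "H i 0 = x i" for i
    using s by (auto simp: H_def w0) (auto simp: w_def x0 s_def)
  ultimately show thesis using that by blast
qed

text \<open>Deflation: a unitary with an eigenvector as first column brings X to a form whose first
  row and column vanish off the diagonal, the row because X is Hermitian. The induction hypothesis
  treats the remaining block.\<close>

lemma hermitian_diagonalizable:
  assumes "\<And>i j. i < d \<Longrightarrow> j < d \<Longrightarrow> X j i = cnj (X i j)"
  shows "\<exists>U l. unitary_fun d U \<and> (\<forall>i<d. \<forall>j<d. X i j = (\<Sum>k<d. of_real (l k) * U i k * cnj (U j k)))"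
  using assms
proof (induction d arbitrary: X)
  case 0
  show ?case by (rule exI[of _ "\<lambda>_ _. 0"]) (simp add: unitary_fun_def)
next
  case (Suc n)
  define M where "M = Matrix.mat (Suc n) (Suc n) (\<lambda>(i, j). X i j)"
  have M: "M \<in> carrier_mat (Suc n) (Suc n)" by (simp add: M_def)
  obtain \<kappa> v where "eigenvector M v \<kappa>"
    using spectrum_non_empty[OF M] by (auto simp: spectrum_def eigenvalue_def)
  then have v: "v \<in> carrier_vec (Suc n)" "v \<noteq> 0\<^sub>v (Suc n)" "M *\<^sub>v v = \<kappa> \<cdot>\<^sub>v v"
    using M by (auto simp: eigenvector_def)
  have ev: "(\<Sum>j<Suc n. X i j * v $ j) = \<kappa> * v $ i" if "i < Suc n" for i
    using arg_cong[OF v(3), of "\<lambda>u. u $ i"] v(1) that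
    by (simp add: M_def scalar_prod_def lessThan_atLeast0[symmetric])
  define N where "N = (\<Sum>i<Suc n. (norm (v $ i))\<^sup>2)"
  obtain i0 where i0: "i0 < Suc n" "v $ i0 \<noteq> 0"
    using v(1,2) by (metis carrier_vecD eq_vecI index_zero_vec)
  then have "0 < N" unfolding N_def by (intro sum_pos2[of _ i0]) auto
  \<comment> \<open>This phase makes the first coordinate real and nonpositive, as
    \<open>unitary_fun_extend\<close> requires.\<close>
  define ph where "ph = (if v $ 0 = 0 then 1 else - cnj (v $ 0) / norm (v $ 0))"
  have ph: "norm ph = 1" by (auto simp: ph_def norm_divide)
  define x where "x i = ph * v $ i / sqrt N" for i
  have "x 0 = - of_real (norm (v $ 0) / sqrt N)"
    by (auto simp: x_def ph_def complex_norm_square[symmetric] power2_eq_square mult.commute)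
  moreover have "(\<Sum>i<Suc n. x i * cnj (x i)) = 1"
  proof -
    have "(\<Sum>i<Suc n. x i * cnj (x i)) = of_real (\<Sum>i<Suc n. (norm (x i))\<^sup>2)"
      by (simp add: complex_norm_square[symmetric] del: sum.lessThan_Suc)
    also have "(\<Sum>i<Suc n. (norm (x i))\<^sup>2) = (\<Sum>i<Suc n. (norm (v $ i))\<^sup>2) / N"
      using \<open>0 < N\<close> by (simp add: x_def norm_mult norm_divide ph power_divide sum_divide_distrib del: sum.lessThan_Suc)
    also have "\<dots> = 1" using \<open>0 < N\<close> unfolding N_def[symmetric] by simp
    finally show ?thesis unfolding of_real_1 .
  qed
  ultimately obtain H where H: "unitary_fun (Suc n) H" and H0: "\<And>i. i < Suc n \<Longrightarrow> H i 0 = x i"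
    using unitary_fun_extend[of x n "norm (v $ 0) / sqrt N"] \<open>0 < N\<close> by auto
  have evx: "(\<Sum>j<Suc n. X i j * x j) = \<kappa> * x i" if "i < Suc n" for i
    using arg_cong[OF ev[OF that], of "\<lambda>y. ph * y / sqrt N"]
    by (simp add: x_def sum_distrib_left sum_divide_distrib mult_ac del: sum.lessThan_Suc)
  \<comment> \<open>The matrix of X in the basis formed by the columns of H.\<close>
  define Y where "Y k l = (\<Sum>i<Suc n. cnj (H i k) * (\<Sum>j<Suc n. X i j * H j l))" for k l
  have XY: "X i j = (\<Sum>k<Suc n. H i k * (\<Sum>l<Suc n. Y k l * cnj (H j l)))" if "i < Suc n" "j < Suc n" for i j
  proof -
    have "(\<Sum>l<Suc n. Y k l * cnj (H j l)) = (\<Sum>i<Suc n. cnj (H i k) * X i j)" for k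
    proof -
      have "(\<Sum>l<Suc n. Y k l * cnj (H j l))
          = (\<Sum>l<Suc n. \<Sum>i<Suc n. cnj (H i k) * (cnj (H j l) * (\<Sum>j<Suc n. cnj (cnj (H j l)) * X i j)))"
        by (simp add: Y_def sum_distrib_left sum_distrib_right mult_ac del: sum.lessThan_Suc)
      also have "\<dots> = (\<Sum>i<Suc n. cnj (H i k) * (\<Sum>l<Suc n. cnj (H j l) * (\<Sum>j<Suc n. cnj (cnj (H j l)) * X i j)))"
        by (subst sum.swap) (simp only: sum_distrib_left)
      also have "\<dots> = (\<Sum>i<Suc n. cnj (H i k) * X i j)"
        by (simp only: unitary_fun_expand[OF unitary_fun_conj[OF H] that(2), symmetric])
      finally show ?thesis .
    qed
    then show ?thesis using unitary_fun_expand[OF H that(1), of "\<lambda>i. X i j"] by simp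
  qed
  have Yh: "Y l k = cnj (Y k l)" for k l
  proof -
    have "cnj (Y k l) = (\<Sum>i<Suc n. \<Sum>j<Suc n. H i k * (cnj (X i j) * cnj (H j l)))"
      by (simp only: Y_def cnj_sum complex_cnj_mult complex_cnj_cnj sum_distrib_left)
    also have "\<dots> = (\<Sum>j<Suc n. \<Sum>i<Suc n. cnj (H j l) * (X j i * H i k))"
    proof (subst sum.swap, intro sum.cong refl)
      fix i j assume "i \<in> {..<Suc n}" "j \<in> {..<Suc n}"
      then have "X i j = cnj (X j i)" using Suc.prems[of j i] by simp
      then show "H j k * (cnj (X j i) * cnj (H i l)) = cnj (H i l) * (X i j * H j k)" by simp
    qed
    finally show ?thesis by (simp only: Y_def sum_distrib_left)
  qed
  have Y0: "Y k 0 = (if k = 0 then \<kappa> else 0)" if "k < Suc n" for k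
  proof -
    have "Y k 0 = (\<Sum>i<Suc n. cnj (H i k) * (\<kappa> * H i 0))"
      unfolding Y_def
    proof (rule sum.cong[OF refl])
      fix i assume i: "i \<in> {..<Suc n}"
      have "(\<Sum>j<Suc n. X i j * H j 0) = (\<Sum>j<Suc n. X i j * x j)"
        by (rule sum.cong) (use H0 in auto)
      then show "cnj (H i k) * (\<Sum>j<Suc n. X i j * H j 0) = cnj (H i k) * (\<kappa> * H i 0)"
        using evx[of i] H0[of i] i by (simp del: sum.lessThan_Suc)
    qed
    also have "\<dots> = \<kappa> * (\<Sum>i<Suc n. H i 0 * cnj (H i k))"
      by (simp add: sum_distrib_left mult_ac del: sum.lessThan_Suc)
    finally show ?thesis using unitary_fun_col[OF H, of 0 k] that by simp
  qed
  have kr: "complex_of_real (Re \<kappa>) = \<kappa>"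
    using Yh[of 0 0] Y0[of 0] by (simp add: complex_eq_iff)
  have "\<exists>U l. unitary_fun n U \<and> (\<forall>i<n. \<forall>j<n. Y (Suc i) (Suc j) = (\<Sum>k<n. of_real (l k) * U i k * cnj (U j k)))"
    by (rule Suc.IH) (rule Yh)
  then obtain U l where U: "unitary_fun n U" and
    Yd: "\<And>i j. i < n \<Longrightarrow> j < n \<Longrightarrow> Y (Suc i) (Suc j) = (\<Sum>k<n. of_real (l k) * U i k * cnj (U j k))" by auto
  \<comment> \<open>The eigenvector stays in front, and the other columns of H are rotated by the
    unitary that diagonalises the block.\<close>
  define V where "V i k = (case k of 0 \<Rightarrow> H i 0 | Suc k \<Rightarrow> (\<Sum>j<n. H i (Suc j) * U j k))" for i k
  define m where "m k = (case k of 0 \<Rightarrow> Re \<kappa> | Suc k \<Rightarrow> l k)" for k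
  have Xd: "X i j = (\<Sum>k<Suc n. of_real (m k) * V i k * cnj (V j k))" if "i < Suc n" "j < Suc n" for i j
  proof -
    have Y0': "Y 0 (Suc l) = 0" if "l < n" for l using Yh[of "Suc l" 0] Y0[of "Suc l"] that by simp
    have "X i j = H i 0 * (\<kappa> * cnj (H j 0)) + (\<Sum>k<n. H i (Suc k) * (\<Sum>l<n. Y (Suc k) (Suc l) * cnj (H j (Suc l))))"
      unfolding XY[OF that] sum.lessThan_Suc_shift using Y0 Y0' by simp
    also have "(\<Sum>k<n. H i (Suc k) * (\<Sum>l<n. Y (Suc k) (Suc l) * cnj (H j (Suc l))))
      = (\<Sum>k<n. \<Sum>l'<n. \<Sum>p<n. of_real (l p) * (H i (Suc k) * U k p) * cnj (H j (Suc l') * U l' p))"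
      by (simp add: Yd sum_distrib_left sum_distrib_right mult_ac)
    also have "\<dots> = (\<Sum>p<n. \<Sum>k<n. \<Sum>l'<n. of_real (l p) * (H i (Suc k) * U k p) * cnj (H j (Suc l') * U l' p))"
      by (rule trans[OF sum.cong[OF refl sum.swap] sum.swap])
    also have "\<dots> = (\<Sum>p<n. of_real (l p) * V i (Suc p) * cnj (V j (Suc p)))"
      by (simp add: V_def sum_distrib_left sum_distrib_right mult_ac)
    finally show ?thesis unfolding sum.lessThan_Suc_shift by (simp add: V_def m_def kr mult_ac)
  qed
  have "unitary_fun (Suc n) V"
  proof (rule unitary_funI)
    have H1: "(\<Sum>i<Suc n. H i 0 * cnj (\<Sum>j<n. H i (Suc j) * U j k)) = 0" for k
    proof -
      have "(\<Sum>i<Suc n. H i 0 * cnj (\<Sum>j<n. H i (Suc j) * U j k))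
          = (\<Sum>j<n. cnj (U j k) * (\<Sum>i<Suc n. H i 0 * cnj (H i (Suc j))))"
        by (simp only: cnj_sum sum_distrib_left, subst sum.swap) (simp add: mult_ac del: sum.lessThan_Suc)
      then show ?thesis using unitary_fun_col[OF H, of 0 "Suc _"] by simp
    qed
    have H2: "(\<Sum>i<Suc n. (\<Sum>j<n. H i (Suc j) * U j k) * cnj (\<Sum>j<n. H i (Suc j) * U j k')) = (\<Sum>j<n. U j k * cnj (U j k'))" for k k'
    proof -
      have "(\<Sum>i<Suc n. (\<Sum>j<n. H i (Suc j) * U j k) * cnj (\<Sum>j<n. H i (Suc j) * U j k'))
          = (\<Sum>i<Suc n. \<Sum>j<n. \<Sum>j'<n. H i (Suc j) * U j k * cnj (H i (Suc j') * U j' k'))"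
        by (simp only: cnj_sum sum_product)
      also have "\<dots> = (\<Sum>j<n. \<Sum>j'<n. \<Sum>i<Suc n. H i (Suc j) * U j k * cnj (H i (Suc j') * U j' k'))"
        by (rule trans[OF sum.swap sum.cong[OF refl sum.swap]])
      also have "\<dots> = (\<Sum>j<n. \<Sum>j'<n. U j k * cnj (U j' k') * (\<Sum>i<Suc n. H i (Suc j) * cnj (H i (Suc j'))))"
        by (simp add: sum_distrib_left mult_ac del: sum.lessThan_Suc)
      also have "\<dots> = (\<Sum>j<n. \<Sum>j'<n. if j = j' then U j k * cnj (U j' k') else 0)"
        by (intro sum.cong refl) (use unitary_fun_col[OF H, of "Suc _" "Suc _"] in auto)
      finally show ?thesis by simp
    qed
    fix k l assume kl: "k < Suc n" "l < Suc n"
    show "(\<Sum>i<Suc n. V i k * cnj (V i l)) = (if k = l then 1 else 0)"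
    proof (cases k; cases l)
      assume "k = 0" "l = 0"
      then show ?thesis using unitary_fun_col[OF H, of 0 0] by (simp add: V_def)
    next
      fix l' assume "k = 0" "l = Suc l'"
      then show ?thesis using H1[of l'] by (simp add: V_def)
    next
      fix k' assume "k = Suc k'" "l = 0"
      then show ?thesis using arg_cong[OF H1[of k'], of cnj] by (simp add: V_def mult.commute)
    next
      fix k' l' assume "k = Suc k'" "l = Suc l'"
      then show ?thesis using H2[of k' l'] unitary_fun_col[OF U, of k' l'] kl by (simp add: V_def del: sum.lessThan_Suc)
    qed
  qed
  then show ?case using Xd by (intro exI[of _ V] exI[of _ m]) auto
qed

lemma spectral_exists:
  assumes "X \<in> carrier_mat d d" "mat_adjoint X = X"
  obtains U l where "spectral d X U l"
proof -
  have "X $$ (j, i) = cnj (X $$ (i, j))" if "i < d" "j < d" for i j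
    using arg_cong[OF assms(2), of "\<lambda>M. M $$ (j, i)"] assms(1) that by (simp add: mat_adjoint_eq)
  from hermitian_diagonalizable[of d "\<lambda>i j. X $$ (i, j)", OF this] that assms(1)
  show thesis by (auto simp: spectral_def)
qed

subsection \<open>Logarithms and relative entropy in an eigenbasis\<close>

definition coef :: "nat \<Rightarrow> (nat \<Rightarrow> nat \<Rightarrow> complex) \<Rightarrow> (nat \<Rightarrow> complex) \<Rightarrow> nat \<Rightarrow> complex" where
  "coef d U v k = (\<Sum>j<d. cnj (U j k) * v j)"

definition qform :: "nat \<Rightarrow> complex mat \<Rightarrow> (nat \<Rightarrow> complex) \<Rightarrow> complex" where
  "qform d X v = (\<Sum>i<d. \<Sum>j<d. cnj (v i) * X $$ (i, j) * v j)"

text \<open>The common shape of log expectations and of minus the relative entropy: a weighted mean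
  of ln r, which is -\<infinity> as soon as some weight sits on a zero of r.\<close>

definition logsum :: "'i set \<Rightarrow> ('i \<Rightarrow> real) \<Rightarrow> ('i \<Rightarrow> real) \<Rightarrow> ereal" where
  "logsum I b r = (if \<forall>i\<in>I. b i \<noteq> 0 \<longrightarrow> r i > 0 then ereal (\<Sum>i\<in>I. b i * ln (r i)) else -\<infinity>)"

lemma spectral_apply:
  assumes "spectral d X U l" "i < d"
  shows "(\<Sum>j<d. X $$ (i, j) * v j) = (\<Sum>k<d. of_real (l k) * U i k * coef d U v k)"
proof -
  have "(\<Sum>j<d. X $$ (i, j) * v j) = (\<Sum>j<d. \<Sum>k<d. of_real (l k) * U i k * cnj (U j k) * v j)"
    by (rule sum.cong) (use assms in \<open>auto simp: spectral_def sum_distrib_right\<close>)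
  also have "\<dots> = (\<Sum>k<d. of_real (l k) * U i k * coef d U v k)"
    by (subst sum.swap) (simp add: coef_def sum_distrib_left mult_ac)
  finally show ?thesis .
qed

lemma spectral_qform:
  assumes "spectral d X U l"
  shows "qform d X v = of_real (\<Sum>k<d. l k * (norm (coef d U v k))\<^sup>2)"
proof -
  have "qform d X v = (\<Sum>i<d. cnj (v i) * (\<Sum>k<d. of_real (l k) * U i k * coef d U v k))"
    unfolding qform_def
  proof (rule sum.cong[OF refl])
    fix i assume "i \<in> {..<d}"
    then show "(\<Sum>j<d. cnj (v i) * X $$ (i, j) * v j) = cnj (v i) * (\<Sum>k<d. of_real (l k) * U i k * coef d U v k)"
      by (subst spectral_apply[OF assms, symmetric]) (auto simp: sum_distrib_left mult.assoc)
  qed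
  also have "\<dots> = (\<Sum>k<d. of_real (l k) * (coef d U v k * (\<Sum>i<d. U i k * cnj (v i))))"
    by (simp add: sum_distrib_left mult_ac) (rule sum.swap)
  also have "\<dots> = (\<Sum>k<d. of_real (l k) * (coef d U v k * cnj (coef d U v k)))"
    by (simp add: coef_def)
  finally show ?thesis by (simp only: of_real_sum of_real_mult complex_norm_square)
qed

lemma unitary_parseval_coef:
  "unitary_fun d U \<Longrightarrow> (\<Sum>k<d. coef d U v k * cnj (coef d U w k)) = (\<Sum>i<d. v i * cnj (w i))"
  unfolding coef_def by (rule unitary_fun_parseval)

lemma of_real_sum_norm_square: "complex_of_real (\<Sum>i\<in>I. (norm (f i))\<^sup>2) = (\<Sum>i\<in>I. f i * cnj (f i))"
  by (simp only: of_real_sum complex_norm_square)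

lemma mult_mat_vec_quadratic:
  assumes "X \<in> carrier_mat d d" "v \<in> carrier_vec d"
  shows "(X *\<^sub>v v) \<bullet>c v = qform d X (($) v)"
  using assms
  by (simp add: qform_def scalar_prod_def conjugate_vec_def lessThan_atLeast0[symmetric] sum_distrib_left mult_ac)

lemma qform_cong: "(\<And>i. i < d \<Longrightarrow> v i = w i) \<Longrightarrow> qform d X v = qform d X w"
  by (simp add: qform_def)

lemma unitary_norm_coef:
  assumes "unitary_fun d U"
  shows "(\<Sum>k<d. (norm (coef d U v k))\<^sup>2) = (\<Sum>i<d. (norm (v i))\<^sup>2)"
proof -
  have "complex_of_real (\<Sum>k<d. (norm (coef d U v k))\<^sup>2) = of_real (\<Sum>i<d. (norm (v i))\<^sup>2)"
    unfolding of_real_sum_norm_square by (rule unitary_parseval_coef[OF assms])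
  then show ?thesis using of_real_eq_iff by blast
qed

lemma coef_column:
  assumes "unitary_fun d U" "k < d" "m < d"
  shows "coef d U (\<lambda>i. U i m) k = (if k = m then 1 else 0)"
  using unitary_fun_col[OF assms(1,3,2)] by (auto simp: coef_def mult.commute)

lemma psd_spectral:
  assumes "psd d X"
  obtains U l where "spectral d X U l" "\<And>k. k < d \<Longrightarrow> 0 \<le> l k"
proof -
  obtain U l where s: "spectral d X U l" using assms unfolding psd_def by (metis spectral_exists)
  have "0 \<le> l m" if "m < d" for m
  proof -
    define v where "v = Matrix.vec d (\<lambda>i. U i m)"
    have X: "X \<in> carrier_mat d d" using assms by (simp add: psd_def)
    have "(X *\<^sub>v v) \<bullet>c v = qform d X (\<lambda>i. U i m)"
      unfolding v_def by (subst mult_mat_vec_quadratic[OF X]) (auto intro!: qform_cong)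
    also have "\<dots> = of_real (\<Sum>k<d. l k * (norm (coef d U (\<lambda>i. U i m) k))\<^sup>2)"
      by (rule spectral_qform[OF s])
    also have "(\<Sum>k<d. l k * (norm (coef d U (\<lambda>i. U i m) k))\<^sup>2) = (\<Sum>k<d. if k = m then l k else 0)"
      by (rule sum.cong) (use s that coef_column in \<open>auto simp: spectral_def\<close>)
    finally have "(X *\<^sub>v v) \<bullet>c v = of_real (l m)" using that by simp
    moreover have "v \<in> carrier_vec d" by (simp add: v_def)
    ultimately show ?thesis using assms unfolding psd_def by (metis Re_complex_of_real)
  qed
  with s that show thesis by blast
qed

lemma psdI:
  assumes "X \<in> carrier_mat d d" "\<And>i j. i < d \<Longrightarrow> j < d \<Longrightarrow> X $$ (j, i) = cnj (X $$ (i, j))"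
    "\<And>v. 0 \<le> Re (qform d X v)"
  shows "psd d X"
  unfolding psd_def
proof (intro conjI ballI assms(1))
  show "mat_adjoint X = X"
  proof (rule eq_matI)
    fix i j assume "i < dim_row X" "j < dim_col X"
    then show "mat_adjoint X $$ (i, j) = X $$ (i, j)"
      using assms(2)[of j i] assms(1) by (simp add: mat_adjoint_eq)
  qed (use assms(1) in \<open>auto simp: mat_adjoint_eq\<close>)
  fix v :: "complex vec" assume "v \<in> carrier_vec d"
  then have "(X *\<^sub>v v) \<bullet>c v = qform d X (\<lambda>i. v $ i)"
    by (rule mult_mat_vec_quadratic[OF assms(1)])
  with assms(3) show "0 \<le> Re ((X *\<^sub>v v) \<bullet>c v)" by simp
qed

lemma psd_hermitian:
  assumes "psd d X" "i < d" "j < d" shows "X $$ (j, i) = cnj (X $$ (i, j))"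
proof -
  have "X \<in> carrier_mat d d" "mat_adjoint X = X" using assms by (auto simp: psd_def)
  from arg_cong[OF this(2), of "\<lambda>M. M $$ (j, i)"] this(1) show ?thesis
    using assms(2,3) by (simp add: mat_adjoint_eq)
qed

lemma psd_carrier: "psd d X \<Longrightarrow> X \<in> carrier_mat d d"
  by (simp add: psd_def)

lemma psd_qform:
  assumes "psd d X" shows "0 \<le> Re (qform d X v)"
proof -
  obtain U l where s: "spectral d X U l" "\<And>k. k < d \<Longrightarrow> 0 \<le> l k" using psd_spectral[OF assms] by blast
  show ?thesis unfolding spectral_qform[OF s(1)] by (auto intro!: sum_nonneg mult_nonneg_nonneg s(2))
qed

lemma spectral_psd:
  assumes "spectral d X U l" "\<And>k. k < d \<Longrightarrow> 0 \<le> l k"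
  shows "psd d X"
proof (rule psdI)
  show "X \<in> carrier_mat d d" using assms(1) by (simp add: spectral_def)
  show "X $$ (j, i) = cnj (X $$ (i, j))" if "i < d" "j < d" for i j
    using assms(1) that by (auto simp: spectral_def mult_ac)
  show "0 \<le> Re (qform d X v)" for v
    unfolding spectral_qform[OF assms(1)] by (auto intro!: sum_nonneg mult_nonneg_nonneg assms(2))
qed

lemma mat_fun_spectral:
  assumes "spectral d X U l"
  shows "mat_fun f X = Matrix.mat d d (\<lambda>(i, j). \<Sum>k<d. f (l k) * U i k * cnj (U j k))"
proof -
  define M where "M = Matrix.mat d d (\<lambda>(i, j). U i j)"
  have M: "M \<in> carrier_mat d d" "mat_adjoint M \<in> carrier_mat d d" by (auto simp: M_def mat_adjoint_eq)
  have U: "unitary_fun d U" using assms by (simp add: spectral_def)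
  have "unitary_mat d M"
    unfolding unitary_mat_def
  proof (intro conjI M)
    show "mat_adjoint M * M = 1\<^sub>m d"
      by (rule eq_matI) (auto simp: M_def mat_adjoint_eq scalar_prod_def lessThan_atLeast0[symmetric]
          unitary_fun_col[OF U] mult.commute[of "cnj _"])
  qed
  moreover have e: "M * mat_diag d g * mat_adjoint M = Matrix.mat d d (\<lambda>(i, j). \<Sum>k<d. g k * U i k * cnj (U j k))" for g
    unfolding mat_diag_mult_right[OF M(1)]
    by (rule eq_matI) (auto simp: M_def mat_adjoint_eq scalar_prod_def lessThan_atLeast0[symmetric] mult_ac)
  moreover have "X = M * mat_diag d (\<lambda>i. complex_of_real (l i)) * mat_adjoint M"
    unfolding e by (rule eq_matI) (use assms in \<open>auto simp: spectral_def\<close>)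
  ultimately show ?thesis using mat_fun_diag by metis
qed

text \<open>The kernel is spanned by the columns whose eigenvalue is 0.\<close>

lemma supp_spectral:
  assumes "spectral d X U l"
  shows "\<phi> \<in> supp X \<longleftrightarrow> \<phi> \<in> carrier_vec d \<and> (\<forall>k<d. l k = 0 \<longrightarrow> coef d U (($) \<phi>) k = 0)"
proof -
  have X: "X \<in> carrier_mat d d" and U: "unitary_fun d U" using assms by (auto simp: spectral_def)
  have ap: "(X *\<^sub>v w) $ i = (\<Sum>k<d. of_real (l k) * U i k * coef d U (($) w) k)" if "i < d" "w \<in> carrier_vec d" for i w
    using spectral_apply[OF assms that(1), of "($) w"] that X by (simp add: scalar_prod_def lessThan_atLeast0[symmetric])
  show ?thesis
  proof (intro iffI conjI allI impI)
    assume \<phi>: "\<phi> \<in> supp X"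
    then show c: "\<phi> \<in> carrier_vec d" using X by (auto simp: supp_def)
    fix k assume k: "k < d" "l k = 0"
    define w where "w = Matrix.vec d (\<lambda>i. U i k)"
    have w: "w \<in> carrier_vec d" by (simp add: w_def)
    have "coef d U (($) w) m = coef d U (\<lambda>i. U i k) m" for m
      unfolding coef_def w_def by (rule sum.cong) auto
    then have cw: "coef d U (($) w) m = (if m = k then 1 else 0)" if "m < d" for m
      using coef_column[OF U that k(1)] by simp
    have "X *\<^sub>v w = 0\<^sub>v d"
    proof (rule eq_vecI)
      fix i assume "i < dim_vec (0\<^sub>v d)"
      then have i: "i < d" by simp
      have "(X *\<^sub>v w) $ i = 0"
        unfolding ap[OF i w] by (rule sum.neutral) (use cw k in auto)
      with i show "(X *\<^sub>v w) $ i = 0\<^sub>v d $ i" by simp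
    qed (use X in simp)
    then have "w \<in> mat_kernel X" using X w by (simp add: mat_kernel_def)
    then have "\<phi> \<bullet>c w = 0" using \<phi> by (auto simp: supp_def)
    then show "coef d U (($) \<phi>) k = 0"
      using c w by (simp add: coef_def scalar_prod_def conjugate_vec_def lessThan_atLeast0[symmetric] w_def mult.commute)
  next
    assume a: "\<phi> \<in> carrier_vec d \<and> (\<forall>k<d. l k = 0 \<longrightarrow> coef d U (($) \<phi>) k = 0)"
    have "\<phi> \<bullet>c w = 0" if "w \<in> mat_kernel X" for w
    proof -
      have w: "w \<in> carrier_vec d" "X *\<^sub>v w = 0\<^sub>v d" using that X by (auto simp: mat_kernel_def)
      have lw: "of_real (l k) * coef d U (($) w) k = 0" if "k < d" for k
      proof -
        have "of_real (l k) * coef d U (($) w) k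
            = (\<Sum>j<d. cnj (U j k) * (\<Sum>m<d. U j m * (of_real (l m) * coef d U (($) w) m)))"
          by (rule unitary_fun_expand_col[OF U that])
        also have "\<dots> = (\<Sum>j<d. cnj (U j k) * (X *\<^sub>v w) $ j)"
          by (rule sum.cong) (use ap[OF _ w(1)] in \<open>auto simp: mult_ac\<close>)
        also have "\<dots> = 0" unfolding w(2) by simp
        finally show ?thesis .
      qed
      have "\<phi> \<bullet>c w = (\<Sum>i<d. \<phi> $ i * cnj (w $ i))"
        using a w by (simp add: scalar_prod_def conjugate_vec_def lessThan_atLeast0[symmetric])
      also have "\<dots> = (\<Sum>k<d. coef d U (($) \<phi>) k * cnj (coef d U (($) w) k))"
        by (rule unitary_parseval_coef[OF U, symmetric])
      also have "\<dots> = 0"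
        by (rule sum.neutral) (use a lw in force)
      finally show ?thesis .
    qed
    then show "\<phi> \<in> supp X" using a X by (auto simp: supp_def)
  qed
qed

lemma spectral_mat_log:
  assumes "spectral d X U l"
  shows "spectral d (mat_log X) U (\<lambda>k. if l k = 0 then 0 else ln (l k))"
proof -
  have "mat_log X = Matrix.mat d d (\<lambda>(i, j). \<Sum>k<d. of_real (if l k = 0 then 0 else ln (l k)) * U i k * cnj (U j k))"
    unfolding mat_log_def mat_fun_spectral[OF assms] by (intro cong_mat refl) (auto intro!: sum.cong)
  with assms show ?thesis by (simp add: spectral_def)
qed

lemma mat_log_quadratic:
  assumes "spectral d X U l" "\<phi> \<in> carrier_vec d"
  shows "(mat_log X *\<^sub>v \<phi>) \<bullet>c \<phi> = of_real (\<Sum>k<d. (norm (coef d U (($) \<phi>) k))\<^sup>2 * ln (l k))"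
    and "mat_log X \<in> carrier_mat d d"
proof -
  note s = spectral_mat_log[OF assms(1)]
  then show L: "mat_log X \<in> carrier_mat d d" by (simp add: spectral_def)
  have "(mat_log X *\<^sub>v \<phi>) \<bullet>c \<phi> = qform d (mat_log X) (($) \<phi>)"
    by (rule mult_mat_vec_quadratic[OF L assms(2)])
  also have "\<dots> = of_real (\<Sum>k<d. (norm (coef d U (($) \<phi>) k))\<^sup>2 * ln (l k))"
    \<comment> \<open>As \<open>ln 0 = 0\<close>, the case distinction in \<open>mat_log\<close>
      agrees with \<open>ln\<close> on the eigenvalue 0.\<close>
    unfolding spectral_qform[OF s] by (rule arg_cong[where f = of_real], rule sum.cong) auto
  finally show "(mat_log X *\<^sub>v \<phi>) \<bullet>c \<phi> = of_real (\<Sum>k<d. (norm (coef d U (($) \<phi>) k))\<^sup>2 * ln (l k))" .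
qed

lemma log_expectation_spectral:
  assumes "spectral d X U l" "\<And>k. k < d \<Longrightarrow> 0 \<le> l k" "\<phi> \<in> carrier_vec d"
  shows "log_expectation X \<phi> = logsum {..<d} (\<lambda>k. (norm (coef d U (($) \<phi>) k))\<^sup>2) l"
proof -
  have "\<phi> \<in> supp X \<longleftrightarrow> (\<forall>k\<in>{..<d}. (norm (coef d U (($) \<phi>) k))\<^sup>2 \<noteq> 0 \<longrightarrow> l k > 0)"
    unfolding supp_spectral[OF assms(1)] using assms(2,3) by (force simp: order_less_le)
  then show ?thesis
    unfolding log_expectation_def logsum_def mat_log_quadratic(1)[OF assms(1,3)] by (simp only: Re_complex_of_real)
qed

text \<open>With c = <u|\<phi>> for the k-th eigenvector u, the eigenvalue equation reads cnj c
  \<phi> = l u. Pairing with u gives l = |c|^2, and comparing squared norms gives |c|^2 =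
  l^2.\<close>

lemma ket_bra_eigenvalues:
  assumes s: "spectral d (ket_bra \<phi>) U l" and \<phi>: "\<phi> \<in> carrier_vec d" and k: "k < d"
    and unit: "(\<Sum>i<d. (norm (\<phi> $ i))\<^sup>2) = 1"
  shows "l k = 0 \<or> l k = 1"
proof -
  define c where "c = coef d U (($) \<phi>) k"
  have U: "unitary_fun d U" using s by (simp add: spectral_def)
  have e: "\<phi> $ i * cnj c = of_real (l k) * U i k" if i: "i < d" for i
  proof -
    have "\<phi> $ i * cnj c = (\<Sum>j<d. ket_bra \<phi> $$ (i, j) * U j k)"
      using \<phi> i by (simp add: c_def coef_def ket_bra_def sum_distrib_left mult_ac)
    also have "\<dots> = (\<Sum>m<d. of_real (l m) * U i m * coef d U (\<lambda>j. U j k) m)"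
      by (rule spectral_apply[OF s i])
    also have "\<dots> = (\<Sum>m<d. if m = k then of_real (l m) * U i m else 0)"
      by (rule sum.cong) (use coef_column[OF U _ k] in auto)
    finally show ?thesis using k by simp
  qed
  have "l k = (norm c)\<^sup>2"
  proof -
    have "c * cnj c = (\<Sum>i<d. cnj (U i k) * (\<phi> $ i * cnj c))"
      by (simp add: c_def coef_def sum_distrib_right mult_ac)
    also have "\<dots> = (\<Sum>i<d. of_real (l k) * (U i k * cnj (U i k)))"
      by (rule sum.cong) (use e in auto)
    also have "\<dots> = of_real (l k)"
      using unitary_fun_col[OF U k k] by (simp add: sum_distrib_left[symmetric])
    finally show ?thesis by (metis complex_norm_square of_real_eq_iff)
  qed
  moreover have "(norm c)\<^sup>2 = (l k)\<^sup>2"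
  proof -
    have "(norm c)\<^sup>2 = (\<Sum>i<d. (norm (\<phi> $ i * cnj c))\<^sup>2)"
      using unit by (simp add: norm_mult power_mult_distrib sum_distrib_right[symmetric])
    also have "\<dots> = (\<Sum>i<d. (l k)\<^sup>2 * (norm (U i k))\<^sup>2)"
      by (rule sum.cong) (use e in \<open>auto simp: norm_mult power_mult_distrib\<close>)
    also have "\<dots> = (l k)\<^sup>2 * (\<Sum>i<d. (norm (U i k))\<^sup>2)" by (simp add: sum_distrib_left)
    also have "(\<Sum>i<d. (norm (U i k))\<^sup>2) = 1"
    proof -
      have "complex_of_real (\<Sum>i<d. (norm (U i k))\<^sup>2) = 1"
        unfolding of_real_sum_norm_square using unitary_fun_col[OF U k k] by simp
      then show ?thesis using of_real_eq_1_iff by blast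
    qed
    finally show ?thesis by simp
  qed
  ultimately show ?thesis by (simp add: power2_eq_square)
qed

text \<open>The eigenvalues of a pure state are 0 and 1, so its own logarithm vanishes and only the
  term with T survives.\<close>

lemma rel_entropy_ket_bra:
  assumes \<phi>: "\<phi> \<in> carrier_vec d" and unit: "(\<Sum>i<d. (norm (\<phi> $ i))\<^sup>2) = 1" and T: "psd d T"
  shows "rel_entropy (ket_bra \<phi>) T = - log_expectation T \<phi>"
proof -
  have kb: "ket_bra \<phi> \<in> carrier_mat d d" using \<phi> by (simp add: ket_bra_def)
  have "mat_adjoint (ket_bra \<phi>) = ket_bra \<phi>"
    by (rule eq_matI) (auto simp: mat_adjoint_eq ket_bra_def)
  then obtain U l where s: "spectral d (ket_bra \<phi>) U l" using spectral_exists[OF kb] by blast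
  have "mat_log (ket_bra \<phi>) = Matrix.mat d d (\<lambda>(i, j). \<Sum>k<d. (if l k = 0 then 0 else complex_of_real (ln (l k))) * U i k * cnj (U j k))"
    unfolding mat_log_def mat_fun_spectral[OF s] ..
  also have "\<dots> = 0\<^sub>m d d"
    by (rule eq_matI) (use ket_bra_eigenvalues[OF s \<phi> _ unit] in \<open>force intro!: sum.neutral\<close>)+
  finally have L0: "mat_log (ket_bra \<phi>) = 0\<^sub>m d d" .
  obtain V m where sT: "spectral d T V m" "\<And>k. k < d \<Longrightarrow> 0 \<le> m k" using psd_spectral[OF T] by blast
  have L: "mat_log T \<in> carrier_mat d d" by (rule mat_log_quadratic(2)[OF sT(1) \<phi>])
  have "mtrace (ket_bra \<phi> * (mat_log (ket_bra \<phi>) - mat_log T)) = - ((mat_log T *\<^sub>v \<phi>) \<bullet>c \<phi>)"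
  proof -
    have "mtrace (ket_bra \<phi> * (mat_log (ket_bra \<phi>) - mat_log T)) = (\<Sum>i<d. \<Sum>j<d. - (\<phi> $ i * cnj (\<phi> $ j) * mat_log T $$ (j, i)))"
      unfolding L0 using \<phi> L by (simp add: mtrace_def ket_bra_def scalar_prod_def lessThan_atLeast0[symmetric])
    also have "\<dots> = - ((mat_log T *\<^sub>v \<phi>) \<bullet>c \<phi>)"
      using \<phi> L by (simp add: scalar_prod_def conjugate_vec_def lessThan_atLeast0[symmetric] sum_negf sum_distrib_right)
        (subst sum.swap, simp add: mult_ac)
    finally show ?thesis .
  qed
  moreover have "supp (ket_bra \<phi>) \<subseteq> supp T \<longleftrightarrow> \<phi> \<in> supp T"
  proof
    assume sub: "supp (ket_bra \<phi>) \<subseteq> supp T"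
    have "\<phi> \<bullet>c w = 0" if w: "w \<in> mat_kernel (ket_bra \<phi>)" for w
    proof -
      have wc: "w \<in> carrier_vec d" "ket_bra \<phi> *\<^sub>v w = 0\<^sub>v d" using w kb by (auto simp: mat_kernel_def)
      define z where "z = (\<Sum>j<d. cnj (\<phi> $ j) * w $ j)"
      have "\<phi> $ i * z = 0" if "i < d" for i
        using arg_cong[OF wc(2), of "\<lambda>u. u $ i"] that wc(1) \<phi>
        by (simp add: ket_bra_def scalar_prod_def lessThan_atLeast0[symmetric] z_def sum_distrib_left mult_ac)
      moreover have "\<exists>i<d. \<phi> $ i \<noteq> 0"
      proof (rule ccontr)
        assume "\<not> ?thesis"
        then have "(\<Sum>i<d. (norm (\<phi> $ i))\<^sup>2) = 0" by (intro sum.neutral) auto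
        with unit show False by simp
      qed
      ultimately have "z = 0" by auto
      moreover have "\<phi> \<bullet>c w = cnj z"
        using \<phi> wc by (simp add: z_def scalar_prod_def conjugate_vec_def lessThan_atLeast0[symmetric])
      ultimately show ?thesis by simp
    qed
    then have "\<phi> \<in> supp (ket_bra \<phi>)" using \<phi> kb by (auto simp: supp_def)
    with sub show "\<phi> \<in> supp T" by blast
  next
    assume "\<phi> \<in> supp T"
    show "supp (ket_bra \<phi>) \<subseteq> supp T"
    proof
      fix v assume v: "v \<in> supp (ket_bra \<phi>)"
      then have vc: "v \<in> carrier_vec d" using kb by (auto simp: supp_def)
      define z where "z = (\<Sum>j<d. cnj (\<phi> $ j) * v $ j)"
      \<comment> \<open>The part of v orthogonal to \<phi> lies in the kernel of the projection,
        hence is orthogonal to v as well, hence is 0. So v is a multiple of \<phi>.\<close>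
      define w where "w = Matrix.vec d (\<lambda>i. v $ i - z * \<phi> $ i)"
      have unit': "(\<Sum>j<d. cnj (\<phi> $ j) * \<phi> $ j) = 1"
        using arg_cong[OF unit, of complex_of_real] unfolding of_real_sum_norm_square by (simp add: mult.commute)
      have zw: "(\<Sum>j<d. cnj (\<phi> $ j) * w $ j) = 0"
      proof -
        have "(\<Sum>j<d. cnj (\<phi> $ j) * w $ j) = (\<Sum>j<d. cnj (\<phi> $ j) * v $ j) - z * (\<Sum>j<d. cnj (\<phi> $ j) * \<phi> $ j)"
          by (simp add: w_def right_diff_distrib sum_subtractf sum_distrib_left mult_ac)
        then show ?thesis by (simp add: unit' z_def)
      qed
      have "(ket_bra \<phi> *\<^sub>v w) $ i = \<phi> $ i * (\<Sum>j<d. cnj (\<phi> $ j) * w $ j)" if "i < d" for i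
        using \<phi> that by (simp add: ket_bra_def scalar_prod_def lessThan_atLeast0[symmetric] w_def sum_distrib_left mult_ac)
      then have "ket_bra \<phi> *\<^sub>v w = 0\<^sub>v d" using kb by (intro eq_vecI) (auto simp: zw)
      then have "w \<in> mat_kernel (ket_bra \<phi>)" using kb by (simp add: mat_kernel_def w_def)
      then have "v \<bullet>c w = 0" using v by (auto simp: supp_def)
      then have vw: "(\<Sum>i<d. v $ i * cnj (w $ i)) = 0"
        by (simp add: scalar_prod_def conjugate_vec_def lessThan_atLeast0[symmetric] w_def)
      have "(\<Sum>i<d. w $ i * cnj (w $ i)) = (\<Sum>i<d. v $ i * cnj (w $ i)) - z * cnj (\<Sum>j<d. cnj (\<phi> $ j) * w $ j)"
        by (simp add: w_def algebra_simps sum_subtractf sum_distrib_left)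
      then have "complex_of_real (\<Sum>i<d. (norm (w $ i))\<^sup>2) = 0" unfolding of_real_sum_norm_square by (simp add: vw zw)
      then have "(\<Sum>i<d. (norm (w $ i))\<^sup>2) = 0" by (simp only: of_real_eq_0_iff)
      then have "v $ i = z * \<phi> $ i" if "i < d" for i
        using that by (auto simp: sum_nonneg_eq_0_iff w_def)
      then have v_eq: "coef d V (($) v) k = z * coef d V (($) \<phi>) k" for k
        by (simp add: coef_def sum_distrib_left mult_ac)
      from \<open>\<phi> \<in> supp T\<close> show "v \<in> supp T"
        unfolding supp_spectral[OF sT(1)] using vc v_eq by auto
    qed
  qed
  ultimately show ?thesis by (simp add: rel_entropy_def log_expectation_def)
qed

subsection \<open>Comparing expectations of logarithms\<close>

text \<open>Operator monotonicity of the logarithm in scalar form: the difference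
  \<open>\<Sum> a ln (r + x) - \<Sum> b ln (l + x)\<close> increases in \<open>x\<close> and tends to 0 at infinity.\<close>

lemma sum_ln_shift_le:
  fixes a r :: "'k \<Rightarrow> real" and b l :: "'i \<Rightarrow> real"
  assumes fin: "finite K" "finite I"
    and nonneg: "\<And>k. k \<in> K \<Longrightarrow> 0 \<le> r k" "\<And>i. i \<in> I \<Longrightarrow> 0 \<le> l i"
    and eq: "sum a K = sum b I"
    and le: "\<And>s. s > 0 \<Longrightarrow> (\<Sum>i\<in>I. b i / (l i + s)) \<le> (\<Sum>k\<in>K. a k / (r k + s))"
    and s: "s > 0"
  shows "(\<Sum>k\<in>K. a k * ln (r k + s)) \<le> (\<Sum>i\<in>I. b i * ln (l i + s))"
proof -
  define F where "F s = (\<Sum>k\<in>K. a k * ln (r k + s)) - (\<Sum>i\<in>I. b i * ln (l i + s))" for s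
  have mono: "F x \<le> F y" if "0 < x" "x \<le> y" for x y
  proof (rule DERIV_nonneg_imp_nondecreasing[OF that(2)])
    fix t assume "x \<le> t" "t \<le> y"
    with that have t: "t > 0" by simp
    have pos: "0 < r k + t" if "k \<in> K" for k using nonneg(1)[OF that] t by linarith
    have pos': "0 < l i + t" if "i \<in> I" for i using nonneg(2)[OF that] t by linarith
    have "(F has_real_derivative (\<Sum>k\<in>K. a k / (r k + t)) - (\<Sum>i\<in>I. b i / (l i + t))) (at t)"
      unfolding F_def by (auto intro!: derivative_eq_intros sum.cong dest: pos pos' simp: field_simps)
    with le[OF t] show "\<exists>y. (F has_real_derivative y) (at t) \<and> 0 \<le> y" by force
  qed
  have "((\<lambda>x. ln (c + x) - ln x) \<longlongrightarrow> 0) at_top" for c :: real by real_asymp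
  then have "((\<lambda>x. (\<Sum>k\<in>K. a k * (ln (r k + x) - ln x)) - (\<Sum>i\<in>I. b i * (ln (l i + x) - ln x)))
      \<longlongrightarrow> (\<Sum>k\<in>K. a k * 0) - (\<Sum>i\<in>I. b i * 0)) at_top"
    by (intro tendsto_intros)
  moreover have "(\<Sum>k\<in>K. a k * (ln (r k + x) - ln x)) - (\<Sum>i\<in>I. b i * (ln (l i + x) - ln x)) = F x" for x
    using eq by (simp add: F_def algebra_simps sum_subtractf sum_distrib_left[symmetric])
  ultimately have "(F \<longlongrightarrow> 0) at_top" by simp
  then have "F s \<le> 0"
    by (rule tendsto_lowerbound) (use mono[OF s] in \<open>auto simp: eventually_at_top_linorder\<close>)
  then show ?thesis by (simp add: F_def)
qed

lemma tendsto_mult_ln_shift: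
  fixes a r :: real
  assumes "a \<noteq> 0 \<Longrightarrow> r > 0"
  shows "((\<lambda>s. a * ln (r + s)) \<longlongrightarrow> a * ln r) (at_right 0)"
proof (cases "a = 0")
  case False
  with assms have "r > 0" by simp
  then have "((\<lambda>s. a * ln (r + s)) \<longlongrightarrow> a * ln (r + 0)) (at_right 0)"
    by (intro tendsto_intros) auto
  then show ?thesis by simp
qed simp

text \<open>Letting s tend to 0 also decides finiteness: a positive weight on an index with l = 0
  would send the right side to -\<infinity>, below A.\<close>

lemma logsum_ge:
  fixes b l :: "'i \<Rightarrow> real"
  assumes fin: "finite I"
    and nonneg: "\<And>i. i \<in> I \<Longrightarrow> 0 \<le> l i" "\<And>i. i \<in> I \<Longrightarrow> 0 \<le> b i"
    and le: "\<And>s. 0 < s \<Longrightarrow> s < 1 \<Longrightarrow> A \<le> (\<Sum>i\<in>I. b i * ln (l i + s)) + c"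
  shows "ereal A \<le> logsum I b l + ereal c"
proof -
  have ev: "\<forall>\<^sub>F s :: real in at_right 0. 0 < s \<and> s < 1"
    by (auto simp: eventually_at_right_field intro!: exI[of _ 1])
  have pos: "l i > 0" if i: "i \<in> I" "b i \<noteq> 0" for i
  proof (rule ccontr)
    assume "\<not> l i > 0"
    then have li: "l i = 0" using nonneg(1)[OF i(1)] by simp
    have bi: "b i > 0" using nonneg(2)[OF i(1)] i(2) by simp
    define M where "M = (\<Sum>j\<in>I - {i}. b j * ln (l j + 1)) + c"
    have "\<forall>\<^sub>F s in at_right 0. A \<le> b i * ln s + M"
      using ev
    proof eventually_elim
      fix s :: real assume s: "0 < s \<and> s < 1"
      have "(\<Sum>j\<in>I. b j * ln (l j + s)) = b i * ln s + (\<Sum>j\<in>I - {i}. b j * ln (l j + s))"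
        using fin i(1) li by (simp add: sum.remove)
      also have "(\<Sum>j\<in>I - {i}. b j * ln (l j + s)) \<le> (\<Sum>j\<in>I - {i}. b j * ln (l j + 1))"
        by (intro sum_mono mult_left_mono nonneg) (use s nonneg(1) in \<open>auto simp: add_nonneg_pos\<close>)
      finally show "A \<le> b i * ln s + M"
        using le[of s] s by (simp add: M_def)
    qed
    moreover have "filterlim (\<lambda>s. b i * ln s + M) at_bot (at_right 0)"
      using bi by real_asymp
    then have "\<forall>\<^sub>F s in at_right 0. b i * ln s + M \<le> A - 1"
      by (simp add: filterlim_at_bot)
    ultimately have "\<forall>\<^sub>F s :: real in at_right 0. A \<le> A - 1"
      by eventually_elim simp
    then show False by simp
  qed
  have "((\<lambda>s. (\<Sum>i\<in>I. b i * ln (l i + s)) + c) \<longlongrightarrow> (\<Sum>i\<in>I. b i * ln (l i)) + c) (at_right 0)"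
    using pos by (intro tendsto_add tendsto_sum tendsto_mult_ln_shift tendsto_const) auto
  then have "A \<le> (\<Sum>i\<in>I. b i * ln (l i)) + c"
    by (rule tendsto_lowerbound) (auto intro!: eventually_mono[OF ev] le)
  then show ?thesis using pos by (auto simp: logsum_def)
qed

lemma logsum_le:
  fixes a r :: "'k \<Rightarrow> real" and b l :: "'i \<Rightarrow> real"
  assumes fin: "finite I"
    and nonneg: "\<And>k. k \<in> K \<Longrightarrow> 0 \<le> r k" "\<And>k. k \<in> K \<Longrightarrow> 0 \<le> a k"
      "\<And>i. i \<in> I \<Longrightarrow> 0 \<le> l i" "\<And>i. i \<in> I \<Longrightarrow> 0 \<le> b i"
    and le: "\<And>s. 0 < s \<Longrightarrow> s < 1 \<Longrightarrow> (\<Sum>k\<in>K. a k * ln (r k + s)) \<le> (\<Sum>i\<in>I. b i * ln (l i + s))"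
  shows "logsum K a r \<le> logsum I b l"
proof (cases "\<forall>k\<in>K. a k \<noteq> 0 \<longrightarrow> r k > 0")
  case True
  have "ereal (\<Sum>k\<in>K. a k * ln (r k)) \<le> logsum I b l + ereal 0"
  proof (rule logsum_ge[OF fin nonneg(3,4)])
    fix s :: real assume s: "0 < s" "s < 1"
    have "(\<Sum>k\<in>K. a k * ln (r k)) \<le> (\<Sum>k\<in>K. a k * ln (r k + s))"
    proof (rule sum_mono)
      fix k assume "k \<in> K"
      then show "a k * ln (r k) \<le> a k * ln (r k + s)"
        using True nonneg s by (cases "a k = 0") (auto intro!: mult_left_mono)
    qed
    also note le[OF s]
    finally show "(\<Sum>k\<in>K. a k * ln (r k)) \<le> (\<Sum>i\<in>I. b i * ln (l i + s)) + 0" by simp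
  qed
  then show ?thesis using True by (simp add: logsum_def)
next
  case False
  then have "logsum K a r = -\<infinity>" by (auto simp: logsum_def)
  then show ?thesis by simp
qed

text \<open>Completing the square.\<close>

lemma two_Re_le:
  fixes y z :: complex
  assumes "c > 0"
  shows "2 * Re (y * cnj z) - c * (norm z)\<^sup>2 \<le> (norm y)\<^sup>2 / c"
proof -
  have "0 \<le> (norm y - c * norm z)\<^sup>2 / c" using assms by simp
  also have "\<dots> = (norm y)\<^sup>2 / c - 2 * (norm y * norm z) + c * (norm z)\<^sup>2"
    using assms by (simp add: power2_eq_square field_simps)
  finally show ?thesis
    using complex_Re_le_cmod[of "y * cnj z"] by (simp add: norm_mult)
qed

text \<open>The right side is <\<phi>|(T + x)^-1|\<phi>>, and the left side is its variational
  expression at v. In this way an upper bound on the form of T at a single vector becomes a lower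
  bound on a resolvent.\<close>

lemma resolvent_lower_bound:
  assumes s: "spectral d T U l" "\<And>k. k < d \<Longrightarrow> 0 \<le> l k" "x > 0"
  shows "2 * Re (\<Sum>i<d. \<phi> i * cnj (v i)) - Re (qform d T v) - x * (\<Sum>i<d. (norm (v i))\<^sup>2)
    \<le> (\<Sum>k<d. (norm (coef d U \<phi> k))\<^sup>2 / (l k + x))"
proof -
  have U: "unitary_fun d U" using s by (simp add: spectral_def)
  have "2 * Re (\<Sum>i<d. \<phi> i * cnj (v i)) - Re (qform d T v) - x * (\<Sum>i<d. (norm (v i))\<^sup>2)
    = (\<Sum>k<d. 2 * Re (coef d U \<phi> k * cnj (coef d U v k)) - (l k + x) * (norm (coef d U v k))\<^sup>2)"
    unfolding spectral_qform[OF s(1)] unitary_parseval_coef[OF U, of \<phi> v, symmetric] unitary_norm_coef[OF U, of v, symmetric]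
    by (simp add: sum_subtractf sum_distrib_left algebra_simps sum.distrib)
  also have "\<dots> \<le> (\<Sum>k<d. (norm (coef d U \<phi> k))\<^sup>2 / (l k + x))"
    by (intro sum_mono two_Re_le) (use s in \<open>auto simp: add_nonneg_pos\<close>)
  finally show ?thesis .
qed

text \<open>The test vectors bound the resolvent expectations of T from below for every x,
  \<open>sum_ln_shift_le\<close> passes from resolvents to shifted logarithms, and
  \<open>logsum_le\<close> removes the shift.\<close>

lemma log_expectation_le_logsum:
  assumes T: "psd d T" and \<phi>: "\<phi> \<in> carrier_vec d" and I: "finite I"
    and nonneg: "\<And>i. i \<in> I \<Longrightarrow> 0 \<le> b i" "\<And>i. i \<in> I \<Longrightarrow> 0 \<le> r i"
    and eq: "(\<Sum>i<d. (norm (\<phi> $ i))\<^sup>2) = sum b I"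
    and ex: "\<And>x. x > 0 \<Longrightarrow> \<exists>v. (\<Sum>i\<in>I. b i / (r i + x)) \<le>
      2 * Re (\<Sum>i<d. \<phi> $ i * cnj (v i)) - Re (qform d T v) - x * (\<Sum>i<d. (norm (v i))\<^sup>2)"
  shows "log_expectation T \<phi> \<le> logsum I b r"
proof -
  obtain U l where s: "spectral d T U l" "\<And>k. k < d \<Longrightarrow> 0 \<le> l k" using psd_spectral[OF T] by blast
  have U: "unitary_fun d U" using s by (simp add: spectral_def)
  have "logsum {..<d} (\<lambda>k. (norm (coef d U (($) \<phi>) k))\<^sup>2) l \<le> logsum I b r"
  proof (rule logsum_le)
    fix x :: real assume "0 < x"
    show "(\<Sum>k<d. (norm (coef d U (($) \<phi>) k))\<^sup>2 * ln (l k + x)) \<le> (\<Sum>i\<in>I. b i * ln (r i + x))"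
    proof (rule sum_ln_shift_le)
      show "(\<Sum>k<d. (norm (coef d U (($) \<phi>) k))\<^sup>2) = sum b I"
        unfolding unitary_norm_coef[OF U] by (rule eq)
      fix x :: real assume x: "0 < x"
      obtain v where "(\<Sum>i\<in>I. b i / (r i + x)) \<le>
          2 * Re (\<Sum>i<d. \<phi> $ i * cnj (v i)) - Re (qform d T v) - x * (\<Sum>i<d. (norm (v i))\<^sup>2)"
        using ex[OF x] by blast
      also have "\<dots> \<le> (\<Sum>k<d. (norm (coef d U (($) \<phi>) k))\<^sup>2 / (l k + x))"
        by (rule resolvent_lower_bound[OF s x])
      finally show "(\<Sum>i\<in>I. b i / (r i + x)) \<le> (\<Sum>k<d. (norm (coef d U (($) \<phi>) k))\<^sup>2 / (l k + x))" .
    qed (use I s nonneg \<open>0 < x\<close> in auto)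
  qed (use I s nonneg in auto)
  then show ?thesis by (simp add: log_expectation_spectral[OF s \<phi>])
qed

text \<open>The vector \<open>v\<close> is (T + x)^-1 \<phi>, at which the variational expression
  attains its maximum.\<close>

lemma spectral_resolvent:
  fixes \<phi> v :: "nat \<Rightarrow> complex" and x :: real
  assumes s: "spectral d T U l" "\<And>k. k < d \<Longrightarrow> 0 \<le> l k" and x: "x > 0"
    and v_def: "v = (\<lambda>i. \<Sum>k<d. U i k * (coef d U \<phi> k / (l k + x)))"
  shows "\<And>i. i < d \<Longrightarrow> (\<Sum>j<d. T $$ (i, j) * v j) + x * v i = \<phi> i"
    and "\<And>k. k < d \<Longrightarrow> coef d U v k = coef d U \<phi> k / (l k + x)"
proof -
  have U: "unitary_fun d U" using s by (simp add: spectral_def)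
  show cv: "coef d U v k = coef d U \<phi> k / (l k + x)" if "k < d" for k
    using unitary_fun_expand_col[OF U that, of "\<lambda>k. coef d U \<phi> k / (l k + x)"] by (simp add: coef_def v_def)
  fix i assume i: "i < d"
  have "(\<Sum>j<d. T $$ (i, j) * v j) + x * v i = (\<Sum>k<d. U i k * (of_real (l k) * coef d U v k)) + (\<Sum>k<d. U i k * (x * (coef d U \<phi> k / (l k + x))))"
  proof -
    have "of_real x * v i = (\<Sum>k<d. U i k * (x * (coef d U \<phi> k / (l k + x))))"
      unfolding v_def sum_distrib_left by (intro sum.cong refl mult.left_commute)
    then show ?thesis unfolding spectral_apply[OF s(1) i] by (simp add: mult_ac)
  qed
  also have "\<dots> = (\<Sum>k<d. U i k * coef d U \<phi> k)"
    unfolding sum.distrib[symmetric]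
  proof (rule sum.cong[OF refl])
    fix k assume "k \<in> {..<d}"
    then have "l k + x \<noteq> 0" using s(2)[of k] x by simp
    then have "complex_of_real (l k) + x \<noteq> 0" by (simp only: of_real_add[symmetric] of_real_eq_0_iff not_False_eq_True)
    then show "U i k * (of_real (l k) * coef d U v k) + U i k * (x * (coef d U \<phi> k / (l k + x))) = U i k * coef d U \<phi> k"
      using cv[of k] \<open>k \<in> {..<d}\<close> by (simp add: field_simps)
  qed
  also have "\<dots> = \<phi> i"
    using unitary_fun_expand[OF U i, of \<phi>] by (simp add: coef_def)
  finally show "(\<Sum>j<d. T $$ (i, j) * v j) + x * v i = \<phi> i" .
qed

text \<open>The hypothesis is needed only for the resolvent vectors of \<open>T\<close>; this is how concavity of the
  logarithm is exploited when \<open>T\<close> is an average.\<close>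

lemma log_expectation_mono:
  assumes T: "psd d T" and S: "psd d S" and \<phi>: "\<phi> \<in> carrier_vec d"
    and le: "\<And>x v. x > 0 \<Longrightarrow> (\<And>i. i < d \<Longrightarrow> (\<Sum>j<d. T $$ (i, j) * v j) + of_real x * v i = \<phi> $ i) \<Longrightarrow>
      Re (qform d S v) \<le> Re (qform d T v)"
  shows "log_expectation S \<phi> \<le> log_expectation T \<phi>"
proof -
  obtain U l where s: "spectral d T U l" "\<And>k. k < d \<Longrightarrow> 0 \<le> l k" using psd_spectral[OF T] by blast
  have U: "unitary_fun d U" using s by (simp add: spectral_def)
  have "log_expectation S \<phi> \<le> logsum {..<d} (\<lambda>k. (norm (coef d U (($) \<phi>) k))\<^sup>2) l"
  proof (rule log_expectation_le_logsum[OF S \<phi>])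
    show "(\<Sum>i<d. (norm (\<phi> $ i))\<^sup>2) = (\<Sum>k<d. (norm (coef d U (($) \<phi>) k))\<^sup>2)"
      by (rule unitary_norm_coef[OF U, symmetric])
    fix x :: real assume x: "0 < x"
    define c where "c = coef d U (($) \<phi>)"
    define v :: "nat \<Rightarrow> complex" where "v = (\<lambda>i. \<Sum>k<d. U i k * (c k / (l k + x)))"
    note r = spectral_resolvent[OF s x v_def[unfolded c_def], folded c_def]
    have "Re (qform d S v) \<le> Re (qform d T v)" using le[OF x, of v] r(1) by simp
    then have "2 * Re (\<Sum>i<d. \<phi> $ i * cnj (v i)) - Re (qform d S v) - x * (\<Sum>i<d. (norm (v i))\<^sup>2)
      \<ge> 2 * Re (\<Sum>i<d. \<phi> $ i * cnj (v i)) - Re (qform d T v) - x * (\<Sum>i<d. (norm (v i))\<^sup>2)" by simp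
    also have "2 * Re (\<Sum>i<d. \<phi> $ i * cnj (v i)) - Re (qform d T v) - x * (\<Sum>i<d. (norm (v i))\<^sup>2)
      = (\<Sum>k<d. 2 * Re (c k * cnj (c k / (l k + x))) - (l k + x) * (norm (c k / (l k + x)))\<^sup>2)"
      unfolding spectral_qform[OF s(1)] unitary_parseval_coef[OF U, of "($) \<phi>" v, symmetric]
        unitary_norm_coef[OF U, of v, symmetric] c_def[symmetric]
      by (simp add: sum_subtractf sum_distrib_left algebra_simps sum.distrib r(2))
    also have "\<dots> = (\<Sum>k<d. (norm (c k))\<^sup>2 / (l k + x))"
    proof (rule sum.cong[OF refl])
      fix k assume "k \<in> {..<d}"
      then have p: "l k + x > 0" using s(2)[of k] x by simp
      have "c k * cnj (c k / (l k + x)) = of_real ((norm (c k))\<^sup>2 / (l k + x))"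
        by (simp only: complex_cnj_divide complex_cnj_complex_of_real times_divide_eq_right of_real_divide complex_norm_square)
      moreover have "norm (c k / (l k + x)) = norm (c k) / (l k + x)"
        using p by (simp add: norm_divide flip: of_real_add)
      moreover have "2 * (N\<^sup>2 / m) - m * (N / m)\<^sup>2 = N\<^sup>2 / m" if "m > 0" for N m :: real
        using that by (simp add: power2_eq_square field_simps)
      ultimately show "2 * Re (c k * cnj (c k / (l k + x))) - (l k + x) * (norm (c k / (l k + x)))\<^sup>2 = (norm (c k))\<^sup>2 / (l k + x)"
        using p by (simp only: Re_complex_of_real)
    qed
    finally show "\<exists>v. (\<Sum>k<d. (norm (coef d U (($) \<phi>) k))\<^sup>2 / (l k + x)) \<le>
      2 * Re (\<Sum>i<d. \<phi> $ i * cnj (v i)) - Re (qform d S v) - x * (\<Sum>i<d. (norm (v i))\<^sup>2)"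
      unfolding c_def by blast
  qed (use s in auto)
  then show ?thesis by (simp add: log_expectation_spectral[OF s \<phi>])
qed

subsection \<open>Averaged rank-one operators\<close>

definition cpow :: "real \<Rightarrow> complex \<Rightarrow> complex" where
  "cpow x z = (if x = 0 then 0 else complex_of_real x powr z)"

lemma cpow_0 [simp]: "cpow 0 z = 0"
  by (simp add: cpow_def)

lemma cpow_exp: "x > 0 \<Longrightarrow> cpow x z = exp (z * of_real (ln x))"
  by (simp add: cpow_def powr_def Ln_of_real)

lemma cnj_cpow: "x \<ge> 0 \<Longrightarrow> cnj (cpow x z) = cpow x (cnj z)"
  by (cases "x = 0") (simp_all add: cpow_exp exp_cnj)

lemma norm_cpow: "x \<ge> 0 \<Longrightarrow> norm (cpow x z) = (if x = 0 then 0 else exp (Re z * ln x))"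
  by (cases "x = 0") (simp_all add: cpow_exp)

lemma norm_cpow_half:
  assumes "x \<ge> 0" shows "(norm (cpow x ((1 + \<i> * of_real t) / 2)))\<^sup>2 = x"
proof (cases "x = 0")
  case False
  with assms have "x > 0" by simp
  then have "(exp (ln x / 2))\<^sup>2 = x" by (simp add: exp_double[symmetric])
  then show ?thesis using \<open>x > 0\<close> by (simp add: norm_cpow)
qed simp

lemma continuous_on_cpow:
  assumes "x \<ge> 0" "continuous_on S g" shows "continuous_on S (\<lambda>t. cpow x (g t))"
  using assms by (cases "x = 0") (auto simp: cpow_exp intro!: continuous_intros)

lemma norm_sum_mult_square_le:
  fixes x y :: "'i \<Rightarrow> complex"
  shows "(norm (\<Sum>i\<in>I. x i * y i))\<^sup>2 \<le> (\<Sum>i\<in>I. (norm (x i))\<^sup>2) * (\<Sum>i\<in>I. (norm (y i))\<^sup>2)"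
proof -
  have "norm (\<Sum>i\<in>I. x i * y i) \<le> (\<Sum>i\<in>I. norm (x i) * norm (y i))"
    by (rule order_trans[OF norm_sum]) (simp add: norm_mult)
  then have "(norm (\<Sum>i\<in>I. x i * y i))\<^sup>2 \<le> (\<Sum>i\<in>I. norm (x i) * norm (y i))\<^sup>2"
    by (intro power_mono) auto
  also have "\<dots> \<le> (\<Sum>i\<in>I. (norm (x i))\<^sup>2) * (\<Sum>i\<in>I. (norm (y i))\<^sup>2)"
    by (rule Cauchy_Schwarz_ineq_sum)
  finally show ?thesis .
qed

lemma coef_sum:
  "coef d U (\<lambda>i. \<Sum>p\<in>P. \<alpha> p * f p i) k = (\<Sum>p\<in>P. \<alpha> p * coef d U (f p) k)"
  unfolding coef_def sum_distrib_left by (subst sum.swap) (simp add: mult_ac)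

lemma coef_cong: "(\<And>i. i < d \<Longrightarrow> v i = w i) \<Longrightarrow> coef d U v k = coef d U w k"
  by (simp add: coef_def)

text \<open>The position of \<psi> relative to a positive operator \<Delta>: the components
  \<open>f p\<close> of \<psi> are eigenvectors of \<Delta> with eigenvalue
  \<open>\<delta> p\<close> and squared norm \<open>b p\<close>. Different p may share an
  eigenvalue; only the number of distinct values enters the final error.\<close>

locale orthogonal_decomposition =
  fixes D :: nat and P :: "'p set" and f :: "'p \<Rightarrow> nat \<Rightarrow> complex" and b \<delta> :: "'p \<Rightarrow> real" and \<psi> :: "complex vec"
  assumes fin: "finite P"
    and psi_carrier: "\<psi> \<in> carrier_vec D"
    and psi: "\<And>i. i < D \<Longrightarrow> \<psi> $ i = (\<Sum>p\<in>P. f p i)"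
    and orth: "\<And>p q. p \<in> P \<Longrightarrow> q \<in> P \<Longrightarrow> (\<Sum>i<D. f p i * cnj (f q i)) = (if p = q then of_real (b p) else 0)"
    and b_pos: "\<And>p. p \<in> P \<Longrightarrow> 0 < b p"
    and \<delta>_nonneg: "\<And>p. p \<in> P \<Longrightarrow> 0 \<le> \<delta> p"
    and b_sum: "sum b P = 1"
begin

definition comb :: "('p \<Rightarrow> complex) \<Rightarrow> nat \<Rightarrow> complex" where
  "comb \<alpha> i = (\<Sum>p\<in>P. \<alpha> p * f p i)"

text \<open>This is \<Delta>^((1 + it) / 2) \<psi>.\<close>

definition phi :: "real \<Rightarrow> nat \<Rightarrow> complex" where
  "phi t = comb (\<lambda>p. cpow (\<delta> p) ((1 + \<i> * of_real t) / 2))"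

definition Opt :: "complex mat" where
  "Opt = Matrix.mat D D (\<lambda>(i, j). LINT t|lborel. of_real (beta0 t) * (phi t i * cnj (phi t j)))"

lemma coef_comb: "coef D Q (comb \<alpha>) k = (\<Sum>p\<in>P. \<alpha> p * coef D Q (f p) k)"
  unfolding comb_def[abs_def] by (rule coef_sum)

lemma comb_inner: "(\<Sum>i<D. comb \<alpha> i * cnj (comb \<beta> i)) = (\<Sum>p\<in>P. \<alpha> p * cnj (\<beta> p) * of_real (b p))"
proof -
  have "(\<Sum>i<D. comb \<alpha> i * cnj (comb \<beta> i)) = (\<Sum>i<D. \<Sum>p\<in>P. \<Sum>q\<in>P. \<alpha> p * cnj (\<beta> q) * (f p i * cnj (f q i)))"
    by (simp add: comb_def sum_product mult_ac)
  also have "\<dots> = (\<Sum>p\<in>P. \<Sum>q\<in>P. \<Sum>i<D. \<alpha> p * cnj (\<beta> q) * (f p i * cnj (f q i)))"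
    by (rule trans[OF sum.swap sum.cong[OF refl sum.swap]])
  also have "\<dots> = (\<Sum>p\<in>P. \<Sum>q\<in>P. if p = q then \<alpha> p * cnj (\<beta> q) * of_real (b p) else 0)"
    unfolding sum_distrib_left[symmetric] by (intro sum.cong refl) (simp add: orth)
  finally show ?thesis using fin by simp
qed

lemma comb_norm: "(\<Sum>i<D. (norm (comb \<alpha> i))\<^sup>2) = (\<Sum>p\<in>P. b p * (norm (\<alpha> p))\<^sup>2)"
proof -
  have "complex_of_real (\<Sum>i<D. (norm (comb \<alpha> i))\<^sup>2) = of_real (\<Sum>p\<in>P. b p * (norm (\<alpha> p))\<^sup>2)"
    unfolding of_real_sum_norm_square comb_inner by (simp only: of_real_sum of_real_mult complex_norm_square mult_ac)
  then show ?thesis by (simp only: of_real_eq_iff)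
qed

lemma psi_comb: "i < D \<Longrightarrow> \<psi> $ i = comb (\<lambda>_. 1) i"
  by (simp add: psi comb_def)

lemma psi_norm: "(\<Sum>i<D. (norm (\<psi> $ i))\<^sup>2) = 1"
  using comb_norm[of "\<lambda>_. 1"] by (simp add: psi_comb b_sum)

text \<open>The hypothesis is T \<le> \<Delta> on the span of the components, and the test vector
  for the shift x is (\<Delta> + x)^-1 \<psi>.\<close>

lemma log_expectation_le:
  assumes T: "psd D T"
    and le: "\<And>\<alpha>. Re (qform D T (comb \<alpha>)) \<le> (\<Sum>p\<in>P. \<delta> p * (norm (\<alpha> p))\<^sup>2 * b p)"
  shows "log_expectation T \<psi> \<le> logsum P b \<delta>"
proof (rule log_expectation_le_logsum[OF T psi_carrier fin])
  show "(\<Sum>i<D. (norm (\<psi> $ i))\<^sup>2) = sum b P" by (simp add: psi_norm b_sum)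
  fix x :: real assume x: "0 < x"
  define \<alpha> where "\<alpha> p = complex_of_real (1 / (\<delta> p + x))" for p
  have "(\<Sum>i<D. \<psi> $ i * cnj (comb \<alpha> i)) = (\<Sum>i<D. comb (\<lambda>_. 1) i * cnj (comb \<alpha> i))"
    by (simp add: psi_comb)
  also have "\<dots> = of_real (\<Sum>p\<in>P. b p / (\<delta> p + x))"
    unfolding comb_inner by (simp add: \<alpha>_def)
  finally have 1: "Re (\<Sum>i<D. \<psi> $ i * cnj (comb \<alpha> i)) = (\<Sum>p\<in>P. b p / (\<delta> p + x))" by simp
  have "(\<Sum>p\<in>P. \<delta> p * (norm (\<alpha> p))\<^sup>2 * b p) + x * (\<Sum>i<D. (norm (comb \<alpha> i))\<^sup>2)
      = (\<Sum>p\<in>P. b p / (\<delta> p + x))"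
    unfolding comb_norm sum_distrib_left sum.distrib[symmetric]
  proof (rule sum.cong[OF refl])
    fix p assume "p \<in> P"
    then have p: "\<delta> p + x > 0" using \<delta>_nonneg[of p] x by linarith
    have n: "norm (\<alpha> p) = 1 / (\<delta> p + x)" using p unfolding \<alpha>_def norm_of_real by simp
    have "\<delta> p * (1 / m)\<^sup>2 * b p + x * (b p * (1 / m)\<^sup>2) = (\<delta> p + x) * b p / m\<^sup>2" for m
      by (simp add: power_divide add_divide_distrib algebra_simps)
    then show "\<delta> p * (norm (\<alpha> p))\<^sup>2 * b p + x * (b p * (norm (\<alpha> p))\<^sup>2) = b p / (\<delta> p + x)"
      unfolding n using p by (simp add: power2_eq_square)
  qed
  with le[of \<alpha>] 1 have "(\<Sum>p\<in>P. b p / (\<delta> p + x)) \<le>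
      2 * Re (\<Sum>i<D. \<psi> $ i * cnj (comb \<alpha> i)) - Re (qform D T (comb \<alpha>)) - x * (\<Sum>i<D. (norm (comb \<alpha> i))\<^sup>2)"
    by linarith
  then show "\<exists>v. (\<Sum>p\<in>P. b p / (\<delta> p + x)) \<le>
      2 * Re (\<Sum>i<D. \<psi> $ i * cnj (v i)) - Re (qform D T v) - x * (\<Sum>i<D. (norm (v i))\<^sup>2)" by blast
qed (use b_pos \<delta>_nonneg in \<open>auto intro: less_imp_le\<close>)

lemma continuous_on_phi: "continuous_on S (\<lambda>t. phi t i)"
  unfolding phi_def comb_def using \<delta>_nonneg by (intro continuous_intros continuous_on_cpow) auto

lemma phi_bounded: "norm (phi t i) \<le> (\<Sum>p\<in>P. sqrt (\<delta> p) * norm (f p i))"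
proof -
  have "norm (cpow (\<delta> p) ((1 + \<i> * of_real t) / 2)) = sqrt (\<delta> p)" if "p \<in> P" for p
    using norm_cpow_half[OF \<delta>_nonneg[OF that], of t] by (metis norm_ge_zero real_sqrt_unique)
  then have "(\<Sum>p\<in>P. norm (cpow (\<delta> p) ((1 + \<i> * of_real t) / 2) * f p i)) = (\<Sum>p\<in>P. sqrt (\<delta> p) * norm (f p i))"
    by (intro sum.cong) (auto simp: norm_mult)
  then show ?thesis unfolding phi_def comb_def by (metis norm_sum)
qed

lemma integrable_phi: "integrable lborel (\<lambda>t. of_real (beta0 t) * (phi t i * cnj (phi t j)))"
proof (rule integrable_beta0_times)
  show "continuous_on UNIV (\<lambda>t. phi t i * cnj (phi t j))"
    by (intro continuous_intros continuous_on_phi)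
  show "norm (phi t i * cnj (phi t j)) \<le> (\<Sum>p\<in>P. sqrt (\<delta> p) * norm (f p i)) * (\<Sum>p\<in>P. sqrt (\<delta> p) * norm (f p j))" for t
    unfolding norm_mult complex_mod_cnj
    by (intro mult_mono phi_bounded) (auto intro!: sum_nonneg mult_nonneg_nonneg simp: \<delta>_nonneg)
qed

lemma Opt_carrier: "Opt \<in> carrier_mat D D"
  by (simp add: Opt_def)

lemma Opt_bilinear:
  "(\<Sum>i<D. \<Sum>j<D. cnj (u i) * Opt $$ (i, j) * v j)
    = (LINT t|lborel. of_real (beta0 t) * ((\<Sum>i<D. cnj (u i) * phi t i) * cnj (\<Sum>j<D. cnj (v j) * phi t j)))"
  and Opt_bilinear_integrable: "integrable lborel (\<lambda>t. of_real (beta0 t) * ((\<Sum>i<D. cnj (u i) * phi t i) * cnj (\<Sum>j<D. cnj (v j) * phi t j)))"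
proof -
  let ?g = "\<lambda>t. of_real (beta0 t) * ((\<Sum>i<D. cnj (u i) * phi t i) * cnj (\<Sum>j<D. cnj (v j) * phi t j))"
  have g: "?g = (\<lambda>t. \<Sum>i<D. \<Sum>j<D. cnj (u i) * v j * (of_real (beta0 t) * (phi t i * cnj (phi t j))))"
    by (rule ext) (simp add: sum_product sum_distrib_left mult_ac)
  show "integrable lborel ?g"
    unfolding g by (intro Bochner_Integration.integrable_sum integrable_mult_right integrable_phi)
  show "(\<Sum>i<D. \<Sum>j<D. cnj (u i) * Opt $$ (i, j) * v j) = (LINT t|lborel. ?g t)"
    unfolding g
    by (subst Bochner_Integration.integral_sum
        | intro Bochner_Integration.integrable_sum integrable_mult_right integrable_phi sum.cong refl
        | simp add: Opt_def mult_ac)+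
qed

lemma Opt_qform: "qform D Opt v = of_real (LINT t|lborel. beta0 t * (norm (\<Sum>i<D. cnj (v i) * phi t i))\<^sup>2)"
proof -
  have "qform D Opt v = (LINT t|lborel. of_real (beta0 t * (norm (\<Sum>i<D. cnj (v i) * phi t i))\<^sup>2))"
    unfolding qform_def Opt_bilinear by (simp only: of_real_mult complex_norm_square)
  then show ?thesis by (simp only: integral_complex_of_real)
qed

lemma integrable_phi_norm: "integrable lborel (\<lambda>t. beta0 t * (norm (\<Sum>i<D. cnj (v i) * phi t i))\<^sup>2)"
proof -
  have "integrable lborel (\<lambda>t. complex_of_real (beta0 t * (norm (\<Sum>i<D. cnj (v i) * phi t i))\<^sup>2))"
    using Opt_bilinear_integrable[of v v] by (simp only: of_real_mult complex_norm_square)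
  then show ?thesis unfolding complex_of_real_integrable_eq .
qed

lemma Opt_psd: "psd D Opt"
proof (rule psdI[OF Opt_carrier])
  fix i j assume "i < D" "j < D"
  then have "cnj (Opt $$ (i, j)) = (LINT t|lborel. cnj (of_real (beta0 t) * (phi t i * cnj (phi t j))))"
    unfolding Opt_def by (simp del: complex_cnj_mult)
  with \<open>i < D\<close> \<open>j < D\<close> show "Opt $$ (j, i) = cnj (Opt $$ (i, j))"
    by (simp add: Opt_def mult_ac)
next
  show "0 \<le> Re (qform D Opt v)" for v
    unfolding Opt_qform by (auto intro!: integral_nonneg mult_nonneg_nonneg)
qed

text \<open>Every single projection already obeys the bound: |<comb \<alpha>|phi t>|^2 is estimated
  by Cauchy-Schwarz, where one factor is 1 because the weights \<open>b\<close> sum to 1. Averaging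
  over t keeps the bound, as \<open>beta0\<close> has mass 1.\<close>

lemma Opt_le:
  "Re (qform D Opt (comb \<alpha>)) \<le> (\<Sum>p\<in>P. \<delta> p * (norm (\<alpha> p))\<^sup>2 * b p)"
proof -
  define B where "B = (\<Sum>p\<in>P. \<delta> p * (norm (\<alpha> p))\<^sup>2 * b p)"
  have le: "(norm (\<Sum>i<D. cnj (comb \<alpha> i) * phi t i))\<^sup>2 \<le> B" for t
  proof -
    define c where "c p = cpow (\<delta> p) ((1 + \<i> * of_real t) / 2)" for p
    have "(\<Sum>i<D. cnj (comb \<alpha> i) * phi t i) = (\<Sum>p\<in>P. of_real (sqrt (b p)) * (of_real (sqrt (b p)) * c p * cnj (\<alpha> p)))"
    proof -
      have "(\<Sum>i<D. cnj (comb \<alpha> i) * phi t i) = (\<Sum>p\<in>P. c p * cnj (\<alpha> p) * of_real (b p))"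
        using comb_inner[of c \<alpha>] by (simp add: phi_def c_def[abs_def] mult.commute)
      also have "\<dots> = (\<Sum>p\<in>P. of_real (sqrt (b p)) * (of_real (sqrt (b p)) * c p * cnj (\<alpha> p)))"
      proof (rule sum.cong[OF refl])
        fix p assume "p \<in> P"
        then have "complex_of_real (b p) = of_real (sqrt (b p)) * of_real (sqrt (b p))"
          using b_pos[of p] by (simp flip: of_real_mult)
        then show "c p * cnj (\<alpha> p) * of_real (b p) = of_real (sqrt (b p)) * (of_real (sqrt (b p)) * c p * cnj (\<alpha> p))"
          by (simp add: mult_ac)
      qed
      finally show ?thesis .
    qed
    then have "(norm (\<Sum>i<D. cnj (comb \<alpha> i) * phi t i))\<^sup>2 \<le>
        (\<Sum>p\<in>P. (norm (complex_of_real (sqrt (b p))))\<^sup>2) * (\<Sum>p\<in>P. (norm (of_real (sqrt (b p)) * c p * cnj (\<alpha> p)))\<^sup>2)"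
      by (simp only: norm_sum_mult_square_le)
    also have "(\<Sum>p\<in>P. (norm (complex_of_real (sqrt (b p))))\<^sup>2) = 1"
      using b_sum b_pos by (simp add: less_imp_le)
    also have "(\<Sum>p\<in>P. (norm (of_real (sqrt (b p)) * c p * cnj (\<alpha> p)))\<^sup>2) = B"
      unfolding B_def
    proof (rule sum.cong[OF refl])
      fix p assume "p \<in> P"
      then show "(norm (of_real (sqrt (b p)) * c p * cnj (\<alpha> p)))\<^sup>2 = \<delta> p * (norm (\<alpha> p))\<^sup>2 * b p"
        using b_pos[of p] norm_cpow_half[OF \<delta>_nonneg, of p t] by (simp add: norm_mult power_mult_distrib c_def)
    qed
    finally show ?thesis by simp
  qed
  have "(LINT t|lborel. beta0 t * (norm (\<Sum>i<D. cnj (comb \<alpha> i) * phi t i))\<^sup>2) \<le> (LINT t|lborel. beta0 t * B)"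
    by (rule integral_mono[OF integrable_phi_norm]) (auto intro!: mult_left_mono le integrable_beta0)
  then show ?thesis unfolding Opt_qform by (simp add: integral_beta0 B_def)
qed

lemma log_expectation_Opt_le: "log_expectation Opt \<psi> \<le> logsum P b \<delta>"
  by (rule log_expectation_le[OF Opt_psd Opt_le])

lemma Opt_eigenvalue:
  assumes s: "spectral D Opt Q l" and k: "k < D"
  shows "(LINT t|lborel. beta0 t * (norm (coef D Q (phi t) k))\<^sup>2) = l k"
    and "integrable lborel (\<lambda>t. beta0 t * (norm (coef D Q (phi t) k))\<^sup>2)"
proof -
  have U: "unitary_fun D Q" using s by (simp add: spectral_def)
  have "qform D Opt (\<lambda>i. Q i k) = of_real (\<Sum>m<D. l m * (norm (coef D Q (\<lambda>i. Q i k) m))\<^sup>2)"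
    by (rule spectral_qform[OF s])
  also have "(\<Sum>m<D. l m * (norm (coef D Q (\<lambda>i. Q i k) m))\<^sup>2) = (\<Sum>m<D. if m = k then l m else 0)"
    by (rule sum.cong) (use coef_column[OF U _ k] in auto)
  finally have "qform D Opt (\<lambda>i. Q i k) = of_real (l k)" using k by simp
  then show "(LINT t|lborel. beta0 t * (norm (coef D Q (phi t) k))\<^sup>2) = l k"
    unfolding Opt_qform of_real_eq_iff by (simp add: coef_def)
  show "integrable lborel (\<lambda>t. beta0 t * (norm (coef D Q (phi t) k))\<^sup>2)"
    using integrable_phi_norm[of "\<lambda>i. Q i k"] by (simp add: coef_def)
qed

text \<open>The vectors \<open>phi t\<close> span a space of dimension at most \<open>card (\<delta> ` P)\<close>; this bounds the rank.\<close>

lemma Opt_rank: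
  assumes s: "spectral D Opt Q l" "\<And>k. k < D \<Longrightarrow> 0 \<le> l k" and x: "x > 0"
  shows "(\<Sum>k<D. l k / (l k + x)) \<le> card (\<delta> ` P)"
proof -
  have U: "unitary_fun D Q" using s by (simp add: spectral_def)
  \<comment> \<open>The projection of \<psi> onto the eigenspace of \<Delta> for r. All vectors
    \<open>phi t\<close> are combinations of these, with coefficients \<open>c t r\<close>.\<close>
  define w where "w r = comb (\<lambda>p. if \<delta> p = r then 1 else 0)" for r
  define n where "n r = (\<Sum>p\<in>{p\<in>P. \<delta> p = r}. b p)" for r
  define z where "z k r = coef D Q (w r) k" for k r
  define c where "c t r = cpow r ((1 + \<i> * of_real t) / 2)" for t r
  have n_pos: "n r > 0" if "r \<in> \<delta> ` P" for r
    unfolding n_def using that fin b_pos by (intro sum_pos) auto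
  have w_inner: "(\<Sum>i<D. comb \<alpha> i * cnj (w r i)) = (\<Sum>p\<in>{p\<in>P. \<delta> p = r}. \<alpha> p * of_real (b p))" for \<alpha> r
    unfolding w_def comb_inner using fin by (simp add: sum.If_cases if_distrib if_distribR Int_def cong: if_cong)
  have zn: "(\<Sum>k<D. (norm (z k r))\<^sup>2) = n r" for r
    unfolding z_def unitary_norm_coef[OF U] unfolding w_def comb_norm n_def sum.inter_filter[OF fin]
    by (rule sum.cong) auto
  have phi_w: "phi t i = (\<Sum>r\<in>\<delta> ` P. c t r * w r i)" for t i
  proof -
    have "(\<Sum>r\<in>\<delta> ` P. c t r * w r i) = (\<Sum>p\<in>P. \<Sum>r\<in>\<delta> ` P. if \<delta> p = r then c t r * f p i else 0)"
      unfolding w_def comb_def sum_distrib_left by (subst sum.swap) (intro sum.cong refl, simp)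
    also have "\<dots> = (\<Sum>p\<in>P. c t (\<delta> p) * f p i)"
      using fin by (intro sum.cong refl) simp
    finally show ?thesis by (simp add: phi_def comb_def c_def)
  qed
  have phi_z: "coef D Q (phi t) k = (\<Sum>r\<in>\<delta> ` P. c t r * z k r)" for t k
    unfolding z_def using coef_sum[of D Q "c t" w "\<delta> ` P" k] phi_w by (simp add: coef_def)
  have cphi: "(\<Sum>j<D. cnj (w r j) * phi t j) = c t r * of_real (n r)" for r t
  proof -
    have "(\<Sum>j<D. cnj (w r j) * phi t j) = (\<Sum>p\<in>{p\<in>P. \<delta> p = r}. c t (\<delta> p) * of_real (b p))"
      unfolding phi_def using w_inner[of "\<lambda>p. c t (\<delta> p)" r] by (simp add: c_def mult.commute)
    then show ?thesis by (simp add: n_def sum_distrib_left)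
  qed
  have key: "of_real (l k) * z k r = (LINT t|lborel. of_real (beta0 t) * (coef D Q (phi t) k * cnj (c t r * of_real (n r))))"
    and key_int: "integrable lborel (\<lambda>t. of_real (beta0 t) * (coef D Q (phi t) k * cnj (c t r * of_real (n r))))"
    if k: "k < D" for k r
  proof -
    have "of_real (l k) * z k r = (\<Sum>i<D. cnj (Q i k) * (\<Sum>m<D. Q i m * (of_real (l m) * z m r)))"
      by (rule unitary_fun_expand_col[OF U k])
    also have "\<dots> = (\<Sum>i<D. cnj (Q i k) * (\<Sum>j<D. Opt $$ (i, j) * w r j))"
      by (rule sum.cong[OF refl]) (use spectral_apply[OF s(1), of _ "w r"] in \<open>simp add: z_def mult_ac\<close>)
    also have "\<dots> = (\<Sum>i<D. \<Sum>j<D. cnj (Q i k) * Opt $$ (i, j) * w r j)"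
      by (simp add: sum_distrib_left mult.assoc)
    also have "\<dots> = (LINT t|lborel. of_real (beta0 t) * ((\<Sum>i<D. cnj (Q i k) * phi t i) * cnj (\<Sum>j<D. cnj (w r j) * phi t j)))"
      by (rule Opt_bilinear)
    finally show "of_real (l k) * z k r = (LINT t|lborel. of_real (beta0 t) * (coef D Q (phi t) k * cnj (c t r * of_real (n r))))"
      unfolding cphi coef_def .
    show "integrable lborel (\<lambda>t. of_real (beta0 t) * (coef D Q (phi t) k * cnj (c t r * of_real (n r))))"
      using Opt_bilinear_integrable[of "\<lambda>i. Q i k" "w r"] unfolding cphi coef_def .
  qed
  \<comment> \<open>The vectors \<open>w r\<close> are orthogonal with squared norms
    \<open>n r\<close>, so the sum is the squared length of the projection of the k-th eigenvector
    onto their span. It equals 1 unless the eigenvalue is 0, and over all k these lengths add up to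
    the dimension of the span.\<close>
  have span: "l k * (\<Sum>r\<in>\<delta> ` P. (norm (z k r))\<^sup>2 / n r) = l k" if k: "k < D" for k
  proof -
    have "complex_of_real (l k * (\<Sum>r\<in>\<delta> ` P. (norm (z k r))\<^sup>2 / n r))
        = (\<Sum>r\<in>\<delta> ` P. cnj (z k r) / of_real (n r) * (of_real (l k) * z k r))"
      by (simp only: of_real_mult of_real_sum of_real_divide complex_norm_square sum_distrib_left)
        (simp add: mult_ac)
    also have "\<dots> = (LINT t|lborel. (\<Sum>r\<in>\<delta> ` P. cnj (z k r) / of_real (n r) * (of_real (beta0 t) * (coef D Q (phi t) k * cnj (c t r * of_real (n r))))))"
      unfolding key[OF k]
      by (subst Bochner_Integration.integral_sum)
        (rule integrable_mult_right[OF key_int[OF k]], simp only: integral_mult_right_zero)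
    also have "(\<lambda>t. \<Sum>r\<in>\<delta> ` P. cnj (z k r) / of_real (n r) * (of_real (beta0 t) * (coef D Q (phi t) k * cnj (c t r * of_real (n r)))))
      = (\<lambda>t. of_real (beta0 t * (norm (coef D Q (phi t) k))\<^sup>2))"
    proof
      fix t
      have "(\<Sum>r\<in>\<delta> ` P. cnj (z k r) / of_real (n r) * (of_real (beta0 t) * (coef D Q (phi t) k * cnj (c t r * of_real (n r)))))
          = (\<Sum>r\<in>\<delta> ` P. of_real (beta0 t) * (coef D Q (phi t) k * cnj (c t r * z k r)))"
        by (rule sum.cong[OF refl]) (use n_pos in \<open>force simp: field_simps\<close>)
      also have "\<dots> = of_real (beta0 t) * (coef D Q (phi t) k * cnj (coef D Q (phi t) k))"
        unfolding phi_z[of t k] by (simp add: sum_distrib_left)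
      finally show "(\<Sum>r\<in>\<delta> ` P. cnj (z k r) / of_real (n r) * (of_real (beta0 t) * (coef D Q (phi t) k * cnj (c t r * of_real (n r)))))
          = of_real (beta0 t * (norm (coef D Q (phi t) k))\<^sup>2)"
        by (simp only: of_real_mult complex_norm_square)
    qed
    also have "(LINT t|lborel. complex_of_real (beta0 t * (norm (coef D Q (phi t) k))\<^sup>2)) = of_real (l k)"
      unfolding integral_complex_of_real Opt_eigenvalue(1)[OF s(1) k] ..
    finally show ?thesis by (simp only: of_real_eq_iff)
  qed
  have "(\<Sum>k<D. l k / (l k + x)) \<le> (\<Sum>k<D. \<Sum>r\<in>\<delta> ` P. (norm (z k r))\<^sup>2 / n r)"
  proof (rule sum_mono)
    fix k assume "k \<in> {..<D}"
    then have k: "k < D" by simp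
    have nn: "0 \<le> (\<Sum>r\<in>\<delta> ` P. (norm (z k r))\<^sup>2 / n r)"
      using n_pos by (intro sum_nonneg divide_nonneg_pos) auto
    show "l k / (l k + x) \<le> (\<Sum>r\<in>\<delta> ` P. (norm (z k r))\<^sup>2 / n r)"
    proof (cases "l k = 0")
      case False
      with span[OF k] have "(\<Sum>r\<in>\<delta> ` P. (norm (z k r))\<^sup>2 / n r) = 1" by simp
      then show ?thesis using s(2)[OF k] x by (simp add: divide_simps)
    qed (use nn in simp)
  qed
  also have "\<dots> = (\<Sum>r\<in>\<delta> ` P. (\<Sum>k<D. (norm (z k r))\<^sup>2) / n r)"
    by (subst sum.swap) (simp add: sum_divide_distrib)
  also have "\<dots> = (\<Sum>r\<in>\<delta> ` P. 1)"
    by (rule sum.cong[OF refl]) (use n_pos zn in force)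
  finally show ?thesis by simp
qed

text \<open>This is Re g'(0) \<le> 0 spelled out. Positivity of all \<open>\<delta> p\<close> lets
  every power of \<Delta> be written as an exponential, and the 1 / N in the eigenvalues
  \<open>w\<close> of \<omega> reappears as the summand ln N.\<close>

lemma log_expectation_Opt_shift:
  assumes \<delta>_pos: "\<And>p. p \<in> P \<Longrightarrow> 0 < \<delta> p"
    and s: "spectral D Opt Q l" "\<And>k. k < D \<Longrightarrow> 0 \<le> l k" and x: "x > 0"
  shows "(\<Sum>p\<in>P. b p * ln (\<delta> p))
    \<le> (\<Sum>k<D. (norm (coef D Q (($) \<psi>) k))\<^sup>2 * ln (l k + x)) + ln (real (card (\<delta> ` P)))"
proof -
  have U: "unitary_fun D Q" using s by (simp add: spectral_def)
  have "P \<noteq> {}" using b_sum by auto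
  define N where "N = real (card (\<delta> ` P))"
  have N: "N > 0" unfolding N_def using fin \<open>P \<noteq> {}\<close> by (simp add: card_gt_0_iff)
  define y where "y = coef D Q (($) \<psi>)"
  define e where "e k p = coef D Q (f p) k" for k p
  define w where "w k = 1 / (N * (l k + x))" for k
  have w_pos: "w k > 0" if "k < D" for k
    using N s(2)[OF that] x by (simp add: w_def add_nonneg_pos)
  define I where "I = {..<D} \<times> P"
  have I: "finite I" using fin by (simp add: I_def)
  \<comment> \<open>The expansion of g into exponentials: the pair (k, p) has the amplitude
    <\<psi>|u_k> <u_k|f p> and half the logarithm of \<open>w k * \<delta> p\<close> as
    frequency.\<close>
  define A where "A i = (case i of (k, p) \<Rightarrow> cnj (y k) * e k p)" for i
  define C where "C i = (case i of (k, p) \<Rightarrow> (ln (w k) + ln (\<delta> p)) / 2)" for i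
  define G where "G z = (\<Sum>i\<in>I. A i * exp (of_real (C i) * z))" for z
  define V where "V z = comb (\<lambda>p. exp (of_real (ln (\<delta> p)) / 2 * z))" for z
  have G_eq: "G z = (\<Sum>k<D. cnj (y k) * (exp (of_real (ln (w k)) / 2 * z) * coef D Q (V z) k))" for z
  proof -
    have "G z = (\<Sum>k<D. \<Sum>p\<in>P. cnj (y k) * e k p * exp (of_real ((ln (w k) + ln (\<delta> p)) / 2) * z))"
      unfolding G_def I_def A_def C_def by (simp add: sum.cartesian_product split_def)
    also have "\<dots> = (\<Sum>k<D. cnj (y k) * (exp (of_real (ln (w k)) / 2 * z) * coef D Q (V z) k))"
      unfolding V_def coef_comb e_def[symmetric] sum_distrib_left
      by (intro sum.cong refl) (simp add: exp_add[symmetric] add_divide_distrib ring_distribs ac_simps)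
    finally show ?thesis .
  qed
  have y_norm: "(\<Sum>k<D. (norm (cnj (y k)))\<^sup>2) = 1"
    unfolding complex_mod_cnj y_def unitary_norm_coef[OF U] psi_norm ..
  have G_bound: "(norm (G z))\<^sup>2 \<le> (\<Sum>k<D. exp (ln (w k) * Re z) * (norm (coef D Q (V z) k))\<^sup>2)" for z
  proof -
    have "(norm (G z))\<^sup>2 \<le> 1 * (\<Sum>k<D. (norm (exp (of_real (ln (w k)) / 2 * z) * coef D Q (V z) k))\<^sup>2)"
      unfolding G_eq y_norm[symmetric] by (rule norm_sum_mult_square_le)
    also have "(\<Sum>k<D. (norm (exp (of_real (ln (w k)) / 2 * z) * coef D Q (V z) k))\<^sup>2)
        = (\<Sum>k<D. exp (ln (w k) * Re z) * (norm (coef D Q (V z) k))\<^sup>2)"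
      by (intro sum.cong refl) (simp add: norm_mult power_mult_distrib exp_double[symmetric])
    finally show ?thesis by simp
  qed
  have G0: "(norm (G (\<i> * of_real t)))\<^sup>2 \<le> 1" for t
  proof -
    have "(norm (G (\<i> * of_real t)))\<^sup>2 \<le> (\<Sum>k<D. (norm (coef D Q (V (\<i> * of_real t)) k))\<^sup>2)"
      using G_bound[of "\<i> * of_real t"] by simp
    also have "\<dots> = 1"
      unfolding unitary_norm_coef[OF U] V_def comb_norm by (simp add: b_sum)
    finally show ?thesis .
  qed
  have V1: "V (1 + \<i> * of_real t) = phi t" for t
    unfolding V_def phi_def comb_def using \<delta>_pos by (intro ext sum.cong refl) (simp add: cpow_exp mult_ac)
  have G1: "(norm (G (1 + \<i> * of_real t)))\<^sup>2 \<le> (\<Sum>k<D. w k * (norm (coef D Q (phi t) k))\<^sup>2)" for t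
  proof -
    have "(\<Sum>k<D. exp (ln (w k) * Re (1 + \<i> * of_real t)) * (norm (coef D Q (phi t) k))\<^sup>2)
        = (\<Sum>k<D. w k * (norm (coef D Q (phi t) k))\<^sup>2)"
      by (rule sum.cong) (use w_pos in auto)
    with G_bound[of "1 + \<i> * of_real t"] show ?thesis unfolding V1 by simp
  qed
  have int1: "(LINT t|lborel. beta0 t * (norm (G (1 + \<i> * of_real t)))\<^sup>2) \<le> 1"
  proof -
    have "(LINT t|lborel. beta0 t * (norm (G (1 + \<i> * of_real t)))\<^sup>2)
        \<le> (LINT t|lborel. (\<Sum>k<D. w k * (beta0 t * (norm (coef D Q (phi t) k))\<^sup>2)))"
    proof (rule integral_mono')
      show "integrable lborel (\<lambda>t. \<Sum>k<D. w k * (beta0 t * (norm (coef D Q (phi t) k))\<^sup>2))"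
        by (intro Bochner_Integration.integrable_sum integrable_mult_right Opt_eigenvalue(2)[OF s(1)]) simp
      fix t
      show "beta0 t * (norm (G (1 + \<i> * of_real t)))\<^sup>2 \<le> (\<Sum>k<D. w k * (beta0 t * (norm (coef D Q (phi t) k))\<^sup>2))"
        using mult_left_mono[OF G1 beta0_nonneg[of t], of t] by (simp add: sum_distrib_left mult_ac)
      show "0 \<le> (\<Sum>k<D. w k * (beta0 t * (norm (coef D Q (phi t) k))\<^sup>2))"
        using w_pos by (intro sum_nonneg mult_nonneg_nonneg) (auto intro: less_imp_le)
    qed
    \<comment> \<open>The trace of \<omega> times \<open>Opt\<close>, which \<open>Opt_rank\<close>
      and the factor 1 / N bring below 1.\<close>
    also have "\<dots> = (\<Sum>k<D. w k * l k)"
      by (subst Bochner_Integration.integral_sum)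
        (auto intro!: integrable_mult_right Opt_eigenvalue(2)[OF s(1)] sum.cong simp: Opt_eigenvalue(1)[OF s(1)])
    also have "\<dots> = (\<Sum>k<D. l k / (l k + x)) / N"
      by (simp add: w_def sum_divide_distrib field_simps)
    also have "\<dots> \<le> 1"
      using Opt_rank[OF s x] N by (simp add: N_def)
    finally show ?thesis .
  qed
  have sum_A: "(\<Sum>i\<in>I. A i) = 1"
  proof -
    have "(\<Sum>i\<in>I. A i) = G 0" by (simp add: G_def)
    also have "\<dots> = (\<Sum>k<D. cnj (y k) * coef D Q (comb (\<lambda>_. 1)) k)"
      unfolding G_eq by (simp add: V_def)
    also have "\<dots> = (\<Sum>k<D. cnj (y k) * y k)"
      unfolding y_def by (intro sum.cong refl arg_cong2[of _ _ _ _ "(*)"] coef_cong) (simp add: psi_comb)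
    also have "\<dots> = of_real (\<Sum>k<D. (norm (y k))\<^sup>2)"
      unfolding of_real_sum_norm_square by (simp add: mult.commute)
    finally show ?thesis unfolding y_norm[unfolded complex_mod_cnj] by simp
  qed
  \<comment> \<open>The derivative of \<open>G\<close> at 0. It decouples, since summing the
    amplitudes over p or over k leaves the weights of \<psi> in the eigenbasis of \<open>Opt\<close>
    or in the components.\<close>
  have sum_AC: "(\<Sum>i\<in>I. A i * of_real (C i))
      = of_real (((\<Sum>k<D. (norm (y k))\<^sup>2 * ln (w k)) + (\<Sum>p\<in>P. b p * ln (\<delta> p))) / 2)"
  proof -
    have ye: "(\<Sum>p\<in>P. e k p) = y k" for k
      using coef_comb[of Q "\<lambda>_. 1" k] coef_cong[of D "($) \<psi>" "comb (\<lambda>_. 1)" Q k]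
      by (simp add: psi_comb y_def e_def)
    have ey: "(\<Sum>k<D. e k p * cnj (y k)) = of_real (b p)" if "p \<in> P" for p
    proof -
      have "(\<Sum>k<D. e k p * cnj (y k)) = (\<Sum>i<D. f p i * cnj (\<psi> $ i))"
        unfolding e_def y_def by (rule unitary_parseval_coef[OF U])
      also have "\<dots> = (\<Sum>i<D. \<Sum>q\<in>P. f p i * cnj (f q i))"
        by (rule sum.cong) (auto simp: psi sum_distrib_left)
      also have "\<dots> = (\<Sum>q\<in>P. if p = q then of_real (b p) else 0)"
        by (subst sum.swap) (rule sum.cong[OF refl], rule orth, use that in auto)
      finally show ?thesis using fin that by simp
    qed
    have "(\<Sum>i\<in>I. A i * of_real (C i)) = (\<Sum>k<D. \<Sum>p\<in>P. cnj (y k) * e k p * of_real ((ln (w k) + ln (\<delta> p)) / 2))"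
      unfolding I_def A_def C_def by (simp add: sum.cartesian_product split_def)
    also have "\<dots> = (\<Sum>k<D. \<Sum>p\<in>P. cnj (y k) * of_real (ln (w k)) / 2 * e k p) + (\<Sum>k<D. \<Sum>p\<in>P. of_real (ln (\<delta> p)) / 2 * (e k p * cnj (y k)))"
      unfolding sum.distrib[symmetric] by (intro sum.cong refl) (simp add: field_simps)
    also have "(\<Sum>k<D. \<Sum>p\<in>P. cnj (y k) * of_real (ln (w k)) / 2 * e k p) = (\<Sum>k<D. of_real (ln (w k)) / 2 * (y k * cnj (y k)))"
      unfolding sum_distrib_left[symmetric] ye by (simp add: mult_ac)
    also have "\<dots> = of_real ((\<Sum>k<D. (norm (y k))\<^sup>2 * ln (w k)) / 2)"
      unfolding complex_norm_square[symmetric] by (simp add: sum_divide_distrib mult_ac)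
    also have "(\<Sum>k<D. \<Sum>p\<in>P. of_real (ln (\<delta> p)) / 2 * (e k p * cnj (y k))) = (\<Sum>p\<in>P. of_real (ln (\<delta> p)) / 2 * of_real (b p))"
      by (subst sum.swap) (intro sum.cong refl, simp only: sum_distrib_left[symmetric] ey)
    also have "\<dots> = of_real ((\<Sum>p\<in>P. b p * ln (\<delta> p)) / 2)"
      by (simp add: sum_divide_distrib mult_ac)
    finally show ?thesis by (simp add: add_divide_distrib)
  qed
  \<comment> \<open>The squared function is again an exponential sum, indexed by pairs, and the
    second moment bound \<open>int1\<close> for \<open>G\<close> is a first moment bound for
    it.\<close>
  have GG: "(\<Sum>j\<in>I \<times> I. (A (fst j) * A (snd j)) * exp (of_real (C (fst j) + C (snd j)) * z)) = G z * G z" for z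
    unfolding G_def sum_product sum.cartesian_product
    by (intro sum.cong refl) (auto simp: exp_add ring_distribs)
  have "Re (\<Sum>j\<in>I \<times> I. (A (fst j) * A (snd j)) * of_real (C (fst j) + C (snd j))) \<le> 0"
  proof (rule Re_derivative_le_0)
    show "finite (I \<times> I)" using I by simp
    show "(\<Sum>j\<in>I \<times> I. A (fst j) * A (snd j)) = 1"
    proof -
      have "(\<Sum>j\<in>I \<times> I. A (fst j) * A (snd j)) = sum A I * sum A I"
        unfolding sum_product sum.cartesian_product by (intro sum.cong refl) auto
      then show ?thesis by (simp add: sum_A)
    qed
    fix t
    have "(\<Sum>j\<in>I \<times> I. A (fst j) * A (snd j) * exp (\<i> * of_real (C (fst j) + C (snd j)) * of_real t)) = G (\<i> * of_real t) * G (\<i> * of_real t)"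
      using GG[of "\<i> * of_real t"] by (simp add: mult_ac)
    then show "norm (\<Sum>j\<in>I \<times> I. A (fst j) * A (snd j) * exp (\<i> * of_real (C (fst j) + C (snd j)) * of_real t)) \<le> 1"
      using G0[of t] by (simp add: norm_mult power2_eq_square)
  next
    show "(LINT t|lborel. beta0 t * norm (\<Sum>j\<in>I \<times> I. A (fst j) * A (snd j) * exp (of_real (C (fst j) + C (snd j)) * (1 + \<i> * of_real t)))) \<le> 1"
      unfolding GG using int1 by (simp add: norm_mult power2_eq_square)
  qed
  moreover have "(\<Sum>j\<in>I \<times> I. (A (fst j) * A (snd j)) * of_real (C (fst j) + C (snd j)))
      = (\<Sum>i\<in>I. A i * of_real (C i)) * (\<Sum>i\<in>I. A i) + (\<Sum>i\<in>I. A i) * (\<Sum>i\<in>I. A i * of_real (C i))"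
    unfolding sum_product sum.cartesian_product sum.distrib[symmetric]
    by (intro sum.cong refl) (auto simp: algebra_simps)
  ultimately have "(\<Sum>k<D. (norm (y k))\<^sup>2 * ln (w k)) + (\<Sum>p\<in>P. b p * ln (\<delta> p)) \<le> 0"
    unfolding sum_AC sum_A mult_1_right mult_1_left of_real_add[symmetric]
    by (simp only: Re_complex_of_real field_sum_of_halves)
  moreover have "(\<Sum>k<D. (norm (y k))\<^sup>2 * ln (w k)) = - ln N * (\<Sum>k<D. (norm (y k))\<^sup>2) - (\<Sum>k<D. (norm (y k))\<^sup>2 * ln (l k + x))"
    unfolding sum_distrib_left sum_subtractf[symmetric]
  proof (rule sum.cong[OF refl])
    fix k assume "k \<in> {..<D}"
    then have "l k + x > 0" using s(2)[of k] x by simp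
    then show "(norm (y k))\<^sup>2 * ln (w k) = - ln N * (norm (y k))\<^sup>2 - (norm (y k))\<^sup>2 * ln (l k + x)"
    proof -
      have "ln (w k) = - (ln N + ln (l k + x))"
        using N \<open>l k + x > 0\<close> unfolding w_def by (subst ln_div) (simp_all add: ln_mult)
      then show ?thesis by (simp only:) (simp add: algebra_simps)
    qed
  qed
  ultimately show ?thesis using y_norm by (simp add: y_def N_def)
qed

lemma log_expectation_Opt_ge:
  "logsum P b \<delta> \<le> log_expectation Opt \<psi> + ereal (ln (real (card (\<delta> ` P))))"
proof (cases "\<forall>p\<in>P. \<delta> p > 0")
  case True
  obtain Q l where s: "spectral D Opt Q l" "\<And>k. k < D \<Longrightarrow> 0 \<le> l k" using psd_spectral[OF Opt_psd] by blast
  have "ereal (\<Sum>p\<in>P. b p * ln (\<delta> p)) \<le> logsum {..<D} (\<lambda>k. (norm (coef D Q (($) \<psi>) k))\<^sup>2) l + ereal (ln (real (card (\<delta> ` P))))"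
    by (rule logsum_ge) (use s log_expectation_Opt_shift[OF _ s] True in auto)
  then show ?thesis
    using True by (simp add: log_expectation_spectral[OF s psi_carrier] logsum_def)
next
  case False
  then have "\<not> (\<forall>p\<in>P. b p \<noteq> 0 \<longrightarrow> \<delta> p > 0)" using b_pos less_numeral_extra(3) by metis
  then have "logsum P b \<delta> = -\<infinity>" unfolding logsum_def by (rule if_not_P)
  then show ?thesis by simp
qed

end

subsection \<open>Purifications\<close>

lemma sum_pair_index:
  fixes g :: "nat \<Rightarrow> 'a :: comm_monoid_add"
  shows "(\<Sum>i<m * n. g i) = (\<Sum>a<m. \<Sum>b<n. g (a * n + b))"
proof -
  have "(\<Sum>b<n. g (a * n + b)) = sum g {a * n..<a * n + n}" for a
    by (simp add: sum.atLeastLessThan_shift_0[of g "a * n"] lessThan_atLeast0)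
  then show ?thesis using sum.nat_group[of g n m] by simp
qed

lemma pair_index_less:
  fixes a b m n :: nat
  assumes "a < m" "b < n" shows "a * n + b < m * n"
proof -
  have "a * n + b < a * n + n" using assms by simp
  also have "\<dots> = Suc a * n" by simp
  also have "\<dots> \<le> m * n" using assms by (intro mult_right_mono) auto
  finally show ?thesis .
qed

lemma qform_pair_index:
  "qform (m * n) T v = (\<Sum>x<m. \<Sum>y<n. \<Sum>x'<m. \<Sum>y'<n. cnj (v (x * n + y)) * T $$ (x * n + y, x' * n + y') * v (x' * n + y'))"
  by (simp add: qform_def sum_pair_index)

lemma ptrace_B_carrier [simp]: "ptrace_B m n T \<in> carrier_mat m m"
  by (simp add: ptrace_B_def)

lemma mtrace_ptrace_B:
  assumes "T \<in> carrier_mat (m * n) (m * n)"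
  shows "mtrace (ptrace_B m n T) = mtrace T"
  using assms by (simp add: mtrace_def ptrace_B_def sum_pair_index)

text \<open>The partial trace sums the blocks <e_y|T|e_y>, and the vector on the right is h
  \<otimes> e_y.\<close>

lemma qform_ptrace_B:
  "qform m (ptrace_B m n T) h = (\<Sum>y<n. qform (m * n) T (\<lambda>i. if i mod n = y then h (i div n) else 0))"
proof -
  have "qform (m * n) T (\<lambda>i. if i mod n = y then h (i div n) else 0)
      = (\<Sum>x<m. \<Sum>x'<m. cnj (h x) * T $$ (x * n + y, x' * n + y) * h x')" if y: "y < n" for y
  proof -
    have "qform (m * n) T (\<lambda>i. if i mod n = y then h (i div n) else 0)
      = (\<Sum>x<m. \<Sum>z<n. \<Sum>x'<m. \<Sum>z'<n. if z = y then (if z' = y then cnj (h x) * T $$ (x * n + z, x' * n + z') * h x' else 0) else 0)"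
      unfolding qform_pair_index by (intro sum.cong refl) auto
    also have "\<dots> = (\<Sum>x<m. \<Sum>z<n. if z = y then (\<Sum>x'<m. cnj (h x) * T $$ (x * n + z, x' * n + y) * h x') else 0)"
      using y by (intro sum.cong refl) auto
    finally show ?thesis using y by simp
  qed
  then have "(\<Sum>y<n. qform (m * n) T (\<lambda>i. if i mod n = y then h (i div n) else 0))
      = (\<Sum>y<n. \<Sum>x<m. \<Sum>x'<m. cnj (h x) * T $$ (x * n + y, x' * n + y) * h x')" by simp
  also have "\<dots> = (\<Sum>x<m. \<Sum>x'<m. \<Sum>y<n. cnj (h x) * T $$ (x * n + y, x' * n + y) * h x')"
    by (rule trans[OF sum.swap sum.cong[OF refl sum.swap]])
  also have "\<dots> = qform m (ptrace_B m n T) h"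
    by (simp add: qform_def ptrace_B_def sum_distrib_left sum_distrib_right)
  finally show ?thesis ..
qed

lemma psd_ptrace_B:
  assumes "psd (m * n) T" shows "psd m (ptrace_B m n T)"
proof (rule psdI[OF ptrace_B_carrier])
  show "ptrace_B m n T $$ (j, i) = cnj (ptrace_B m n T $$ (i, j))" if "i < m" "j < m" for i j
  proof -
    have "T $$ (j * n + k, i * n + k) = cnj (T $$ (i * n + k, j * n + k))" if "k < n" for k
      using that \<open>i < m\<close> \<open>j < m\<close> by (intro psd_hermitian[OF assms]) (auto simp: pair_index_less)
    then show ?thesis using that by (simp add: ptrace_B_def)
  qed
  show "0 \<le> Re (qform m (ptrace_B m n T) v)" for v
    unfolding qform_ptrace_B Re_sum by (intro sum_nonneg psd_qform[OF assms])
qed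

text \<open>\<open>v = (X \<otimes> 1) w\<close> for a subnormalized \<open>w\<close>, and \<open>\<langle>w|Y|w\<rangle> \<le> tr Y\<close> for positive \<open>Y\<close>.\<close>

lemma qform_tensor_le:
  assumes T: "psd (m * n) T"
    and v: "\<And>x y. x < m \<Longrightarrow> y < n \<Longrightarrow> v (x * n + y) = (\<Sum>j<J. H j x * S j y)"
    and S: "(\<Sum>j<J. \<Sum>y<n. (norm (S j y))\<^sup>2) \<le> 1"
  shows "Re (qform (m * n) T v) \<le> (\<Sum>j<J. Re (qform m (ptrace_B m n T) (H j)))"
proof -
  obtain Q l where s: "spectral (m * n) T Q l" "\<And>k. k < m * n \<Longrightarrow> 0 \<le> l k" using psd_spectral[OF T] by blast
  \<comment> \<open>With \<open>E j y\<close> = H j \<otimes> e_y, the vector v is the combination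
    with coefficients \<open>S j y\<close>. Their total squared weight is at most 1, so
    Cauchy-Schwarz bounds each coordinate of v.\<close>
  define E where "E j y i = (if i mod n = y then H j (i div n) else 0)" for j y i
  have le: "(norm (coef (m * n) Q v k))\<^sup>2 \<le> (\<Sum>j<J. \<Sum>y<n. (norm (coef (m * n) Q (E j y) k))\<^sup>2)" for k
  proof -
    have "coef (m * n) Q v k = coef (m * n) Q (\<lambda>i. \<Sum>p\<in>{..<J} \<times> {..<n}. S (fst p) (snd p) * E (fst p) (snd p) i) k"
    proof (rule coef_cong)
      fix i assume "i < m * n"
      then have n: "0 < n" by (cases n) auto
      have i: "i div n < m" "i mod n < n" "i div n * n + i mod n = i"
        using n \<open>i < m * n\<close> by (auto simp: less_mult_imp_div_less)
      have "(\<Sum>p\<in>{..<J} \<times> {..<n}. S (fst p) (snd p) * E (fst p) (snd p) i) = (\<Sum>j<J. \<Sum>y<n. S j y * E j y i)"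
        by (simp add: sum.cartesian_product split_def)
      also have "\<dots> = (\<Sum>j<J. \<Sum>y<n. if y = i mod n then H j (i div n) * S j (i mod n) else 0)"
        by (intro sum.cong refl) (auto simp: E_def)
      also have "\<dots> = v i" using v[OF i(1,2)] i by simp
      finally show "v i = (\<Sum>p\<in>{..<J} \<times> {..<n}. S (fst p) (snd p) * E (fst p) (snd p) i)" ..
    qed
    also have "\<dots> = (\<Sum>p\<in>{..<J} \<times> {..<n}. S (fst p) (snd p) * coef (m * n) Q (E (fst p) (snd p)) k)"
      by (rule coef_sum)
    finally have "(norm (coef (m * n) Q v k))\<^sup>2 \<le> (\<Sum>p\<in>{..<J} \<times> {..<n}. (norm (S (fst p) (snd p)))\<^sup>2)
        * (\<Sum>p\<in>{..<J} \<times> {..<n}. (norm (coef (m * n) Q (E (fst p) (snd p)) k))\<^sup>2)"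
      by (simp only: norm_sum_mult_square_le)
    also have "\<dots> \<le> 1 * (\<Sum>p\<in>{..<J} \<times> {..<n}. (norm (coef (m * n) Q (E (fst p) (snd p)) k))\<^sup>2)"
      using S by (intro mult_right_mono sum_nonneg) (auto simp: sum.cartesian_product split_def)
    finally show ?thesis by (simp add: sum.cartesian_product split_def)
  qed
  have "Re (qform (m * n) T v) = (\<Sum>k<m * n. l k * (norm (coef (m * n) Q v k))\<^sup>2)"
    by (simp only: spectral_qform[OF s(1)] Re_complex_of_real)
  also have "\<dots> \<le> (\<Sum>k<m * n. l k * (\<Sum>j<J. \<Sum>y<n. (norm (coef (m * n) Q (E j y) k))\<^sup>2))"
    by (intro sum_mono mult_left_mono le s(2)) simp
  also have "\<dots> = (\<Sum>k<m * n. \<Sum>j<J. \<Sum>y<n. l k * (norm (coef (m * n) Q (E j y) k))\<^sup>2)"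
    by (simp only: sum_distrib_left)
  also have "\<dots> = (\<Sum>j<J. \<Sum>y<n. \<Sum>k<m * n. l k * (norm (coef (m * n) Q (E j y) k))\<^sup>2)"
    by (rule trans[OF sum.swap sum.cong[OF refl sum.swap]])
  also have "\<dots> = (\<Sum>j<J. \<Sum>y<n. Re (qform (m * n) T (E j y)))"
    by (simp only: spectral_qform[OF s(1)] Re_complex_of_real)
  also have "\<dots> = (\<Sum>j<J. Re (qform m (ptrace_B m n T) (H j)))"
    unfolding qform_ptrace_B E_def Re_sum ..
  finally show ?thesis .
qed

lemma qform_add:
  "qform d (Matrix.mat d d (\<lambda>p. X $$ p + Y $$ p)) v = qform d X v + qform d Y v"
  unfolding qform_def by (simp add: algebra_simps sum.distrib)

lemma qform_diff:
  "qform d (Matrix.mat d d (\<lambda>p. X $$ p - Y $$ p)) v = qform d X v - qform d Y v"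
  unfolding qform_def by (simp add: algebra_simps sum_subtractf)

lemma psd_zero_entries:
  assumes X: "psd d X" and z: "\<And>v. qform d X v = 0" and ij: "i < d" "j < d"
  shows "X $$ (i, j) = 0"
proof -
  obtain Q l where s: "spectral d X Q l" using psd_spectral[OF X] by blast
  have U: "unitary_fun d Q" using s by (simp add: spectral_def)
  have "l k = 0" if "k < d" for k
  proof -
    have "(\<Sum>m<d. l m * (norm (coef d Q (\<lambda>i. Q i k) m))\<^sup>2) = (\<Sum>m<d. if m = k then l m else 0)"
      by (rule sum.cong) (use coef_column[OF U _ that] in auto)
    then have "qform d X (\<lambda>i. Q i k) = of_real (l k)"
      using that by (simp only: spectral_qform[OF s]) simp
    with z show ?thesis by simp
  qed
  with s ij show ?thesis by (simp add: spectral_def)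
qed

text \<open>This is R \<otimes> 1 / n; it supplies a missing marginal by a positive
  operator.\<close>

definition maximally_mixed_extension :: "nat \<Rightarrow> nat \<Rightarrow> complex mat \<Rightarrow> complex mat" where
  "maximally_mixed_extension m n R = Matrix.mat (m * n) (m * n)
     (\<lambda>(i, j). if i mod n = j mod n then R $$ (i div n, j div n) / of_nat n else 0)"

lemma qform_maximally_mixed_extension:
  "qform (m * n) (maximally_mixed_extension m n R) v = (\<Sum>y<n. qform m R (\<lambda>x. v (x * n + y))) / of_nat n"
proof -
  have "qform (m * n) (maximally_mixed_extension m n R) v
      = (\<Sum>x<m. \<Sum>y<n. \<Sum>x'<m. \<Sum>y'<n. if y = y' then cnj (v (x * n + y)) * R $$ (x, x') * v (x' * n + y) / of_nat n else 0)"
    unfolding qform_pair_index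
    by (intro sum.cong refl) (auto simp: maximally_mixed_extension_def pair_index_less)
  also have "\<dots> = (\<Sum>x<m. \<Sum>y<n. \<Sum>x'<m. cnj (v (x * n + y)) * R $$ (x, x') * v (x' * n + y) / of_nat n)"
    by (intro sum.cong refl) simp
  also have "\<dots> = (\<Sum>y<n. \<Sum>x<m. \<Sum>x'<m. cnj (v (x * n + y)) * R $$ (x, x') * v (x' * n + y) / of_nat n)"
    by (rule sum.swap)
  finally show ?thesis by (simp add: qform_def sum_divide_distrib)
qed

lemma psd_maximally_mixed_extension:
  assumes "psd m R" shows "psd (m * n) (maximally_mixed_extension m n R)"
proof (rule psdI)
  show "maximally_mixed_extension m n R \<in> carrier_mat (m * n) (m * n)"
    by (simp add: maximally_mixed_extension_def)
  fix i j assume ij: "i < m * n" "j < m * n"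
  then have "R $$ (j div n, i div n) = cnj (R $$ (i div n, j div n))"
    by (intro psd_hermitian[OF assms]) (auto simp: less_mult_imp_div_less)
  with ij show "maximally_mixed_extension m n R $$ (j, i) = cnj (maximally_mixed_extension m n R $$ (i, j))"
    by (simp add: maximally_mixed_extension_def)
next
  fix v
  have "Re (qform (m * n) (maximally_mixed_extension m n R) v) = (\<Sum>y<n. Re (qform m R (\<lambda>x. v (x * n + y)))) / real n"
    unfolding qform_maximally_mixed_extension by (simp add: Re_divide_of_nat)
  then show "0 \<le> Re (qform (m * n) (maximally_mixed_extension m n R) v)"
    by (simp add: sum_nonneg psd_qform[OF assms])
qed

lemma ptrace_maximally_mixed_extension:
  assumes "n > 0" "i < m" "j < m"
  shows "ptrace_B m n (maximally_mixed_extension m n R) $$ (i, j) = R $$ (i, j)"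
  using assms by (simp add: ptrace_B_def maximally_mixed_extension_def pair_index_less)

lemma purification_unit:
  assumes "purification dA dB \<psi> \<rho>" shows "(\<Sum>i<dA * dB. (norm (\<psi> $ i))\<^sup>2) = 1"
proof -
  have "complex_of_real (\<Sum>i<dA * dB. (norm (\<psi> $ i))\<^sup>2) = \<psi> \<bullet>c \<psi>"
    unfolding of_real_sum_norm_square using assms
    by (auto simp: purification_def scalar_prod_def conjugate_vec_def lessThan_atLeast0[symmetric])
  then show ?thesis using assms by (simp add: purification_def del: of_real_sum)
qed

section \<open>The Schmidt decomposition and the relative modular operator\<close>

locale purified_pair =
  fixes DA DB :: nat and \<rho> \<sigma> :: "complex mat" and \<psi> :: "complex vec"
    and U V :: "nat \<Rightarrow> nat \<Rightarrow> complex" and \<nu> \<mu> :: "nat \<Rightarrow> real"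
  assumes rho: "spectral DA \<rho> U \<nu>" and nu: "\<And>k. k < DA \<Longrightarrow> 0 \<le> \<nu> k"
    and sigma: "spectral DA \<sigma> V \<mu>" and mu: "\<And>k. k < DA \<Longrightarrow> 0 \<le> \<mu> k"
    and pur: "purification DA DB \<psi> \<rho>"
begin

text \<open>The unnormalized Schmidt vector in B that goes with the j-th eigenvector u_j of \<rho>:
  \<psi> is the sum of all u_j \<otimes> schmidt j.\<close>

definition schmidt :: "nat \<Rightarrow> nat \<Rightarrow> complex" where
  "schmidt j y = coef DA U (\<lambda>x. \<psi> $ (x * DB + y)) j"

definition overlap :: "nat \<Rightarrow> nat \<Rightarrow> complex" where
  "overlap a j = coef DA V (\<lambda>x. U x j) a"

text \<open>Exactly the pairs with a nonzero component of \<psi>, since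
  \<open>orthogonal_decomposition\<close> asks for positive weights.\<close>

definition pairs :: "(nat \<times> nat) set" where
  "pairs = {(a, j). a < DA \<and> j < DA \<and> overlap a j \<noteq> 0 \<and> \<nu> j > 0}"

text \<open>The component <v_a|u_j> v_a \<otimes> schmidt j. It is an eigenvector of the relative
  modular operator, as v_a is one of \<sigma> for \<mu> a and schmidt j is one of the reduced state
  on B for \<nu> j; hence \<open>ratio\<close>.\<close>

definition component :: "nat \<times> nat \<Rightarrow> nat \<Rightarrow> complex" where
  "component p i = (case p of (a, j) \<Rightarrow> overlap a j * V (i div DB) a * schmidt j (i mod DB))"

definition weight :: "nat \<times> nat \<Rightarrow> real" where
  "weight p = (case p of (a, j) \<Rightarrow> (norm (overlap a j))\<^sup>2 * \<nu> j)"

definition ratio :: "nat \<times> nat \<Rightarrow> real" where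
  "ratio p = (case p of (a, j) \<Rightarrow> \<mu> a / \<nu> j)"

lemma unitary_U: "unitary_fun DA U" and unitary_V: "unitary_fun DA V"
  using rho sigma by (auto simp: spectral_def)

lemma psi_carrier: "\<psi> \<in> carrier_vec (DA * DB)"
  using pur by (simp add: purification_def)

lemma psi_unit: "(\<Sum>i<DA * DB. (norm (\<psi> $ i))\<^sup>2) = 1"
  by (rule purification_unit[OF pur])

lemma rho_entry:
  assumes "a < DA" "a' < DA"
  shows "\<rho> $$ (a, a') = (\<Sum>y<DB. \<psi> $ (a * DB + y) * cnj (\<psi> $ (a' * DB + y)))"
proof -
  have "\<rho> = ptrace_B DA DB (ket_bra \<psi>)" using pur by (simp add: purification_def)
  then show ?thesis using assms psi_carrier by (simp add: ptrace_B_def ket_bra_def pair_index_less)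
qed

text \<open>The Gram matrix of the Schmidt vectors is \<rho> written in its own eigenbasis.\<close>

lemma schmidt_inner:
  assumes "j < DA" "k < DA"
  shows "(\<Sum>y<DB. schmidt j y * cnj (schmidt k y)) = (if j = k then of_real (\<nu> j) else 0)"
proof -
  have "(\<Sum>y<DB. schmidt j y * cnj (schmidt k y))
      = (\<Sum>y<DB. \<Sum>a<DA. \<Sum>a'<DA. cnj (U a j) * (\<psi> $ (a * DB + y) * cnj (\<psi> $ (a' * DB + y)) * U a' k))"
    unfolding schmidt_def coef_def cnj_sum sum_product by (intro sum.cong refl) (simp add: mult_ac)
  also have "\<dots> = (\<Sum>a<DA. \<Sum>a'<DA. \<Sum>y<DB. cnj (U a j) * (\<psi> $ (a * DB + y) * cnj (\<psi> $ (a' * DB + y)) * U a' k))"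
    by (rule trans[OF sum.swap sum.cong[OF refl sum.swap]])
  also have "\<dots> = (\<Sum>a<DA. cnj (U a j) * (\<Sum>a'<DA. \<rho> $$ (a, a') * U a' k))"
    by (simp add: rho_entry sum_distrib_left sum_distrib_right)
  also have "\<dots> = (\<Sum>a<DA. cnj (U a j) * (of_real (\<nu> k) * U a k))"
  proof (rule sum.cong[OF refl])
    fix a assume "a \<in> {..<DA}"
    then have "(\<Sum>a'<DA. \<rho> $$ (a, a') * U a' k) = (\<Sum>m<DA. of_real (\<nu> m) * U a m * coef DA U (\<lambda>x. U x k) m)"
      using spectral_apply[OF rho, of a "\<lambda>x. U x k"] by simp
    also have "\<dots> = (\<Sum>m<DA. if m = k then of_real (\<nu> m) * U a m else 0)"
      by (rule sum.cong) (use coef_column[OF unitary_U _ assms(2)] in auto)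
    finally show "cnj (U a j) * (\<Sum>a'<DA. \<rho> $$ (a, a') * U a' k) = cnj (U a j) * (of_real (\<nu> k) * U a k)"
      using assms by simp
  qed
  also have "\<dots> = of_real (\<nu> k) * (\<Sum>a<DA. U a k * cnj (U a j))"
    by (simp add: sum_distrib_left mult_ac)
  finally show ?thesis using unitary_fun_col[OF unitary_U assms(2,1)] by auto
qed

lemma schmidt_norm:
  assumes "j < DA" shows "(\<Sum>y<DB. (norm (schmidt j y))\<^sup>2) = \<nu> j"
  using schmidt_inner[OF assms assms] unfolding of_real_sum_norm_square[symmetric]
  by (simp only: of_real_eq_iff refl if_True)

lemma schmidt_eq_0: "j < DA \<Longrightarrow> \<nu> j = 0 \<Longrightarrow> y < DB \<Longrightarrow> schmidt j y = 0"
  using schmidt_norm[of j] by (simp add: sum_nonneg_eq_0_iff)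

lemma sum_nu: "(\<Sum>j<DA. \<nu> j) = 1"
proof -
  have "(\<Sum>j<DA. \<nu> j) = (\<Sum>j<DA. \<Sum>y<DB. (norm (schmidt j y))\<^sup>2)"
    by (simp add: schmidt_norm)
  also have "\<dots> = (\<Sum>y<DB. \<Sum>x<DA. (norm (\<psi> $ (x * DB + y)))\<^sup>2)"
    unfolding schmidt_def by (subst sum.swap) (simp add: unitary_norm_coef[OF unitary_U])
  also have "\<dots> = 1"
    using psi_unit by (subst sum.swap) (simp add: sum_pair_index)
  finally show ?thesis .
qed

lemma overlap_norm: "j < DA \<Longrightarrow> (\<Sum>a<DA. (norm (overlap a j))\<^sup>2) = 1"
proof -
  assume j: "j < DA"
  have "complex_of_real (\<Sum>x<DA. (norm (U x j))\<^sup>2) = 1"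
    unfolding of_real_sum_norm_square using unitary_fun_col[OF unitary_U j j] by simp
  then have "(\<Sum>x<DA. (norm (U x j))\<^sup>2) = 1" using of_real_eq_1_iff by blast
  then show ?thesis unfolding overlap_def unitary_norm_coef[OF unitary_V] .
qed

lemma unitary_overlap: "unitary_fun DA overlap"
proof (rule unitary_funI)
  fix k l assume "k < DA" "l < DA"
  then show "(\<Sum>i<DA. overlap i k * cnj (overlap i l)) = (if k = l then 1 else 0)"
    unfolding overlap_def unitary_parseval_coef[OF unitary_V] by (rule unitary_fun_col[OF unitary_U])
qed

lemma pairs_subset: "pairs \<subseteq> {..<DA} \<times> {..<DA}"
  by (auto simp: pairs_def)

lemma finite_pairs: "finite pairs"
  using finite_subset[OF pairs_subset] by simp

lemma sum_pairs:
  assumes "\<And>a j. a < DA \<Longrightarrow> j < DA \<Longrightarrow> (a, j) \<notin> pairs \<Longrightarrow> g a j = 0"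
  shows "(\<Sum>(a, j)\<in>pairs. g a j) = (\<Sum>j<DA. \<Sum>a<DA. g a j)"
proof -
  have "(\<Sum>(a, j)\<in>pairs. g a j) = (\<Sum>(a, j)\<in>{..<DA} \<times> {..<DA}. g a j)"
    by (rule sum.mono_neutral_left) (use pairs_subset assms in auto)
  also have "\<dots> = (\<Sum>a<DA. \<Sum>j<DA. g a j)" by (simp add: sum.cartesian_product)
  finally show ?thesis using sum.swap by metis
qed

lemma not_in_pairs:
  "a < DA \<Longrightarrow> j < DA \<Longrightarrow> (a, j) \<notin> pairs \<Longrightarrow> overlap a j = 0 \<or> \<nu> j = 0"
  using nu[of j] by (auto simp: pairs_def)

lemma U_expand: "x < DA \<Longrightarrow> U x j = (\<Sum>a<DA. V x a * overlap a j)"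
  unfolding overlap_def coef_def by (rule unitary_fun_expand[OF unitary_V])

lemma component_pair_index:
  "y < DB \<Longrightarrow> component (a, j) (x * DB + y) = overlap a j * V x a * schmidt j y"
  by (simp add: component_def)

lemma psi_components:
  assumes "i < DA * DB" shows "\<psi> $ i = (\<Sum>p\<in>pairs. component p i)"
proof -
  have DB: "0 < DB" using assms by (auto intro: gr0I)
  define x y where "x = i div DB" and "y = i mod DB"
  have i: "i = x * DB + y" "x < DA" "y < DB"
    using assms DB by (auto simp: x_def y_def less_mult_imp_div_less)
  have "(\<Sum>p\<in>pairs. component p i) = (\<Sum>(a, j)\<in>pairs. overlap a j * V x a * schmidt j y)"
    by (rule sum.cong) (auto simp: i(1) component_pair_index i(3))
  also have "\<dots> = (\<Sum>j<DA. \<Sum>a<DA. overlap a j * V x a * schmidt j y)"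
    using not_in_pairs schmidt_eq_0[OF _ _ i(3)] by (intro sum_pairs) fastforce
  also have "\<dots> = (\<Sum>j<DA. U x j * schmidt j y)"
    by (rule sum.cong) (auto simp: U_expand[OF i(2)] sum_distrib_left sum_distrib_right mult_ac)
  also have "\<dots> = \<psi> $ i"
    unfolding schmidt_def coef_def i(1) using unitary_fun_expand[OF unitary_U i(2), of "\<lambda>x. \<psi> $ (x * DB + y)"] by simp
  finally show ?thesis ..
qed

lemma component_orthogonal:
  assumes "p \<in> pairs" "q \<in> pairs"
  shows "(\<Sum>i<DA * DB. component p i * cnj (component q i)) = (if p = q then of_real (weight p) else 0)"
proof -
  obtain a j a' j' where pq: "p = (a, j)" "q = (a', j')" by (cases p; cases q) auto
  have l: "a < DA" "j < DA" "a' < DA" "j' < DA" using assms by (auto simp: pq pairs_def)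
  have "(\<Sum>i<DA * DB. component p i * cnj (component q i))
      = (\<Sum>x<DA. \<Sum>y<DB. overlap a j * cnj (overlap a' j') * ((V x a * cnj (V x a')) * (schmidt j y * cnj (schmidt j' y))))"
    unfolding sum_pair_index pq by (intro sum.cong refl) (simp add: component_pair_index mult_ac)
  also have "\<dots> = overlap a j * cnj (overlap a' j') * ((\<Sum>x<DA. V x a * cnj (V x a')) * (\<Sum>y<DB. schmidt j y * cnj (schmidt j' y)))"
    by (simp only: sum_distrib_left[symmetric] sum_distrib_right[symmetric])
  also have "\<dots> = (if p = q then overlap a j * cnj (overlap a j) * of_real (\<nu> j) else 0)"
    unfolding unitary_fun_col[OF unitary_V l(1,3)] schmidt_inner[OF l(2,4)] by (auto simp: pq)
  finally show ?thesis by (simp only: weight_def pq prod.case of_real_mult complex_norm_square)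
qed

lemma sum_weight: "sum weight pairs = 1"
proof -
  have "sum weight pairs = (\<Sum>(a, j)\<in>pairs. (norm (overlap a j))\<^sup>2 * \<nu> j)"
    by (rule sum.cong) (auto simp: weight_def)
  also have "\<dots> = (\<Sum>j<DA. \<Sum>a<DA. (norm (overlap a j))\<^sup>2 * \<nu> j)"
    by (rule sum_pairs) (use not_in_pairs in fastforce)
  also have "\<dots> = 1"
    by (simp add: sum_distrib_right[symmetric] overlap_norm sum_nu)
  finally show ?thesis .
qed

sublocale orthogonal_decomposition "DA * DB" pairs component weight ratio \<psi>
proof
  show "finite pairs" by (rule finite_pairs)
  show "\<psi> \<in> carrier_vec (DA * DB)" by (rule psi_carrier)
  show "\<psi> $ i = (\<Sum>p\<in>pairs. component p i)" if "i < DA * DB" for i by (rule psi_components[OF that])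
  show "(\<Sum>i<DA * DB. component p i * cnj (component q i)) = (if p = q then of_real (weight p) else 0)"
    if "p \<in> pairs" "q \<in> pairs" for p q by (rule component_orthogonal[OF that])
  show "0 < weight p" "0 \<le> ratio p" if "p \<in> pairs" for p
    using that mu by (auto simp: pairs_def weight_def ratio_def)
  show "sum weight pairs = 1" by (rule sum_weight)
qed

text \<open>The operator inequality \<open>\<tau> \<le> tr\<^sub>B \<tau> \<otimes> (tr\<^sub>A \<psi>)\<^sup>-\<^sup>1\<close> on the support of the second factor.\<close>

lemma qform_comb_le:
  assumes T: "psd (DA * DB) T"
    and le: "\<And>h. Re (qform DA (ptrace_B DA DB T) h) \<le> Re (qform DA \<sigma> h)"
  shows "Re (qform (DA * DB) T (comb \<alpha>)) \<le> (\<Sum>p\<in>pairs. ratio p * (norm (\<alpha> p))\<^sup>2 * weight p)"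
proof -
  define \<beta> where "\<beta> a j = (if (a, j) \<in> pairs then \<alpha> (a, j) * overlap a j else 0)" for a j
  \<comment> \<open>This brings \<open>comb \<alpha>\<close> into the form (X \<otimes> 1) \<psi>
    with X u_j = H j, to which \<open>qform_tensor_le\<close> applies.\<close>
  define H where "H j x = (\<Sum>a<DA. V x a * \<beta> a j)" for j x
  have c: "comb \<alpha> (x * DB + y) = (\<Sum>j<DA. H j x * schmidt j y)" if "y < DB" for x y
  proof -
    have "comb \<alpha> (x * DB + y) = (\<Sum>(a, j)\<in>pairs. V x a * \<beta> a j * schmidt j y)"
      unfolding comb_def by (rule sum.cong) (auto simp: component_pair_index[OF that] \<beta>_def)
    also have "\<dots> = (\<Sum>j<DA. \<Sum>a<DA. V x a * \<beta> a j * schmidt j y)"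
      by (rule sum_pairs) (simp add: \<beta>_def)
    finally show ?thesis by (simp add: H_def sum_distrib_right)
  qed
  have "Re (qform (DA * DB) T (comb \<alpha>)) \<le> (\<Sum>j<DA. Re (qform DA (ptrace_B DA DB T) (H j)))"
    by (rule qform_tensor_le[OF T, where S = schmidt]) (auto simp: schmidt_norm sum_nu c)
  also have "\<dots> \<le> (\<Sum>j<DA. Re (qform DA \<sigma> (H j)))"
    by (intro sum_mono le)
  also have "\<dots> = (\<Sum>j<DA. \<Sum>a<DA. \<mu> a * (norm (\<beta> a j))\<^sup>2)"
  proof (rule sum.cong[OF refl])
    fix j
    have "coef DA V (H j) a = \<beta> a j" if "a < DA" for a
      unfolding H_def coef_def using unitary_fun_expand_col[OF unitary_V that, of "\<lambda>a. \<beta> a j"] by simp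
    then show "Re (qform DA \<sigma> (H j)) = (\<Sum>a<DA. \<mu> a * (norm (\<beta> a j))\<^sup>2)"
      by (simp only: spectral_qform[OF sigma] Re_complex_of_real) simp
  qed
  also have "\<dots> = (\<Sum>(a, j)\<in>pairs. \<mu> a * (norm (\<beta> a j))\<^sup>2)"
    by (rule sum_pairs[symmetric]) (simp add: \<beta>_def)
  also have "\<dots> = (\<Sum>p\<in>pairs. ratio p * (norm (\<alpha> p))\<^sup>2 * weight p)"
    by (rule sum.cong) (auto simp: \<beta>_def ratio_def weight_def pairs_def norm_mult power_mult_distrib)
  finally show ?thesis .
qed

lemma log_expectation_extension_le:
  assumes "psd (DA * DB) T" "ptrace_B DA DB T = \<sigma>"
  shows "log_expectation T \<psi> \<le> logsum pairs weight ratio"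
  by (rule log_expectation_le[OF assms(1) qform_comb_le[OF assms(1)]]) (simp add: assms(2))

lemma cpow_ratio:
  assumes "m \<ge> 0" "r > 0" shows "cpow (m / r) z = cpow m z * cpow r (- z)"
proof (cases "m = 0")
  case False
  with assms have "m > 0" by simp
  with assms show ?thesis
    by (simp add: cpow_exp ln_div exp_add[symmetric] algebra_simps)
qed simp

text \<open>One t in <h|tr_B Opt|h>: the squared norms \<nu> j of the Schmidt vectors cancel the
  factor from \<rho>^(-z). What is left is the squared length of the projection of \<sigma>^(cnj z)
  h onto supp \<rho>.\<close>

lemma phi_slice:
  assumes z: "z = (1 + \<i> * of_real t) / 2"
  shows "(\<Sum>y<DB. (norm (\<Sum>x<DA. cnj (h x) * phi t (x * DB + y)))\<^sup>2)
    = (\<Sum>j<DA. if \<nu> j = 0 then 0 else (norm (\<Sum>a<DA. overlap a j * (cpow (\<mu> a) z * cnj (coef DA V h a))))\<^sup>2)"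
proof -
  define g where "g a j = (if (a, j) \<in> pairs then cpow (ratio (a, j)) z * overlap a j else 0)" for a j
  define w where "w j = (\<Sum>a<DA. g a j * cnj (coef DA V h a))" for j
  have "(\<Sum>x<DA. cnj (h x) * phi t (x * DB + y)) = (\<Sum>j<DA. w j * schmidt j y)" if "y < DB" for y
  proof -
    have "phi t (x * DB + y) = (\<Sum>j<DA. \<Sum>a<DA. g a j * V x a * schmidt j y)" for x
    proof -
      have "phi t (x * DB + y) = (\<Sum>(a, j)\<in>pairs. g a j * V x a * schmidt j y)"
        unfolding phi_def comb_def z[symmetric] by (rule sum.cong) (auto simp: component_pair_index[OF that] g_def)
      also have "\<dots> = (\<Sum>j<DA. \<Sum>a<DA. g a j * V x a * schmidt j y)"
        by (rule sum_pairs) (simp add: g_def)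
      finally show ?thesis .
    qed
    then have "(\<Sum>x<DA. cnj (h x) * phi t (x * DB + y)) = (\<Sum>x<DA. \<Sum>j<DA. \<Sum>a<DA. g a j * (V x a * cnj (h x)) * schmidt j y)"
      by (simp add: sum_distrib_left mult_ac)
    also have "\<dots> = (\<Sum>j<DA. \<Sum>a<DA. \<Sum>x<DA. g a j * (V x a * cnj (h x)) * schmidt j y)"
      by (rule trans[OF sum.swap sum.cong[OF refl sum.swap]])
    also have "\<dots> = (\<Sum>j<DA. w j * schmidt j y)"
      by (simp add: w_def coef_def sum_distrib_left sum_distrib_right)
    finally show ?thesis .
  qed
  then have "complex_of_real (\<Sum>y<DB. (norm (\<Sum>x<DA. cnj (h x) * phi t (x * DB + y)))\<^sup>2)
      = (\<Sum>y<DB. (\<Sum>j<DA. w j * schmidt j y) * cnj (\<Sum>j<DA. w j * schmidt j y))"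
    unfolding of_real_sum_norm_square by simp
  also have "\<dots> = (\<Sum>y<DB. \<Sum>j<DA. \<Sum>k<DA. w j * cnj (w k) * (schmidt j y * cnj (schmidt k y)))"
    by (simp add: sum_product mult_ac)
  also have "\<dots> = (\<Sum>j<DA. \<Sum>k<DA. \<Sum>y<DB. w j * cnj (w k) * (schmidt j y * cnj (schmidt k y)))"
    by (rule trans[OF sum.swap sum.cong[OF refl sum.swap]])
  also have "\<dots> = (\<Sum>j<DA. \<Sum>k<DA. if j = k then w j * cnj (w j) * of_real (\<nu> j) else 0)"
    unfolding sum_distrib_left[symmetric] by (intro sum.cong refl) (simp add: schmidt_inner)
  also have "\<dots> = of_real (\<Sum>j<DA. (norm (w j))\<^sup>2 * \<nu> j)"
    by (simp only: of_real_sum of_real_mult complex_norm_square) simp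
  finally have "(\<Sum>y<DB. (norm (\<Sum>x<DA. cnj (h x) * phi t (x * DB + y)))\<^sup>2) = (\<Sum>j<DA. (norm (w j))\<^sup>2 * \<nu> j)"
    by (simp only: of_real_eq_iff)
  also have "\<dots> = (\<Sum>j<DA. if \<nu> j = 0 then 0 else (norm (\<Sum>a<DA. overlap a j * (cpow (\<mu> a) z * cnj (coef DA V h a))))\<^sup>2)"
  proof (rule sum.cong[OF refl])
    fix j assume "j \<in> {..<DA}"
    then have j: "j < DA" by simp
    show "(norm (w j))\<^sup>2 * \<nu> j = (if \<nu> j = 0 then 0 else (norm (\<Sum>a<DA. overlap a j * (cpow (\<mu> a) z * cnj (coef DA V h a))))\<^sup>2)"
    proof (cases "\<nu> j = 0")
      case False
      then have nj: "\<nu> j > 0" using nu[OF j] by simp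
      have "g a j = cpow (\<nu> j) (- z) * (overlap a j * cpow (\<mu> a) z)" if "a < DA" for a
        using not_in_pairs[OF that j] False cpow_ratio[OF mu[OF that] nj, of z] by (auto simp: g_def ratio_def)
      then have "w j = cpow (\<nu> j) (- z) * (\<Sum>a<DA. overlap a j * (cpow (\<mu> a) z * cnj (coef DA V h a)))"
        by (simp add: w_def sum_distrib_left mult_ac)
      moreover have "(norm (cpow (\<nu> j) (- z)))\<^sup>2 * \<nu> j = 1"
        using nj by (simp add: norm_cpow z exp_minus exp_double[symmetric] power_inverse)
      ultimately show ?thesis using False by (simp add: norm_mult power_mult_distrib mult_ac)
    qed simp
  qed
  finally show ?thesis .
qed

text \<open>The sum over all j is the full squared norm of \<sigma>^(cnj z) h because the overlaps
  form a unitary matrix, and |\<mu>^z|^2 = \<mu> for Re z = 1/2.\<close>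

lemma overlap_slice:
  "(\<Sum>j<DA. (norm (\<Sum>a<DA. overlap a j * (cpow (\<mu> a) ((1 + \<i> * of_real t) / 2) * cnj (coef DA V h a))))\<^sup>2) = Re (qform DA \<sigma> h)"
proof -
  have "(\<Sum>j<DA. (norm (\<Sum>a<DA. overlap a j * (cpow (\<mu> a) ((1 + \<i> * of_real t) / 2) * cnj (coef DA V h a))))\<^sup>2)
      = (\<Sum>j<DA. (norm (coef DA (\<lambda>a j. cnj (overlap a j)) (\<lambda>a. cpow (\<mu> a) ((1 + \<i> * of_real t) / 2) * cnj (coef DA V h a)) j))\<^sup>2)"
    by (simp add: coef_def)
  also have "\<dots> = (\<Sum>a<DA. (norm (cpow (\<mu> a) ((1 + \<i> * of_real t) / 2) * cnj (coef DA V h a)))\<^sup>2)"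
    by (rule unitary_norm_coef[OF unitary_fun_conj[OF unitary_overlap]])
  also have "\<dots> = (\<Sum>a<DA. \<mu> a * (norm (coef DA V h a))\<^sup>2)"
    by (rule sum.cong) (auto simp: norm_mult power_mult_distrib norm_cpow_half[OF mu])
  finally show ?thesis by (simp only: spectral_qform[OF sigma] Re_complex_of_real)
qed

lemma qform_ptrace_Opt:
  "qform DA (ptrace_B DA DB Opt) h
    = of_real (LINT t|lborel. beta0 t * (\<Sum>y<DB. (norm (\<Sum>x<DA. cnj (h x) * phi t (x * DB + y)))\<^sup>2))"
  and integrable_ptrace_Opt:
    "integrable lborel (\<lambda>t. beta0 t * (\<Sum>y<DB. (norm (\<Sum>x<DA. cnj (h x) * phi t (x * DB + y)))\<^sup>2))"
proof -
  define E where "E y i = (if i mod DB = y then h (i div DB) else 0)" for y i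
  have e: "(\<Sum>i<DA * DB. cnj (E y i) * phi t i) = (\<Sum>x<DA. cnj (h x) * phi t (x * DB + y))" if "y < DB" for y t
  proof -
    have "(\<Sum>i<DA * DB. cnj (E y i) * phi t i) = (\<Sum>x<DA. \<Sum>z<DB. if z = y then cnj (h x) * phi t (x * DB + y) else 0)"
      unfolding sum_pair_index by (intro sum.cong refl) (auto simp: E_def)
    then show ?thesis using that by simp
  qed
  have i: "integrable lborel (\<lambda>t. beta0 t * (norm (\<Sum>x<DA. cnj (h x) * phi t (x * DB + y)))\<^sup>2)" if "y < DB" for y
    using integrable_phi_norm[of "E y"] by (simp add: e[OF that])
  then show "integrable lborel (\<lambda>t. beta0 t * (\<Sum>y<DB. (norm (\<Sum>x<DA. cnj (h x) * phi t (x * DB + y)))\<^sup>2))"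
    unfolding sum_distrib_left by (intro Bochner_Integration.integrable_sum) auto
  have "qform DA (ptrace_B DA DB Opt) h = (\<Sum>y<DB. of_real (LINT t|lborel. beta0 t * (norm (\<Sum>x<DA. cnj (h x) * phi t (x * DB + y)))\<^sup>2))"
    unfolding qform_ptrace_B E_def[symmetric] Opt_qform by (rule sum.cong) (auto simp: e)
  also have "\<dots> = of_real (LINT t|lborel. (\<Sum>y<DB. beta0 t * (norm (\<Sum>x<DA. cnj (h x) * phi t (x * DB + y)))\<^sup>2))"
    by (subst Bochner_Integration.integral_sum) (use i in auto)
  finally show "qform DA (ptrace_B DA DB Opt) h
    = of_real (LINT t|lborel. beta0 t * (\<Sum>y<DB. (norm (\<Sum>x<DA. cnj (h x) * phi t (x * DB + y)))\<^sup>2))"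
    unfolding sum_distrib_left .
qed

text \<open>What the marginal of \<open>Opt\<close> lacks. It is positive because projecting onto
  supp \<rho> only shortens vectors.\<close>

definition defect :: "complex mat" where
  "defect = Matrix.mat DA DA (\<lambda>p. \<sigma> $$ p - ptrace_B DA DB Opt $$ p)"

lemma psd_sigma: "psd DA \<sigma>"
  by (rule spectral_psd[OF sigma mu])

lemma psd_defect: "psd DA defect"
proof (rule psdI)
  show "defect \<in> carrier_mat DA DA" by (simp add: defect_def)
  show "defect $$ (j, i) = cnj (defect $$ (i, j))" if "i < DA" "j < DA" for i j
    using psd_hermitian[OF psd_sigma that] psd_hermitian[OF psd_ptrace_B[OF Opt_psd] that] that
    by (simp add: defect_def)
  fix h
  have "(LINT t|lborel. beta0 t * (\<Sum>y<DB. (norm (\<Sum>x<DA. cnj (h x) * phi t (x * DB + y)))\<^sup>2))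
      \<le> (LINT t|lborel. beta0 t * Re (qform DA \<sigma> h))"
  proof (rule integral_mono[OF integrable_ptrace_Opt])
    fix t
    have "(\<Sum>y<DB. (norm (\<Sum>x<DA. cnj (h x) * phi t (x * DB + y)))\<^sup>2) \<le> Re (qform DA \<sigma> h)"
      unfolding phi_slice[OF refl] overlap_slice[of t h, symmetric] by (intro sum_mono) auto
    then show "beta0 t * (\<Sum>y<DB. (norm (\<Sum>x<DA. cnj (h x) * phi t (x * DB + y)))\<^sup>2) \<le> beta0 t * Re (qform DA \<sigma> h)"
      by (intro mult_left_mono) auto
  qed (simp add: integrable_beta0)
  then have "Re (qform DA (ptrace_B DA DB Opt) h) \<le> Re (qform DA \<sigma> h)"
    unfolding qform_ptrace_Opt by (simp add: integral_beta0)
  then show "0 \<le> Re (qform DA defect h)"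
    unfolding defect_def qform_diff by simp
qed

text \<open>The assumption is supp \<sigma> \<subseteq> supp \<rho> in terms of eigenvectors. Then
  the projection in \<open>phi_slice\<close> loses nothing, for any t.\<close>

lemma ptrace_Opt_eq:
  assumes "\<And>a j. a < DA \<Longrightarrow> j < DA \<Longrightarrow> \<nu> j = 0 \<Longrightarrow> \<mu> a \<noteq> 0 \<Longrightarrow> overlap a j = 0"
  shows "ptrace_B DA DB Opt = \<sigma>"
proof -
  have "qform DA defect h = 0" for h
  proof -
    have "(\<Sum>y<DB. (norm (\<Sum>x<DA. cnj (h x) * phi t (x * DB + y)))\<^sup>2) = Re (qform DA \<sigma> h)" for t
      unfolding phi_slice[OF refl] overlap_slice[of t h, symmetric]
    proof (rule sum.cong[OF refl])
      fix j assume "j \<in> {..<DA}"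
      then have "(\<Sum>a<DA. overlap a j * (cpow (\<mu> a) z * cnj (coef DA V h a))) = 0" if "\<nu> j = 0" for z
        using assms[of _ j] that by (intro sum.neutral) (auto, metis cpow_0)
      then show "(if \<nu> j = 0 then 0 else (norm (\<Sum>a<DA. overlap a j * (cpow (\<mu> a) ((1 + \<i> * of_real t) / 2) * cnj (coef DA V h a))))\<^sup>2)
        = (norm (\<Sum>a<DA. overlap a j * (cpow (\<mu> a) ((1 + \<i> * of_real t) / 2) * cnj (coef DA V h a))))\<^sup>2" by simp
    qed
    then have "qform DA (ptrace_B DA DB Opt) h = of_real (Re (qform DA \<sigma> h))"
      unfolding qform_ptrace_Opt by (simp add: integral_beta0)
    also have "\<dots> = qform DA \<sigma> h" by (simp only: spectral_qform[OF sigma] Re_complex_of_real)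
    finally show ?thesis unfolding defect_def qform_diff by simp
  qed
  from psd_zero_entries[OF psd_defect this] show ?thesis
    using psd_carrier[OF psd_sigma] by (intro eq_matI) (auto simp: defect_def ptrace_B_def)
qed

lemma DB_pos: "DB > 0"
  using psi_unit by (cases DB) auto

text \<open>A positive operator with marginal \<open>defect\<close> is added, and monotonicity of
  the logarithm keeps the log expectation from dropping.\<close>

lemma extension_above_Opt:
  assumes "mtrace \<sigma> = 1"
  obtains T where "psd (DA * DB) T" "mtrace T = 1" "ptrace_B DA DB T = \<sigma>"
    "log_expectation Opt \<psi> \<le> log_expectation T \<psi>"
proof -
  define M where "M = maximally_mixed_extension DA DB defect"
  define T where "T = Matrix.mat (DA * DB) (DA * DB) (\<lambda>p. Opt $$ p + M $$ p)"
  have M: "psd (DA * DB) M" unfolding M_def by (rule psd_maximally_mixed_extension[OF psd_defect])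
  have T: "psd (DA * DB) T"
  proof (rule psdI)
    show "T \<in> carrier_mat (DA * DB) (DA * DB)" by (simp add: T_def)
    show "T $$ (j, i) = cnj (T $$ (i, j))" if "i < DA * DB" "j < DA * DB" for i j
      using psd_hermitian[OF Opt_psd that] psd_hermitian[OF M that] that by (simp add: T_def)
    show "0 \<le> Re (qform (DA * DB) T v)" for v
      unfolding T_def qform_add using psd_qform[OF Opt_psd, of v] psd_qform[OF M, of v] by simp
  qed
  have pt: "ptrace_B DA DB T = \<sigma>"
  proof (rule eq_matI)
    fix i j assume "i < dim_row \<sigma>" "j < dim_col \<sigma>"
    then have ij: "i < DA" "j < DA" using psd_carrier[OF psd_sigma] by auto
    have "ptrace_B DA DB T $$ (i, j) = ptrace_B DA DB Opt $$ (i, j) + ptrace_B DA DB M $$ (i, j)"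
      using ij by (simp add: ptrace_B_def T_def pair_index_less sum.distrib)
    also have "ptrace_B DA DB M $$ (i, j) = defect $$ (i, j)"
      unfolding M_def by (rule ptrace_maximally_mixed_extension[OF DB_pos ij])
    finally show "ptrace_B DA DB T $$ (i, j) = \<sigma> $$ (i, j)" using ij by (simp add: defect_def)
  qed (use psd_carrier[OF psd_sigma] in \<open>auto simp: ptrace_B_def\<close>)
  have "mtrace T = 1" using mtrace_ptrace_B[OF psd_carrier[OF T]] pt assms by simp
  moreover have "log_expectation Opt \<psi> \<le> log_expectation T \<psi>"
    by (rule log_expectation_mono[OF T Opt_psd psi_carrier])
      (use psd_qform[OF M] in \<open>simp add: T_def qform_add\<close>)
  ultimately show thesis using that T pt by blast
qed

lemma mtrace_rho_mult:
  assumes "spectral DA L W g"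
  shows "mtrace (\<rho> * L) = (\<Sum>j<DA. of_real (\<nu> j * (\<Sum>a<DA. g a * (norm (coef DA W (\<lambda>x. U x j) a))\<^sup>2)))"
proof -
  have c: "\<rho> \<in> carrier_mat DA DA" "L \<in> carrier_mat DA DA" using rho assms by (auto simp: spectral_def)
  have "mtrace (\<rho> * L) = (\<Sum>x<DA. \<Sum>y<DA. \<rho> $$ (x, y) * L $$ (y, x))"
    using c by (simp add: mtrace_def scalar_prod_def lessThan_atLeast0[symmetric])
  also have "\<dots> = (\<Sum>x<DA. \<Sum>y<DA. \<Sum>j<DA. of_real (\<nu> j) * (cnj (U y j) * L $$ (y, x) * U x j))"
    using rho by (intro sum.cong refl) (simp add: spectral_def sum_distrib_left sum_distrib_right mult_ac)
  also have "\<dots> = (\<Sum>j<DA. \<Sum>x<DA. \<Sum>y<DA. of_real (\<nu> j) * (cnj (U y j) * L $$ (y, x) * U x j))"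
    by (rule trans[OF sum.cong[OF refl sum.swap] sum.swap])
  also have "\<dots> = (\<Sum>j<DA. of_real (\<nu> j) * qform DA L (\<lambda>x. U x j))"
    unfolding qform_def sum_distrib_left by (intro sum.cong refl sum.swap)
  finally show ?thesis unfolding spectral_qform[OF assms] by (simp only: of_real_mult)
qed

text \<open>A pair of ratio 0 is an eigenvector of \<rho> with positive eigenvalue that overlaps the
  kernel of \<sigma>.\<close>

lemma supp_rho_subset_iff: "supp \<rho> \<subseteq> supp \<sigma> \<longleftrightarrow> (\<forall>p\<in>pairs. ratio p > 0)"
proof
  assume sub: "supp \<rho> \<subseteq> supp \<sigma>"
  show "\<forall>p\<in>pairs. ratio p > 0"
  proof (clarify)
    fix a j assume p: "(a, j) \<in> pairs"
    then have l: "a < DA" "j < DA" "overlap a j \<noteq> 0" "\<nu> j > 0" by (auto simp: pairs_def)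
    define u where "u = Matrix.vec DA (\<lambda>x. U x j)"
    have cu: "coef DA W (($) u) k = coef DA W (\<lambda>x. U x j) k" for W k
      by (rule coef_cong) (simp add: u_def)
    have "u \<in> supp \<rho>"
      unfolding supp_spectral[OF rho] cu using coef_column[OF unitary_U _ l(2)] l(4) by (auto simp: u_def)
    with sub have "u \<in> supp \<sigma>" by blast
    then have "\<mu> a \<noteq> 0"
      unfolding supp_spectral[OF sigma] cu using l by (auto simp: overlap_def)
    then show "0 < ratio (a, j)" using mu[OF l(1)] l(4) by (simp add: ratio_def)
  qed
next
  assume pos: "\<forall>p\<in>pairs. ratio p > 0"
  show "supp \<rho> \<subseteq> supp \<sigma>"
  proof
    fix v assume v: "v \<in> supp \<rho>"
    then have vc: "v \<in> carrier_vec DA" and v0: "\<And>j. j < DA \<Longrightarrow> \<nu> j = 0 \<Longrightarrow> coef DA U (($) v) j = 0"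
      unfolding supp_spectral[OF rho] by auto
    have "coef DA V (($) v) a = 0" if a: "a < DA" "\<mu> a = 0" for a
    proof -
      have "coef DA V (($) v) a = coef DA V (\<lambda>x. \<Sum>j<DA. coef DA U (($) v) j * U x j) a"
        by (rule coef_cong) (subst unitary_fun_expand[OF unitary_U], auto simp: coef_def mult.commute)
      also have "\<dots> = (\<Sum>j<DA. coef DA U (($) v) j * overlap a j)"
        unfolding coef_sum overlap_def ..
      also have "\<dots> = 0"
      proof (rule sum.neutral, clarify)
        fix j assume "j < DA"
        have "ratio (a, j) = 0" using a by (simp add: ratio_def)
        then have "(a, j) \<notin> pairs" using pos by force
        with not_in_pairs[OF a(1) \<open>j < DA\<close>] v0[OF \<open>j < DA\<close>] show "coef DA U (($) v) j * overlap a j = 0" by auto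
      qed
      finally show ?thesis .
    qed
    with vc show "v \<in> supp \<sigma>" unfolding supp_spectral[OF sigma] by blast
  qed
qed

text \<open>In the two eigenbases the trace becomes the classical relative entropy of the
  Nussbaum-Szkola weights |<v_a|u_j>|^2 \<nu> j and |<v_a|u_j>|^2 \<mu> a, whose quotient is the
  inverse of \<open>ratio\<close>.\<close>

lemma rel_entropy_logsum: "rel_entropy \<rho> \<sigma> = - logsum pairs weight ratio"
proof (cases "\<forall>p\<in>pairs. ratio p > 0")
  case True
  define g where "g x = (if x = 0 then 0 else ln x)" for x :: real
  have L: "spectral DA (mat_log \<rho>) U (\<lambda>k. g (\<nu> k))" "spectral DA (mat_log \<sigma>) V (\<lambda>k. g (\<mu> k))"
    using spectral_mat_log[OF rho] spectral_mat_log[OF sigma] by (simp_all add: g_def)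
  have c: "\<rho> \<in> carrier_mat DA DA" "mat_log \<rho> \<in> carrier_mat DA DA" "mat_log \<sigma> \<in> carrier_mat DA DA"
    using rho L by (auto simp: spectral_def)
  have "mtrace (\<rho> * (mat_log \<rho> - mat_log \<sigma>)) = mtrace (\<rho> * mat_log \<rho>) - mtrace (\<rho> * mat_log \<sigma>)"
    using c by (simp add: mult_minus_distrib_mat mtrace_def sum_subtractf)
  also have "mtrace (\<rho> * mat_log \<rho>) = (\<Sum>j<DA. of_real (\<nu> j * g (\<nu> j)))"
    unfolding mtrace_rho_mult[OF L(1)]
  proof (intro sum.cong refl arg_cong[of _ _ of_real])
    fix j assume "j \<in> {..<DA}"
    then have "(\<Sum>a<DA. g (\<nu> a) * (norm (coef DA U (\<lambda>x. U x j) a))\<^sup>2) = (\<Sum>a<DA. if a = j then g (\<nu> a) else 0)"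
      by (intro sum.cong refl) (use coef_column[OF unitary_U] in auto)
    with \<open>j \<in> {..<DA}\<close> show "\<nu> j * (\<Sum>a<DA. g (\<nu> a) * (norm (coef DA U (\<lambda>x. U x j) a))\<^sup>2) = \<nu> j * g (\<nu> j)" by simp
  qed
  also have "mtrace (\<rho> * mat_log \<sigma>) = (\<Sum>j<DA. of_real (\<nu> j * (\<Sum>a<DA. g (\<mu> a) * (norm (overlap a j))\<^sup>2)))"
    unfolding mtrace_rho_mult[OF L(2)] overlap_def ..
  finally have "Re (mtrace (\<rho> * (mat_log \<rho> - mat_log \<sigma>)))
      = (\<Sum>j<DA. \<nu> j * g (\<nu> j) - \<nu> j * (\<Sum>a<DA. g (\<mu> a) * (norm (overlap a j))\<^sup>2))"
    by (simp add: sum_subtractf)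
  also have "\<dots> = (\<Sum>j<DA. \<Sum>a<DA. (norm (overlap a j))\<^sup>2 * \<nu> j * (g (\<nu> j) - g (\<mu> a)))"
  proof (rule sum.cong[OF refl])
    fix j assume "j \<in> {..<DA}"
    moreover have "(\<Sum>a<DA. (norm (overlap a j))\<^sup>2 * \<nu> j * (g (\<nu> j) - g (\<mu> a)))
        = (\<Sum>a<DA. (norm (overlap a j))\<^sup>2) * (\<nu> j * g (\<nu> j)) - \<nu> j * (\<Sum>a<DA. g (\<mu> a) * (norm (overlap a j))\<^sup>2)"
      by (simp add: sum_distrib_left sum_distrib_right sum_subtractf algebra_simps)
    ultimately show "\<nu> j * g (\<nu> j) - \<nu> j * (\<Sum>a<DA. g (\<mu> a) * (norm (overlap a j))\<^sup>2)
        = (\<Sum>a<DA. (norm (overlap a j))\<^sup>2 * \<nu> j * (g (\<nu> j) - g (\<mu> a)))"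
      by (simp add: overlap_norm)
  qed
  also have "\<dots> = (\<Sum>(a, j)\<in>pairs. (norm (overlap a j))\<^sup>2 * \<nu> j * (g (\<nu> j) - g (\<mu> a)))"
    by (rule sum_pairs[symmetric]) (use not_in_pairs in fastforce)
  also have "\<dots> = (\<Sum>p\<in>pairs. - (weight p * ln (ratio p)))"
  proof (rule sum.cong[OF refl], clarify)
    fix a j assume p: "(a, j) \<in> pairs"
    then have "\<nu> j > 0" "\<mu> a / \<nu> j > 0" using True by (auto simp: pairs_def ratio_def)
    then have "\<mu> a > 0" by (simp add: zero_less_divide_iff)
    then show "(norm (overlap a j))\<^sup>2 * \<nu> j * (g (\<nu> j) - g (\<mu> a)) = - (weight (a, j) * ln (ratio (a, j)))"
      using \<open>\<nu> j > 0\<close> by (simp add: weight_def ratio_def g_def ln_div algebra_simps)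
  qed
  finally show ?thesis
    using True supp_rho_subset_iff by (simp add: rel_entropy_def logsum_def sum_negf)
next
  case False
  then have "\<not> (\<forall>p\<in>pairs. weight p \<noteq> 0 \<longrightarrow> ratio p > 0)" using b_pos less_numeral_extra(3) by metis
  then have "logsum pairs weight ratio = -\<infinity>" unfolding logsum_def by (rule if_not_P)
  with False show ?thesis using supp_rho_subset_iff by (simp add: rel_entropy_def)
qed

end

subsection \<open>Tensor powers\<close>

lemma pair_index_div [simp]: "b < n \<Longrightarrow> (a * n + b) div n = (a :: nat)"
  and pair_index_mod [simp]: "b < n \<Longrightarrow> (a * n + b) mod n = (b :: nat)"
  by auto

lemma pair_indexE:
  fixes i m n :: nat
  assumes "i < m * n"
  obtains x y where "i = x * n + y" "x < m" "y < n"
proof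
  have "n > 0" using assms by (cases n) auto
  show "i = i div n * n + i mod n" by (rule div_mult_mod_eq[symmetric])
  show "i div n < m" using assms by (simp add: less_mult_imp_div_less)
  show "i mod n < n" using \<open>n > 0\<close> by simp
qed

lemma digit_less [simp]: "d > 0 \<Longrightarrow> digit d i k < d"
  by (simp add: digit_def)

lemma digit_low:
  assumes "d > 0" "k < n" shows "digit d (a * d ^ n + r) k = digit d r k"
proof -
  obtain m where n: "n = k + Suc m" using assms(2) less_iff_Suc_add by auto
  have "a * d ^ n + r = r + (a * d ^ m * d) * d ^ k" by (simp add: n power_add mult_ac)
  moreover have "(r + (a * d ^ m * d) * d ^ k) div d ^ k = r div d ^ k + a * d ^ m * d"
    using assms(1) by simp
  ultimately have "(a * d ^ n + r) div d ^ k = r div d ^ k + a * d ^ m * d" by metis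
  then show ?thesis by (simp add: digit_def)
qed

lemma digit_high:
  assumes "a < d" "r < d ^ n" shows "digit d (a * d ^ n + r) n = a"
  using assms by (simp add: digit_def)

text \<open>Indices below d^n correspond to digit strings, so this is the distributive law. All
  factorizations over tensor powers come down to it.\<close>

lemma sum_prod_digits:
  fixes f :: "nat \<Rightarrow> nat \<Rightarrow> 'a :: comm_semiring_1"
  assumes "d > 0"
  shows "(\<Sum>i<d ^ n. \<Prod>k<n. f k (digit d i k)) = (\<Prod>k<n. \<Sum>a<d. f k a)"
proof (induction n)
  case (Suc n)
  have "(\<Sum>i<d ^ Suc n. \<Prod>k<Suc n. f k (digit d i k))
      = (\<Sum>a<d. \<Sum>r<d ^ n. \<Prod>k<Suc n. f k (digit d (a * d ^ n + r) k))"
    by (simp only: power_Suc sum_pair_index)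
  also have "\<dots> = (\<Sum>a<d. \<Sum>r<d ^ n. (\<Prod>k<n. f k (digit d r k)) * f n a)"
    by (intro sum.cong refl) (simp add: digit_low[OF assms] digit_high)
  also have "\<dots> = (\<Prod>k<n. \<Sum>a<d. f k a) * (\<Sum>a<d. f n a)"
    by (simp only: sum_distrib_left[symmetric] sum_distrib_right[symmetric] Suc)
  finally show ?case by simp
qed simp

lemma sum_prod_digits2:
  fixes f :: "nat \<Rightarrow> nat \<Rightarrow> nat \<Rightarrow> 'a :: comm_semiring_1"
  assumes "d > 0" "e > 0"
  shows "(\<Sum>i<d ^ n. \<Sum>j<e ^ n. \<Prod>k<n. f k (digit d i k) (digit e j k)) = (\<Prod>k<n. \<Sum>a<d. \<Sum>b<e. f k a b)"
proof -
  have "(\<Sum>i<d ^ n. \<Sum>j<e ^ n. \<Prod>k<n. f k (digit d i k) (digit e j k))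
      = (\<Sum>i<d ^ n. \<Prod>k<n. \<Sum>b<e. f k (digit d i k) b)"
    by (intro sum.cong refl sum_prod_digits[OF assms(2), of "\<lambda>k. f k (digit d _ k)"])
  also have "\<dots> = (\<Prod>k<n. \<Sum>a<d. \<Sum>b<e. f k a b)"
    by (rule sum_prod_digits[OF assms(1)])
  finally show ?thesis .
qed

lemma sum_digits:
  assumes "d > 0" shows "i < d ^ n \<Longrightarrow> (\<Sum>k<n. digit d i k * d ^ k) = i"
proof (induction n arbitrary: i)
  case (Suc n)
  obtain a r where i: "i = a * d ^ n + r" "a < d" "r < d ^ n"
    using Suc.prems by (auto elim: pair_indexE)
  have "(\<Sum>k<Suc n. digit d i k * d ^ k) = (\<Sum>k<n. digit d r k * d ^ k) + a * d ^ n"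
    unfolding i(1) using i by (simp add: digit_low[OF assms] digit_high)
  with Suc.IH[OF i(3)] show ?case by (simp add: i(1))
qed simp

lemma digits_eqI:
  assumes "d > 0" "i < d ^ n" "j < d ^ n" "\<And>k. k < n \<Longrightarrow> digit d i k = digit d j k"
  shows "i = j"
proof -
  have "(\<Sum>k<n. digit d i k * d ^ k) = (\<Sum>k<n. digit d j k * d ^ k)"
    by (rule sum.cong[OF refl]) (use assms(4) in auto)
  then show ?thesis unfolding sum_digits[OF assms(1,2)] sum_digits[OF assms(1,3)] .
qed

lemma digit_sum:
  assumes "d > 0" "\<And>k. k < n \<Longrightarrow> a k < d"
  shows "(\<Sum>k<n. a k * d ^ k) < d ^ n" and "\<And>k. k < n \<Longrightarrow> digit d (\<Sum>k<n. a k * d ^ k) k = a k"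
proof -
  have "(\<Sum>k<n. a k * d ^ k) < d ^ n \<and> (\<forall>k<n. digit d (\<Sum>k<n. a k * d ^ k) k = a k)"
    using assms(2)
  proof (induction n)
    case (Suc n)
    then have IH: "(\<Sum>k<n. a k * d ^ k) < d ^ n" "\<And>k. k < n \<Longrightarrow> digit d (\<Sum>k<n. a k * d ^ k) k = a k" by auto
    have e: "(\<Sum>k<Suc n. a k * d ^ k) = a n * d ^ n + (\<Sum>k<n. a k * d ^ k)" by simp
    have "digit d (\<Sum>k<Suc n. a k * d ^ k) k = a k" if "k < Suc n" for k
      unfolding e using that IH digit_low[OF assms(1), of k n] Suc.prems[of n]
      by (cases "k = n") (auto simp: digit_high)
    moreover have "(\<Sum>k<Suc n. a k * d ^ k) < d ^ Suc n"
      unfolding e using pair_index_less[OF Suc.prems[of n] IH(1)] by simp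
    ultimately show ?case by blast
  qed simp
  then show "(\<Sum>k<n. a k * d ^ k) < d ^ n" "\<And>k. k < n \<Longrightarrow> digit d (\<Sum>k<n. a k * d ^ k) k = a k" by auto
qed

lemma prod_indicator:
  fixes n :: nat shows
  "(\<Prod>k<n. if P k then 1 else 0) = (if \<forall>k<n. P k then 1 else (0 :: 'a :: comm_semiring_1))"
  by (induction n) (auto simp: less_Suc_eq)

definition tensor_fun :: "nat \<Rightarrow> nat \<Rightarrow> (nat \<Rightarrow> nat \<Rightarrow> complex) \<Rightarrow> nat \<Rightarrow> nat \<Rightarrow> complex" where
  "tensor_fun d n U i j = (\<Prod>k<n. U (digit d i k) (digit d j k))"

definition tensor_eigenvalue :: "nat \<Rightarrow> nat \<Rightarrow> (nat \<Rightarrow> real) \<Rightarrow> nat \<Rightarrow> real" where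
  "tensor_eigenvalue d n l j = (\<Prod>k<n. l (digit d j k))"

lemma tensor_power_entry:
  assumes "X \<in> carrier_mat d d" "i < d ^ n" "j < d ^ n"
  shows "tensor_power n X $$ (i, j) = tensor_fun d n (\<lambda>i j. X $$ (i, j)) i j"
  using assms by (simp add: tensor_power_def tensor_fun_def)

lemma tensor_power_carrier: "X \<in> carrier_mat d d \<Longrightarrow> tensor_power n X \<in> carrier_mat (d ^ n) (d ^ n)"
  by (simp add: tensor_power_def)

text \<open>The coefficients \<open>g\<close> are arbitrary complex numbers, so that this covers a
  matrix and its complex powers alike.\<close>

lemma tensor_fun_spectral:
  assumes d: "d > 0" and X: "\<And>i j. i < d \<Longrightarrow> j < d \<Longrightarrow> X i j = (\<Sum>k<d. g k * U i k * cnj (U j k))"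
  shows "tensor_fun d n X i j = (\<Sum>k<d ^ n. (\<Prod>m<n. g (digit d k m)) * tensor_fun d n U i k * cnj (tensor_fun d n U j k))"
proof -
  have "tensor_fun d n X i j = (\<Prod>m<n. \<Sum>k<d. g k * U (digit d i m) k * cnj (U (digit d j m) k))"
    unfolding tensor_fun_def by (intro prod.cong refl X) (simp_all add: d)
  also have "\<dots> = (\<Sum>k<d ^ n. \<Prod>m<n. g (digit d k m) * U (digit d i m) (digit d k m) * cnj (U (digit d j m) (digit d k m)))"
    by (rule sum_prod_digits[OF d, symmetric])
  finally show ?thesis by (simp add: tensor_fun_def prod.distrib)
qed

lemma unitary_tensor_fun:
  assumes d: "d > 0" and U: "unitary_fun d U" shows "unitary_fun (d ^ n) (tensor_fun d n U)"
proof (rule unitary_funI)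
  fix k l assume kl: "k < d ^ n" "l < d ^ n"
  have "(\<Sum>i<d ^ n. tensor_fun d n U i k * cnj (tensor_fun d n U i l))
      = (\<Prod>m<n. \<Sum>a<d. U a (digit d k m) * cnj (U a (digit d l m)))"
    unfolding sum_prod_digits[OF d, symmetric] by (simp add: tensor_fun_def prod.distrib)
  also have "\<dots> = (\<Prod>m<n. if digit d k m = digit d l m then 1 else 0)"
    by (intro prod.cong refl unitary_fun_col[OF U]) (simp_all add: d)
  also have "\<dots> = (if k = l then 1 else 0)"
    unfolding prod_indicator using digits_eqI[OF d kl] by auto
  finally show "(\<Sum>i<d ^ n. tensor_fun d n U i k * cnj (tensor_fun d n U i l)) = (if k = l then 1 else 0)" .
qed

lemma spectral_tensor_power:
  assumes d: "d > 0" and s: "spectral d X U l"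
  shows "spectral (d ^ n) (tensor_power n X) (tensor_fun d n U) (tensor_eigenvalue d n l)"
proof -
  have X: "X \<in> carrier_mat d d" "unitary_fun d U" using s by (auto simp: spectral_def)
  have "tensor_power n X $$ (i, j) = (\<Sum>k<d ^ n. of_real (tensor_eigenvalue d n l k) * tensor_fun d n U i k * cnj (tensor_fun d n U j k))"
    if "i < d ^ n" "j < d ^ n" for i j
    unfolding tensor_power_entry[OF X(1) that] tensor_eigenvalue_def of_real_prod
    by (rule tensor_fun_spectral[OF d]) (use s in \<open>simp add: spectral_def\<close>)
  then show ?thesis using unitary_tensor_fun[OF d X(2)] tensor_power_carrier[OF X(1)] by (simp add: spectral_def)
qed

lemma tensor_eigenvalue_nonneg:
  assumes "d > 0" "\<And>k. k < d \<Longrightarrow> 0 \<le> l k" shows "0 \<le> tensor_eigenvalue d n l j"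
  unfolding tensor_eigenvalue_def using assms by (intro prod_nonneg) auto

lemma cpow_mult: "x \<ge> 0 \<Longrightarrow> y \<ge> 0 \<Longrightarrow> cpow (x * y) z = cpow x z * cpow y z"
  by (cases "x = 0 \<or> y = 0") (auto simp: cpow_exp ln_mult exp_add[symmetric] algebra_simps)

lemma cpow_1: "cpow 1 z = 1"
  by (simp add: cpow_exp)

lemma cpow_prod:
  fixes n :: nat
  assumes "\<And>k. k < n \<Longrightarrow> 0 \<le> x k" shows "(\<Prod>k<n. cpow (x k) z) = cpow (\<Prod>k<n. x k) z"
  using assms by (induction n) (auto simp: cpow_1 intro!: cpow_mult[symmetric] prod_nonneg)

lemma mat_cpow_entry:
  assumes "spectral d X U l" "i < d" "j < d"
  shows "mat_cpow X z $$ (i, j) = (\<Sum>k<d. cpow (l k) z * U i k * cnj (U j k))"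
  using assms unfolding mat_cpow_def mat_fun_spectral[OF assms(1)] by (simp add: cpow_def)

lemma mat_cpow_carrier: "spectral d X U l \<Longrightarrow> mat_cpow X z \<in> carrier_mat d d"
  unfolding mat_cpow_def by (subst mat_fun_spectral) auto

lemma tensor_power_mat_cpow:
  assumes d: "d > 0" and s: "spectral d X U l" "\<And>k. k < d \<Longrightarrow> 0 \<le> l k" and ij: "i < d ^ n" "j < d ^ n"
  shows "tensor_power n (mat_cpow X z) $$ (i, j)
    = (\<Sum>k<d ^ n. cpow (tensor_eigenvalue d n l k) z * tensor_fun d n U i k * cnj (tensor_fun d n U j k))"
proof -
  have "tensor_power n (mat_cpow X z) $$ (i, j)
    = (\<Sum>k<d ^ n. (\<Prod>m<n. cpow (l (digit d k m)) z) * tensor_fun d n U i k * cnj (tensor_fun d n U j k))"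
    unfolding tensor_power_entry[OF mat_cpow_carrier[OF s(1)] ij]
    by (rule tensor_fun_spectral[OF d]) (rule mat_cpow_entry[OF s(1)])
  moreover have "(\<Prod>m<n. cpow (l (digit d k m)) z) = cpow (tensor_eigenvalue d n l k) z" for k
    unfolding tensor_eigenvalue_def by (rule cpow_prod) (simp add: s d)
  ultimately show ?thesis by simp
qed

lemma tensor_power_AB_entry:
  assumes "x < dA ^ n" "y < dB ^ n"
  shows "tensor_power_AB dA dB n \<psi> $ (x * dB ^ n + y) = (\<Prod>k<n. \<psi> $ (digit dA x k * dB + digit dB y k))"
  using assms by (simp add: tensor_power_AB_def pair_index_less)

lemma tensor_power_AB_carrier: "tensor_power_AB dA dB n \<psi> \<in> carrier_vec (dA ^ n * dB ^ n)"
  by (simp add: tensor_power_AB_def)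

lemma purification_dims_pos:
  assumes "purification dA dB \<psi> \<rho>" shows "dA > 0" "dB > 0"
  using purification_unit[OF assms] by (auto intro: gr0I)

text \<open>Although A and B factors are regrouped, the coefficients are still products over the
  digits, and both the partial trace and the norm factorize.\<close>

lemma purification_tensor_power:
  assumes p: "purification dA dB \<psi> \<rho>"
  shows "purification (dA ^ n) (dB ^ n) (tensor_power_AB dA dB n \<psi>) (tensor_power n \<rho>)"
proof -
  note d = purification_dims_pos[OF p]
  have pt: "ptrace_B dA dB (ket_bra \<psi>) = \<rho>" and c: "\<psi> \<in> carrier_vec (dA * dB)" using p by (auto simp: purification_def)
  then have rc: "\<rho> \<in> carrier_mat dA dA" using ptrace_B_carrier by blast
  have entry: "\<rho> $$ (a, a') = (\<Sum>y<dB. \<psi> $ (a * dB + y) * cnj (\<psi> $ (a' * dB + y)))" if "a < dA" "a' < dA" for a a'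
    unfolding pt[symmetric] using that c by (simp add: ptrace_B_def ket_bra_def pair_index_less)
  let ?\<Psi> = "tensor_power_AB dA dB n \<psi>"
  have C: "?\<Psi> \<in> carrier_vec (dA ^ n * dB ^ n)" by (rule tensor_power_AB_carrier)
  have "ptrace_B (dA ^ n) (dB ^ n) (ket_bra ?\<Psi>) = tensor_power n \<rho>"
  proof (rule eq_matI)
    fix i j assume "i < dim_row (tensor_power n \<rho>)" "j < dim_col (tensor_power n \<rho>)"
    then have ij: "i < dA ^ n" "j < dA ^ n" using tensor_power_carrier[OF rc, of n] by auto
    have "ptrace_B (dA ^ n) (dB ^ n) (ket_bra ?\<Psi>) $$ (i, j)
        = (\<Sum>y<dB ^ n. ?\<Psi> $ (i * dB ^ n + y) * cnj (?\<Psi> $ (j * dB ^ n + y)))"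
      using ij C by (simp add: ptrace_B_def ket_bra_def pair_index_less)
    also have "\<dots> = (\<Sum>y<dB ^ n. \<Prod>k<n. \<psi> $ (digit dA i k * dB + digit dB y k) * cnj (\<psi> $ (digit dA j k * dB + digit dB y k)))"
      by (intro sum.cong refl) (simp add: tensor_power_AB_entry ij prod.distrib)
    also have "\<dots> = (\<Prod>k<n. \<Sum>b<dB. \<psi> $ (digit dA i k * dB + b) * cnj (\<psi> $ (digit dA j k * dB + b)))"
      by (rule sum_prod_digits[OF d(2)])
    also have "\<dots> = tensor_power n \<rho> $$ (i, j)"
      unfolding tensor_power_entry[OF rc ij] tensor_fun_def by (intro prod.cong refl) (simp add: entry d)
    finally show "ptrace_B (dA ^ n) (dB ^ n) (ket_bra ?\<Psi>) $$ (i, j) = tensor_power n \<rho> $$ (i, j)" .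
  qed (use tensor_power_carrier[OF rc, of n] in \<open>auto simp: ptrace_B_def\<close>)
  moreover have "?\<Psi> \<bullet>c ?\<Psi> = 1"
  proof -
    have one: "(\<Sum>a<dA. \<Sum>b<dB. \<psi> $ (a * dB + b) * cnj (\<psi> $ (a * dB + b))) = 1"
      using p c by (simp add: purification_def scalar_prod_def conjugate_vec_def lessThan_atLeast0[symmetric] sum_pair_index)
    have "?\<Psi> \<bullet>c ?\<Psi> = (\<Sum>x<dA ^ n. \<Sum>y<dB ^ n. ?\<Psi> $ (x * dB ^ n + y) * cnj (?\<Psi> $ (x * dB ^ n + y)))"
      using C by (simp add: scalar_prod_def conjugate_vec_def lessThan_atLeast0[symmetric] sum_pair_index)
    also have "\<dots> = (\<Sum>x<dA ^ n. \<Sum>y<dB ^ n. \<Prod>k<n. \<psi> $ (digit dA x k * dB + digit dB y k) * cnj (\<psi> $ (digit dA x k * dB + digit dB y k)))"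
      by (intro sum.cong refl) (simp add: tensor_power_AB_entry prod.distrib)
    also have "\<dots> = (\<Prod>k<n. \<Sum>a<dA. \<Sum>b<dB. \<psi> $ (a * dB + b) * cnj (\<psi> $ (a * dB + b)))"
      by (rule sum_prod_digits2[OF d])
    finally show ?thesis by (simp add: one)
  qed
  ultimately show ?thesis using C by (simp add: purification_def)
qed

section \<open>Identification of the explicit optimizer with \<open>Opt\<close>, and additivity
  under tensor powers\<close>

context purified_pair
begin

text \<open>Back from eigencomponents to \<sigma>^z \<rho>^(-z) acting on the A factor of \<psi>,
  the form that matches \<open>opt_integrand\<close> and factorizes over digits.\<close>

lemma phi_eq:
  assumes x: "x < DA" and y: "y < DB" and z: "z = (1 + \<i> * of_real t) / 2"
  shows "phi t (x * DB + y) = (\<Sum>x'<DA. (\<Sum>a<DA. cpow (\<mu> a) z * V x a * cnj (V x' a)) *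
    (\<Sum>x''<DA. (\<Sum>j<DA. cpow (\<nu> j) (- z) * U x' j * cnj (U x'' j)) * \<psi> $ (x'' * DB + y)))"
proof -
  have "(\<Sum>x''<DA. (\<Sum>j<DA. cpow (\<nu> j) (- z) * U x' j * cnj (U x'' j)) * \<psi> $ (x'' * DB + y))
      = (\<Sum>j<DA. cpow (\<nu> j) (- z) * U x' j * schmidt j y)" for x'
    unfolding schmidt_def coef_def sum_distrib_right sum_distrib_left by (subst sum.swap) (simp add: mult_ac)
  then have "(\<Sum>x'<DA. (\<Sum>a<DA. cpow (\<mu> a) z * V x a * cnj (V x' a)) *
      (\<Sum>x''<DA. (\<Sum>j<DA. cpow (\<nu> j) (- z) * U x' j * cnj (U x'' j)) * \<psi> $ (x'' * DB + y)))
    = (\<Sum>x'<DA. \<Sum>a<DA. \<Sum>j<DA. cpow (\<mu> a) z * cpow (\<nu> j) (- z) * V x a * schmidt j y * (cnj (V x' a) * U x' j))"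
    by (simp add: sum_product mult_ac)
  also have "\<dots> = (\<Sum>a<DA. \<Sum>j<DA. \<Sum>x'<DA. cpow (\<mu> a) z * cpow (\<nu> j) (- z) * V x a * schmidt j y * (cnj (V x' a) * U x' j))"
    by (rule trans[OF sum.swap sum.cong[OF refl sum.swap]])
  also have "\<dots> = (\<Sum>j<DA. \<Sum>a<DA. cpow (\<mu> a) z * cpow (\<nu> j) (- z) * V x a * schmidt j y * overlap a j)"
    unfolding overlap_def coef_def sum_distrib_left by (rule sum.swap)
  also have "\<dots> = (\<Sum>(a, j)\<in>pairs. cpow (\<mu> a) z * cpow (\<nu> j) (- z) * V x a * schmidt j y * overlap a j)"
    by (rule sum_pairs[symmetric]) (use not_in_pairs in fastforce)
  also have "\<dots> = phi t (x * DB + y)"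
    unfolding phi_def comb_def z[symmetric]
    by (rule sum.cong) (auto simp: component_pair_index[OF y] ratio_def pairs_def cpow_ratio mu)
  finally show ?thesis ..
qed

end

lemma ket_bra_entry:
  "v \<in> carrier_vec d \<Longrightarrow> i < d \<Longrightarrow> j < d \<Longrightarrow> ket_bra v $$ (i, j) = v $ i * cnj (v $ j)"
  by (simp add: ket_bra_def)

lemma ket_bra_conjugate:
  assumes "A \<in> carrier_mat d d" "v \<in> carrier_vec d"
  shows "A * ket_bra v * mat_adjoint A = ket_bra (A *\<^sub>v v)"
proof (rule eq_matI)
  fix i j assume "i < dim_row (ket_bra (A *\<^sub>v v))" "j < dim_col (ket_bra (A *\<^sub>v v))"
  then have ij: "i < d" "j < d" using assms by (auto simp: ket_bra_def)
  have "(A * ket_bra v) $$ (i, k) = (A *\<^sub>v v) $ i * cnj (v $ k)" if "k < d" for k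
    using assms ij that by (simp add: ket_bra_def scalar_prod_def lessThan_atLeast0[symmetric] sum_distrib_left sum_distrib_right mult_ac)
  then have "(A * ket_bra v * mat_adjoint A) $$ (i, j) = (\<Sum>k<d. (A *\<^sub>v v) $ i * cnj (v $ k) * cnj (A $$ (j, k)))"
    using assms ij by (simp add: mat_adjoint_eq scalar_prod_def lessThan_atLeast0[symmetric] ket_bra_def del: index_mult_mat_vec)
  also have "\<dots> = (A *\<^sub>v v) $ i * cnj ((A *\<^sub>v v) $ j)"
    using assms ij by (simp add: scalar_prod_def lessThan_atLeast0[symmetric] sum_distrib_left mult_ac)
  finally show "(A * ket_bra v * mat_adjoint A) $$ (i, j) = ket_bra (A *\<^sub>v v) $$ (i, j)"
    using assms ij by (simp add: ket_bra_def)
qed (use assms in \<open>auto simp: ket_bra_def mat_adjoint_eq\<close>)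

lemma on_A_carrier: "X \<in> carrier_mat d d \<Longrightarrow> on_A dB n X \<in> carrier_mat (d ^ n * dB ^ n) (d ^ n * dB ^ n)"
  by (simp add: on_A_def kron_def tensor_power_def)

lemma on_A_entry:
  assumes "X \<in> carrier_mat d d" "x < d ^ n" "x' < d ^ n" "y < dB ^ n" "y' < dB ^ n"
  shows "on_A dB n X $$ (x * dB ^ n + y, x' * dB ^ n + y') = (if y = y' then tensor_power n X $$ (x, x') else 0)"
  using assms by (simp add: on_A_def kron_def pair_index_less tensor_power_def)

lemma on_A_mult_vec:
  assumes "X \<in> carrier_mat d d" "v \<in> carrier_vec (d ^ n * dB ^ n)" "x < d ^ n" "y < dB ^ n"
  shows "(on_A dB n X *\<^sub>v v) $ (x * dB ^ n + y) = (\<Sum>x'<d ^ n. tensor_power n X $$ (x, x') * v $ (x' * dB ^ n + y))"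
proof -
  have "(on_A dB n X *\<^sub>v v) $ (x * dB ^ n + y)
      = (\<Sum>x'<d ^ n. \<Sum>y'<dB ^ n. on_A dB n X $$ (x * dB ^ n + y, x' * dB ^ n + y') * v $ (x' * dB ^ n + y'))"
    using on_A_carrier[OF assms(1), of dB n] assms pair_index_less[OF assms(3,4)]
    by (simp add: scalar_prod_def lessThan_atLeast0[symmetric] sum_pair_index)
  also have "\<dots> = (\<Sum>x'<d ^ n. \<Sum>y'<dB ^ n. if y' = y then tensor_power n X $$ (x, x') * v $ (x' * dB ^ n + y) else 0)"
    by (intro sum.cong refl) (auto simp: on_A_entry[OF assms(1,3) _ assms(4)])
  finally show ?thesis using assms(4) by simp
qed

lemma on_A_adjoint:
  assumes "X \<in> carrier_mat d d" "Y \<in> carrier_mat d d" "\<And>i j. i < d \<Longrightarrow> j < d \<Longrightarrow> Y $$ (i, j) = cnj (X $$ (j, i))"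
    and "d > 0" "dB > 0"
  shows "on_A dB n Y = mat_adjoint (on_A dB n X)"
proof (rule eq_matI)
  note c = on_A_carrier[OF assms(1), of dB n] on_A_carrier[OF assms(2), of dB n]
  fix i j assume "i < dim_row (mat_adjoint (on_A dB n X))" "j < dim_col (mat_adjoint (on_A dB n X))"
  then have ij: "i < d ^ n * dB ^ n" "j < d ^ n * dB ^ n" using c by (auto simp: mat_adjoint_eq)
  obtain x y where "i = x * dB ^ n + y" "x < d ^ n" "y < dB ^ n" using ij(1) by (rule pair_indexE)
  moreover obtain x' y' where "j = x' * dB ^ n + y'" "x' < d ^ n" "y' < dB ^ n" using ij(2) by (rule pair_indexE)
  ultimately have l: "i = x * dB ^ n + y" "j = x' * dB ^ n + y'" "x < d ^ n" "x' < d ^ n" "y < dB ^ n" "y' < dB ^ n"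
    by auto
  have "tensor_power n Y $$ (x, x') = cnj (tensor_power n X $$ (x', x))"
    unfolding tensor_power_entry[OF assms(1) l(4,3)] tensor_power_entry[OF assms(2) l(3,4)] tensor_fun_def cnj_prod
    by (intro prod.cong refl assms(3)) (simp_all add: assms(4))
  then have "on_A dB n Y $$ (i, j) = cnj (on_A dB n X $$ (j, i))"
    unfolding l(1,2) on_A_entry[OF assms(2) l(3,4,5,6)] on_A_entry[OF assms(1) l(4,3,6,5)] by auto
  then show "on_A dB n Y $$ (i, j) = mat_adjoint (on_A dB n X) $$ (i, j)"
    using c ij by (simp add: mat_adjoint_eq)
qed (use on_A_carrier[OF assms(1), of dB n] on_A_carrier[OF assms(2), of dB n] in \<open>auto simp: mat_adjoint_eq\<close>)

lemma purified_pair_tensor_power: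
  assumes "purified_pair dA dB \<rho> \<sigma> \<psi> U V \<nu> \<mu>"
  shows "purified_pair (dA ^ n) (dB ^ n) (tensor_power n \<rho>) (tensor_power n \<sigma>) (tensor_power_AB dA dB n \<psi>)
    (tensor_fun dA n U) (tensor_fun dA n V) (tensor_eigenvalue dA n \<nu>) (tensor_eigenvalue dA n \<mu>)"
proof -
  interpret purified_pair dA dB \<rho> \<sigma> \<psi> U V \<nu> \<mu> by (rule assms)
  note d = purification_dims_pos[OF pur]
  show ?thesis
    by unfold_locales
      (auto intro!: spectral_tensor_power rho sigma tensor_eigenvalue_nonneg nu mu purification_tensor_power pur d)
qed

locale tensor_purified_pair = purified_pair dA dB \<rho> \<sigma> \<psi> U V \<nu> \<mu>
  for dA dB :: nat and \<rho> \<sigma> :: "complex mat" and \<psi> :: "complex vec" and U V and \<nu> \<mu> :: "nat \<Rightarrow> real" +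
  fixes n :: nat
begin

lemma dA_pos: "dA > 0" and dB_pos: "dB > 0"
  using purification_dims_pos[OF pur] by auto

sublocale N: purified_pair "dA ^ n" "dB ^ n" "tensor_power n \<rho>" "tensor_power n \<sigma>" "tensor_power_AB dA dB n \<psi>"
  "tensor_fun dA n U" "tensor_fun dA n V" "tensor_eigenvalue dA n \<nu>" "tensor_eigenvalue dA n \<mu>"
  by (rule purified_pair_tensor_power) unfold_locales

text \<open>For positive X the adjoint of X^z is X^(cnj z), so the last two factors are adjoints of
  the first two and the integrand is the projection onto a single, unnormalized vector.\<close>

lemma opt_integrand_eq:
  assumes ij: "i < dA ^ n * dB ^ n" "j < dA ^ n * dB ^ n"
  shows "opt_integrand dA dB n \<rho> \<sigma> \<psi> t $$ (i, j) = N.phi t i * cnj (N.phi t j)"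
proof -
  define z where "z = (1 + \<i> * complex_of_real t) / 2"
  have zc: "cnj z = (1 - \<i> * complex_of_real t) / 2" by (simp add: z_def)
  define S where "S = on_A dB n (mat_cpow \<sigma> z)"
  define R where "R = on_A dB n (mat_cpow \<rho> (- z))"
  let ?D = "dA ^ n * dB ^ n"
  let ?\<Psi> = "tensor_power_AB dA dB n \<psi>"
  have c: "S \<in> carrier_mat ?D ?D" "R \<in> carrier_mat ?D ?D" "mat_adjoint S \<in> carrier_mat ?D ?D" "mat_adjoint R \<in> carrier_mat ?D ?D"
    "ket_bra ?\<Psi> \<in> carrier_mat ?D ?D"
    using on_A_carrier[OF mat_cpow_carrier[OF sigma], of dB n z] on_A_carrier[OF mat_cpow_carrier[OF rho], of dB n "- z"]
      tensor_power_AB_carrier[of dA dB n \<psi>]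
    by (simp_all add: S_def R_def mat_adjoint_carrier ket_bra_def)
  have S': "on_A dB n (mat_cpow \<sigma> (cnj z)) = mat_adjoint S"
    unfolding S_def
    by (rule on_A_adjoint[OF mat_cpow_carrier[OF sigma] mat_cpow_carrier[OF sigma] _ dA_pos dB_pos])
      (auto simp: mat_cpow_entry[OF sigma] cnj_cpow[OF mu] mult_ac intro!: sum.cong)
  have R': "on_A dB n (mat_cpow \<rho> (- cnj z)) = mat_adjoint R"
    unfolding R_def
    by (rule on_A_adjoint[OF mat_cpow_carrier[OF rho] mat_cpow_carrier[OF rho] _ dA_pos dB_pos])
      (auto simp: mat_cpow_entry[OF rho] cnj_cpow[OF nu] mult_ac intro!: sum.cong)
  have "opt_integrand dA dB n \<rho> \<sigma> \<psi> t = S * R * ket_bra ?\<Psi> * mat_adjoint R * mat_adjoint S"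
    unfolding opt_integrand_def zc[symmetric] z_def[symmetric] S' R' S_def[symmetric] R_def[symmetric] ..
  also have "\<dots> = S * (R * ket_bra ?\<Psi> * mat_adjoint R) * mat_adjoint S"
    using c by (simp add: assoc_mult_mat[of _ ?D ?D _ ?D _ ?D])
  also have "\<dots> = ket_bra (S *\<^sub>v (R *\<^sub>v ?\<Psi>))"
    unfolding ket_bra_conjugate[OF c(2) tensor_power_AB_carrier]
    by (rule ket_bra_conjugate[OF c(1) mult_mat_vec_carrier[OF c(2) tensor_power_AB_carrier]])
  finally have 1: "opt_integrand dA dB n \<rho> \<sigma> \<psi> t = ket_bra (S *\<^sub>v (R *\<^sub>v ?\<Psi>))" .
  have phi: "(S *\<^sub>v (R *\<^sub>v ?\<Psi>)) $ i = N.phi t i" if i: "i < ?D" for i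
  proof -
    obtain x y where l: "i = x * dB ^ n + y" "x < dA ^ n" "y < dB ^ n" using i by (rule pair_indexE)
    have "(S *\<^sub>v (R *\<^sub>v ?\<Psi>)) $ i = (\<Sum>x'<dA ^ n. tensor_power n (mat_cpow \<sigma> z) $$ (x, x') *
        (\<Sum>x''<dA ^ n. tensor_power n (mat_cpow \<rho> (- z)) $$ (x', x'') * ?\<Psi> $ (x'' * dB ^ n + y)))"
    proof -
      have "(S *\<^sub>v (R *\<^sub>v ?\<Psi>)) $ i = (\<Sum>x'<dA ^ n. tensor_power n (mat_cpow \<sigma> z) $$ (x, x') * (R *\<^sub>v ?\<Psi>) $ (x' * dB ^ n + y))"
        unfolding l(1) S_def
        by (rule on_A_mult_vec[OF mat_cpow_carrier[OF sigma] mult_mat_vec_carrier[OF c(2) tensor_power_AB_carrier] l(2,3)])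
      then show ?thesis
        unfolding R_def by (simp add: on_A_mult_vec[OF mat_cpow_carrier[OF rho] tensor_power_AB_carrier _ l(3)])
    qed
    also have "\<dots> = N.phi t i"
      unfolding l(1) N.phi_eq[OF l(2,3) z_def]
      by (intro sum.cong refl arg_cong2[of _ _ _ _ "(*)"] tensor_power_mat_cpow[OF dA_pos] sigma rho mu nu) (use l in auto)
    finally show ?thesis .
  qed
  have "S *\<^sub>v (R *\<^sub>v ?\<Psi>) \<in> carrier_vec ?D"
    by (intro mult_mat_vec_carrier[OF c(1)] mult_mat_vec_carrier[OF c(2)] tensor_power_AB_carrier)
  from ket_bra_entry[OF this ij] show ?thesis unfolding 1 phi[OF ij(1)] phi[OF ij(2)] .
qed

lemma opt_state_eq: "opt_state dA dB n \<rho> \<sigma> \<psi> = N.Opt"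
  unfolding opt_state_def N.Opt_def by (intro cong_mat refl) (auto simp: opt_integrand_eq)

text \<open>The product form yields the permutation invariance of \<open>Opt\<close>.\<close>

lemma phi_tensor:
  assumes x: "x < dA ^ n" and y: "y < dB ^ n"
  shows "N.phi t (x * dB ^ n + y) = (\<Prod>k<n. phi t (digit dA x k * dB + digit dB y k))"
proof -
  define z where "z = (1 + \<i> * complex_of_real t) / 2"
  define M1 where "M1 x x' = (\<Sum>a<dA. cpow (\<mu> a) z * V x a * cnj (V x' a))" for x x'
  define M2 where "M2 x x' = (\<Sum>a<dA. cpow (\<nu> a) (- z) * U x a * cnj (U x' a))" for x x'
  have cp: "(\<Prod>m<n. cpow (l (digit dA k m)) w) = cpow (tensor_eigenvalue dA n l k) w" if "\<And>k. k < dA \<Longrightarrow> 0 \<le> l k" for l k w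
    unfolding tensor_eigenvalue_def by (rule cpow_prod) (simp add: that dA_pos)
  have "N.phi t (x * dB ^ n + y) = (\<Sum>x'<dA ^ n. tensor_fun dA n M1 x x' *
      (\<Sum>x''<dA ^ n. tensor_fun dA n M2 x' x'' * (\<Prod>k<n. \<psi> $ (digit dA x'' k * dB + digit dB y k))))"
    unfolding N.phi_eq[OF x y z_def] M1_def[abs_def] M2_def[abs_def]
    by (intro sum.cong refl arg_cong2[of _ _ _ _ "(*)"])
      (simp_all add: tensor_fun_spectral[OF dA_pos refl] cp mu nu tensor_power_AB_entry y)
  also have "\<dots> = (\<Sum>x'<dA ^ n. \<Sum>x''<dA ^ n. \<Prod>k<n. M1 (digit dA x k) (digit dA x' k) *
      (M2 (digit dA x' k) (digit dA x'' k) * \<psi> $ (digit dA x'' k * dB + digit dB y k)))"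
    by (simp add: tensor_fun_def prod.distrib sum_distrib_left)
  also have "\<dots> = (\<Prod>k<n. \<Sum>x'<dA. \<Sum>x''<dA. M1 (digit dA x k) x' * (M2 x' x'' * \<psi> $ (x'' * dB + digit dB y k)))"
    by (rule sum_prod_digits2[OF dA_pos dA_pos])
  also have "\<dots> = (\<Prod>k<n. phi t (digit dA x k * dB + digit dB y k))"
    unfolding M1_def M2_def
    by (intro prod.cong refl, subst phi_eq[OF _ _ z_def]) (simp_all add: dA_pos dB_pos sum_distrib_left)
  finally show ?thesis .
qed

lemma overlap_tensor: "N.overlap a j = (\<Prod>k<n. overlap (digit dA a k) (digit dA j k))"
proof -
  have "N.overlap a j = (\<Sum>x<dA ^ n. \<Prod>k<n. cnj (V (digit dA x k) (digit dA a k)) * U (digit dA x k) (digit dA j k))"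
    by (simp add: N.overlap_def coef_def tensor_fun_def prod.distrib)
  also have "\<dots> = (\<Prod>k<n. \<Sum>x<dA. cnj (V x (digit dA a k)) * U x (digit dA j k))"
    by (rule sum_prod_digits[OF dA_pos])
  finally show ?thesis by (simp add: overlap_def coef_def)
qed

lemma weight_tensor: "N.weight (a, j) = (\<Prod>k<n. weight (digit dA a k, digit dA j k))"
  by (simp only: N.weight_def weight_def prod.case overlap_tensor tensor_eigenvalue_def prod.distrib
      prod_norm[symmetric] prod_power_distrib)

lemma ratio_tensor: "N.ratio (a, j) = (\<Prod>k<n. ratio (digit dA a k, digit dA j k))"
  by (simp add: N.ratio_def ratio_def tensor_eigenvalue_def prod_dividef)

lemma pairs_tensor:
  "(a, j) \<in> N.pairs \<longleftrightarrow> a < dA ^ n \<and> j < dA ^ n \<and> (\<forall>k<n. (digit dA a k, digit dA j k) \<in> pairs)"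
proof -
  have "(\<Prod>k<n. \<nu> (digit dA j k)) > 0 \<longleftrightarrow> (\<forall>k<n. \<nu> (digit dA j k) > 0)"
  proof (intro iffI allI impI)
    fix k assume pos: "(\<Prod>k<n. \<nu> (digit dA j k)) > 0" and "k < n"
    have "\<nu> (digit dA j k) \<noteq> 0"
    proof
      assume "\<nu> (digit dA j k) = 0"
      with \<open>k < n\<close> have "(\<Prod>k<n. \<nu> (digit dA j k)) = 0" by (intro prod_zero) auto
      with pos show False by simp
    qed
    with nu[of "digit dA j k"] dA_pos show "\<nu> (digit dA j k) > 0" by simp
  qed (auto intro!: prod_pos)
  then show ?thesis
    by (auto simp: N.pairs_def pairs_def overlap_tensor tensor_eigenvalue_def dA_pos)
qed

text \<open>Additivity of the relative entropy: the logarithm of a product is a sum over positions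
  m, and in the m-th term all other positions contribute the total weight 1.\<close>

lemma logsum_tensor:
  assumes n: "n \<ge> 1"
  shows "logsum N.pairs N.weight N.ratio = ereal (real n) * logsum pairs weight ratio"
proof (cases "\<forall>p\<in>pairs. ratio p > 0")
  case True
  have pos: "N.ratio (a, j) > 0" if "(a, j) \<in> N.pairs" for a j
    using that True unfolding ratio_tensor pairs_tensor by (auto intro!: prod_pos)
  have w0: "weight (a, j) = 0" if "a < dA" "j < dA" "(a, j) \<notin> pairs" for a j
    using not_in_pairs[OF that] by (auto simp: weight_def)
  \<comment> \<open>The single logarithm is placed as a factor at position m, so that each summand
    stays a product over digits.\<close>
  have "(\<Sum>p\<in>N.pairs. N.weight p * ln (N.ratio p))
      = (\<Sum>(a, j)\<in>N.pairs. \<Sum>m<n. \<Prod>k<n. weight (digit dA a k, digit dA j k) * (if k = m then ln (ratio (digit dA a k, digit dA j k)) else 1))"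
  proof (rule sum.cong[OF refl], clarify)
    fix a j assume p: "(a, j) \<in> N.pairs"
    then have rp: "ratio (digit dA a m, digit dA j m) > 0" if "m < n" for m
      using that True unfolding pairs_tensor by auto
    have "ln (N.ratio (a, j)) = (\<Sum>m<n. ln (ratio (digit dA a m, digit dA j m)))"
      unfolding ratio_tensor by (rule ln_prod) (use rp in force)+
    then show "N.weight (a, j) * ln (N.ratio (a, j))
        = (\<Sum>m<n. \<Prod>k<n. weight (digit dA a k, digit dA j k) * (if k = m then ln (ratio (digit dA a k, digit dA j k)) else 1))"
      by (simp add: weight_tensor prod.distrib sum_distrib_left)
  qed
  also have "\<dots> = (\<Sum>j<dA ^ n. \<Sum>a<dA ^ n. \<Sum>m<n. \<Prod>k<n. weight (digit dA a k, digit dA j k) * (if k = m then ln (ratio (digit dA a k, digit dA j k)) else 1))"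
  proof (rule N.sum_pairs)
    fix a j assume "a < dA ^ n" "j < dA ^ n" "(a, j) \<notin> N.pairs"
    then obtain k where "k < n" "(digit dA a k, digit dA j k) \<notin> pairs" unfolding pairs_tensor by auto
    then show "(\<Sum>m<n. \<Prod>k<n. weight (digit dA a k, digit dA j k) * (if k = m then ln (ratio (digit dA a k, digit dA j k)) else 1)) = 0"
      by (intro sum.neutral ballI prod_zero) (auto intro!: bexI[of _ k] simp: w0 dA_pos)
  qed
  also have "\<dots> = (\<Sum>m<n. \<Sum>j<dA ^ n. \<Sum>a<dA ^ n. \<Prod>k<n. weight (digit dA a k, digit dA j k) * (if k = m then ln (ratio (digit dA a k, digit dA j k)) else 1))"
    by (rule trans[OF sum.cong[OF refl sum.swap] sum.swap])
  also have "\<dots> = (\<Sum>m<n. \<Prod>k<n. \<Sum>j<dA. \<Sum>a<dA. weight (a, j) * (if k = m then ln (ratio (a, j)) else 1))"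
    by (intro sum.cong refl sum_prod_digits2[OF dA_pos dA_pos, of "\<lambda>k j a. weight (a, j) * (if k = _ then ln (ratio (a, j)) else 1)"])
  also have "\<dots> = (\<Sum>m<n. \<Prod>k<n. if k = m then (\<Sum>p\<in>pairs. weight p * ln (ratio p)) else 1)"
  proof (intro sum.cong prod.cong refl)
    fix m k
    have "(\<Sum>j<dA. \<Sum>a<dA. weight (a, j) * (if k = m then ln (ratio (a, j)) else 1))
        = (\<Sum>(a, j)\<in>pairs. weight (a, j) * (if k = m then ln (ratio (a, j)) else 1))"
      by (rule sum_pairs[symmetric]) (simp add: w0)
    also have "\<dots> = (if k = m then (\<Sum>p\<in>pairs. weight p * ln (ratio p)) else sum weight pairs)"
      by (auto intro!: sum.cong)
    finally show "(\<Sum>j<dA. \<Sum>a<dA. weight (a, j) * (if k = m then ln (ratio (a, j)) else 1))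
        = (if k = m then (\<Sum>p\<in>pairs. weight p * ln (ratio p)) else 1)" by (simp add: sum_weight)
  qed
  also have "\<dots> = real n * (\<Sum>p\<in>pairs. weight p * ln (ratio p))" by simp
  finally show ?thesis using True pos by (auto simp: logsum_def)
next
  case False
  then obtain a j where p: "(a, j) \<in> pairs" "\<not> ratio (a, j) > 0" by auto
  then have "a < dA" "j < dA" by (auto simp: pairs_def)
  \<comment> \<open>A constant string over a pair of ratio 0; with n \<ge> 1 its product has a
    vanishing factor.\<close>
  define a' where "a' = (\<Sum>k<n. a * dA ^ k)"
  define j' where "j' = (\<Sum>k<n. j * dA ^ k)"
  have dg: "a' < dA ^ n" "j' < dA ^ n" "\<And>k. k < n \<Longrightarrow> digit dA a' k = a" "\<And>k. k < n \<Longrightarrow> digit dA j' k = j"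
    unfolding a'_def j'_def using digit_sum[OF dA_pos, of n "\<lambda>_. a"] digit_sum[OF dA_pos, of n "\<lambda>_. j"] \<open>a < dA\<close> \<open>j < dA\<close> by auto
  have "(a', j') \<in> N.pairs" unfolding pairs_tensor using dg p by auto
  moreover have "ratio (a, j) = 0" using p \<delta>_nonneg[OF p(1)] by simp
  then have "N.ratio (a', j') = 0" unfolding ratio_tensor using dg n by (intro prod_zero) (auto intro!: exI[of _ 0])
  ultimately have "\<not> (\<forall>p\<in>N.pairs. N.weight p \<noteq> 0 \<longrightarrow> N.ratio p > 0)"
    using N.b_pos[of "(a', j')"] by force
  then have "logsum N.pairs N.weight N.ratio = -\<infinity>" unfolding logsum_def by (rule if_not_P)
  moreover have "logsum pairs weight ratio = -\<infinity>"
    using p b_pos[OF p(1)] unfolding logsum_def by (intro if_not_P) force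
  ultimately show ?thesis using n by simp
qed

text \<open>The product of eigenvalues along a tuple depends only on the type of the tuple.\<close>

lemma card_ratio_le: "card (N.ratio ` N.pairs) \<le> (Suc n) ^ (2 * dA)"
proof -
  \<comment> \<open>The possible types: each of the dA letters occurs between 0 and n times. One
    type for a and one for j give the exponent 2 * dA.\<close>
  define F where "F = {..<dA} \<rightarrow>\<^sub>E {..n}"
  define G where "G = (\<lambda>(f, g). (\<Prod>c<dA. \<mu> c ^ f c) / (\<Prod>c<dA. \<nu> c ^ g c :: real))"
  define ty where "ty a = restrict (\<lambda>c. card {k. k < n \<and> digit dA a k = c}) {..<dA}" for a
  have ty: "ty a \<in> F" for a
  proof -
    have "card {k. k < n \<and> digit dA a k = c} \<le> n" for c
      using card_mono[of "{..<n}" "{k. k < n \<and> digit dA a k = c}"] by auto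
    then show ?thesis by (auto simp: ty_def F_def)
  qed
  have ev: "tensor_eigenvalue dA n l a = (\<Prod>c<dA. l c ^ ty a c)" for l a
  proof -
    have "tensor_eigenvalue dA n l a = (\<Prod>c<dA. \<Prod>k\<in>{k \<in> {..<n}. digit dA a k = c}. l (digit dA a k))"
      unfolding tensor_eigenvalue_def by (rule prod.group[symmetric]) (auto simp: dA_pos)
    also have "\<dots> = (\<Prod>c<dA. l c ^ ty a c)"
      by (intro prod.cong refl) (simp add: ty_def)
    finally show ?thesis .
  qed
  have "N.ratio ` N.pairs \<subseteq> G ` (F \<times> F)"
  proof clarify
    fix a j
    have "N.ratio (a, j) = G (ty a, ty j)" by (simp add: N.ratio_def G_def ev)
    then show "N.ratio (a, j) \<in> G ` (F \<times> F)" using ty by blast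
  qed
  moreover have fin: "finite F" unfolding F_def by (intro finite_PiE) auto
  ultimately have "card (N.ratio ` N.pairs) \<le> card (F \<times> F)"
    by (meson card_image_le card_mono finite_SigmaI finite_imageI order_trans)
  also have "card (F \<times> F) = Suc n ^ (2 * dA)"
    by (simp add: card_cartesian_product F_def card_PiE power_mult power2_eq_square power_mult_distrib power_add[symmetric] mult_2)
  finally show ?thesis .
qed

end

subsection \<open>Permutations of the tensor factors\<close>

lemma permutes_less: "p permutes {..<n} \<Longrightarrow> k < n \<Longrightarrow> p k < (n :: nat)"
  using permutes_in_image[of p "{..<n}" k] by simp

lemma perm_index_less: "d > 0 \<Longrightarrow> perm_index d n p i < d ^ n"
  unfolding perm_index_def by (rule digit_sum(1)) auto

lemma digit_perm_index: "d > 0 \<Longrightarrow> k < n \<Longrightarrow> digit d (perm_index d n p i) k = digit d i (p k)"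
  unfolding perm_index_def by (rule digit_sum(2)) auto

text \<open>Digits are pulled back along the permutation, which reverses the order of
  composition.\<close>

lemma perm_index_comp:
  assumes "d > 0" "p permutes {..<n}"
  shows "perm_index d n p (perm_index d n q i) = perm_index d n (q \<circ> p) i"
proof -
  have "digit d (perm_index d n q i) (p k) = digit d i ((q \<circ> p) k)" if "k < n" for k
    using digit_perm_index[OF assms(1) permutes_less[OF assms(2) that]] by simp
  then show ?thesis unfolding perm_index_def[of d n p] perm_index_def[of d n "q \<circ> p"] by simp
qed

lemma perm_index_id: "d > 0 \<Longrightarrow> i < d ^ n \<Longrightarrow> perm_index d n id i = i"
  unfolding perm_index_def by (simp add: sum_digits)

definition perm_pair :: "nat \<Rightarrow> nat \<Rightarrow> nat \<Rightarrow> (nat \<Rightarrow> nat) \<Rightarrow> nat \<Rightarrow> nat" where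
  "perm_pair dA dB n p i = perm_index dA n p (i div dB ^ n) * dB ^ n + perm_index dB n p (i mod dB ^ n)"

definition factor_perms :: "nat \<Rightarrow> (nat \<Rightarrow> nat) set" where
  "factor_perms n = {p. p permutes {..<n}}"

lemma finite_factor_perms: "finite (factor_perms n)"
  unfolding factor_perms_def by (rule finite_permutations) simp

lemma id_factor_perms: "id \<in> factor_perms n"
  by (simp add: factor_perms_def permutes_id)

lemma card_factor_perms_pos: "card (factor_perms n) > 0"
  using finite_factor_perms id_factor_perms by (auto simp: card_gt_0_iff)

locale factor_permutation =
  fixes dA dB n :: nat
  assumes dA: "dA > 0" and dB: "dB > 0"
begin

abbreviation D where "D \<equiv> dA ^ n * dB ^ n"
abbreviation move where "move \<equiv> perm_pair dA dB n"

lemma perm_pair_index: "y < dB ^ n \<Longrightarrow> move p (x * dB ^ n + y) = perm_index dA n p x * dB ^ n + perm_index dB n p y"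
  by (simp add: perm_pair_def)

lemma perm_pair_less: "move p i < D"
  unfolding perm_pair_def by (intro pair_index_less perm_index_less dA dB)

lemma perm_pair_comp: "p permutes {..<n} \<Longrightarrow> move p (move q i) = move (q \<circ> p) i"
  by (simp add: perm_pair_def perm_index_less dB perm_index_comp dA)

lemma perm_pair_id: "i < D \<Longrightarrow> move id i = i"
  by (erule pair_indexE) (simp add: perm_pair_def perm_index_id dA dB)

lemma perm_pair_inv:
  assumes "p permutes {..<n}" "i < D"
  shows "move p (move (inv_into UNIV p) i) = i" "move (inv_into UNIV p) (move p i) = i"
proof -
  have q: "inv_into UNIV p permutes {..<n}" using permutes_inv[OF assms(1)] .
  have "inv_into UNIV p \<circ> p = id" "p \<circ> inv_into UNIV p = id" using permutes_inv_o[OF assms(1)] by auto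
  then show "move p (move (inv_into UNIV p) i) = i" "move (inv_into UNIV p) (move p i) = i"
    using perm_pair_comp[OF assms(1), of "inv_into UNIV p" i] perm_pair_comp[OF q, of p i] perm_pair_id[OF assms(2)] by auto
qed

lemma sum_perm_pair:
  assumes "p permutes {..<n}" shows "(\<Sum>i<D. g (move p i)) = (\<Sum>i<D. g i)"
  by (rule sum.reindex_bij_witness[of _ "move (inv_into UNIV p)" "move p"]) (auto simp: perm_pair_inv[OF assms] perm_pair_less)

lemma sum_perm_index:
  assumes d: "d > 0" and p: "p permutes {..<n}" shows "(\<Sum>i<d ^ n. g (perm_index d n p i)) = (\<Sum>i<d ^ n. g i)"
proof (rule sum.reindex_bij_witness[of _ "perm_index d n (inv_into UNIV p)" "perm_index d n p"])
  have q: "inv_into UNIV p permutes {..<n}" using permutes_inv[OF p] .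
  have c: "inv_into UNIV p \<circ> p = id" "p \<circ> inv_into UNIV p = id" using permutes_inv_o[OF p] by auto
  fix i assume "i \<in> {..<d ^ n}"
  then show "perm_index d n (inv_into UNIV p) (perm_index d n p i) = i" "perm_index d n p (perm_index d n (inv_into UNIV p) i) = i"
    using perm_index_comp[OF d p, of "inv_into UNIV p" i] perm_index_comp[OF d q, of p i] perm_index_id[OF d, of i n] c by auto
qed (auto simp: perm_index_less d)

text \<open>Conjugation by the permutation matrix relabels both indices by the inverse permutation,
  which again permutes the factors.\<close>

lemma perm_invariantI:
  assumes X: "X \<in> carrier_mat D D"
    and inv: "\<And>p i j. p permutes {..<n} \<Longrightarrow> i < D \<Longrightarrow> j < D \<Longrightarrow> X $$ (move p i, move p j) = X $$ (i, j)"
  shows "perm_invariant dA dB n X"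
  unfolding perm_invariant_def
proof (intro allI impI)
  fix p :: "nat \<Rightarrow> nat" assume p: "p permutes {..<n}"
  define P where "P = perm_unitary dA dB n p"
  have P: "P \<in> carrier_mat D D" "mat_adjoint P \<in> carrier_mat D D" by (auto simp: P_def perm_unitary_def mat_adjoint_eq)
  have Pe: "P $$ (i, k) = (if k = move (inv_into UNIV p) i then 1 else 0)" if "i < D" "k < D" for i k
    using that perm_pair_inv[OF p, of i] perm_pair_inv[OF p, of k]
    by (auto simp: P_def perm_unitary_def perm_pair_def[symmetric])
  show "perm_unitary dA dB n p * X * mat_adjoint (perm_unitary dA dB n p) = X"
    unfolding P_def[symmetric]
  proof (rule eq_matI)
    fix i j assume "i < dim_row X" "j < dim_col X"
    then have ij: "i < D" "j < D" using X by auto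
    have PX: "(P * X) $$ (i, k) = X $$ (move (inv_into UNIV p) i, k)" if "k < D" for k
    proof -
      have "(P * X) $$ (i, k) = (\<Sum>m<D. P $$ (i, m) * X $$ (m, k))"
        using P X ij that by (simp add: scalar_prod_def lessThan_atLeast0[symmetric])
      also have "\<dots> = (\<Sum>m<D. if m = move (inv_into UNIV p) i then X $$ (m, k) else 0)"
        by (intro sum.cong refl) (auto simp: Pe ij)
      finally show ?thesis using perm_pair_less[of "inv_into UNIV p" i] by simp
    qed
    have "(P * X * mat_adjoint P) $$ (i, j) = (\<Sum>k<D. (P * X) $$ (i, k) * cnj (P $$ (j, k)))"
    proof -
      have "(Y * mat_adjoint P) $$ (i, j) = (\<Sum>k<D. Y $$ (i, k) * cnj (P $$ (j, k)))" if "Y \<in> carrier_mat D D" for Y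
        using that P(1) ij by (simp add: scalar_prod_def lessThan_atLeast0[symmetric] mat_adjoint_eq)
      then show ?thesis using mult_carrier_mat[OF P(1) X] by blast
    qed
    also have "\<dots> = (\<Sum>k<D. if k = move (inv_into UNIV p) j then X $$ (move (inv_into UNIV p) i, k) else 0)"
      by (intro sum.cong refl) (auto simp: PX Pe ij)
    also have "\<dots> = X $$ (i, j)"
      using perm_pair_less[of "inv_into UNIV p" j] inv[OF permutes_inv[OF p] ij] by simp
    finally show "(P * X * mat_adjoint P) $$ (i, j) = X $$ (i, j)" .
  qed (use X P in auto)
qed

lemma prod_perm:
  assumes "p permutes {..<n}" shows "(\<Prod>k<n. g (p k)) = (\<Prod>k<n. g k)"
  using prod.permute[OF assms, of g] by (simp add: o_def)

lemma product_perm_invariant: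
  assumes v: "\<And>x y. x < dA ^ n \<Longrightarrow> y < dB ^ n \<Longrightarrow> v (x * dB ^ n + y) = (\<Prod>k<n. g (digit dA x k) (digit dB y k))"
    and p: "p permutes {..<n}" and i: "i < D"
  shows "v (move p i) = v i"
proof -
  obtain x y where l: "i = x * dB ^ n + y" "x < dA ^ n" "y < dB ^ n" using i by (rule pair_indexE)
  have "v (move p i) = (\<Prod>k<n. g (digit dA x (p k)) (digit dB y (p k)))"
    unfolding l(1) perm_pair_index[OF l(3)] v[OF perm_index_less[OF dA] perm_index_less[OF dB]]
    by (intro prod.cong refl) (simp add: digit_perm_index dA dB)
  also have "\<dots> = v i"
    unfolding l(1) v[OF l(2,3)] by (rule prod_perm[OF p])
  finally show ?thesis .
qed

lemma tensor_power_perm_invariant: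
  assumes X: "X \<in> carrier_mat dA dA" and p: "p permutes {..<n}" and ij: "i < dA ^ n" "j < dA ^ n"
  shows "tensor_power n X $$ (perm_index dA n p i, perm_index dA n p j) = tensor_power n X $$ (i, j)"
proof -
  have "tensor_power n X $$ (perm_index dA n p i, perm_index dA n p j) = (\<Prod>k<n. X $$ (digit dA i (p k), digit dA j (p k)))"
    unfolding tensor_power_entry[OF X perm_index_less[OF dA] perm_index_less[OF dA]] tensor_fun_def
    by (intro prod.cong refl) (simp add: digit_perm_index dA)
  also have "\<dots> = tensor_power n X $$ (i, j)"
    unfolding tensor_power_entry[OF X ij] tensor_fun_def by (rule prod_perm[OF p])
  finally show ?thesis .
qed

definition perm_average :: "complex mat \<Rightarrow> complex mat" where
  "perm_average T = Matrix.mat D D (\<lambda>(i, j). (\<Sum>p\<in>factor_perms n. T $$ (move p i, move p j)) / of_nat (card (factor_perms n)))"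

lemma perm_average_invariant:
  assumes p: "p permutes {..<n}" and ij: "i < D" "j < D"
  shows "perm_average T $$ (move p i, move p j) = perm_average T $$ (i, j)"
proof -
  have "(\<Sum>q\<in>factor_perms n. T $$ (move q (move p i), move q (move p j))) = (\<Sum>q\<in>factor_perms n. T $$ (move (p \<circ> q) i, move (p \<circ> q) j))"
    by (intro sum.cong refl) (auto simp: factor_perms_def perm_pair_comp)
  also have "\<dots> = (\<Sum>q\<in>factor_perms n. T $$ (move q i, move q j))"
  proof (rule sum.reindex_bij_witness[of _ "\<lambda>q. inv_into UNIV p \<circ> q" "\<lambda>q. p \<circ> q"])
    fix q assume "q \<in> factor_perms n"
    then show "p \<circ> q \<in> factor_perms n" "inv_into UNIV p \<circ> q \<in> factor_perms n"
      using p permutes_inv[OF p] by (auto simp: factor_perms_def intro: permutes_compose)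
    show "inv_into UNIV p \<circ> (p \<circ> q) = q" "p \<circ> (inv_into UNIV p \<circ> q) = q"
      using permutes_inv_o[OF p] by (simp_all add: o_assoc)
  qed simp
  finally show ?thesis using ij perm_pair_less by (simp add: perm_average_def)
qed

lemma qform_perm:
  assumes p: "p permutes {..<n}"
  shows "(\<Sum>i<D. \<Sum>j<D. cnj (v i) * T $$ (move p i, move p j) * v j) = qform D T (\<lambda>i. v (move (inv_into UNIV p) i))"
proof -
  define G where "G i j = cnj (v (move (inv_into UNIV p) i)) * T $$ (i, j) * v (move (inv_into UNIV p) j)" for i j
  have "(\<Sum>i<D. \<Sum>j<D. cnj (v i) * T $$ (move p i, move p j) * v j) = (\<Sum>i<D. \<Sum>j<D. G (move p i) (move p j))"
    by (intro sum.cong refl) (simp add: G_def perm_pair_inv[OF p])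
  also have "\<dots> = (\<Sum>i<D. \<Sum>j<D. G (move p i) j)"
    by (intro sum.cong refl sum_perm_pair[OF p])
  also have "\<dots> = (\<Sum>i<D. \<Sum>j<D. G i j)"
    by (rule sum_perm_pair[OF p, of "\<lambda>i. \<Sum>j<D. G i j"])
  finally show ?thesis by (simp add: qform_def G_def)
qed

lemma qform_perm_average:
  "qform D (perm_average T) v = (\<Sum>p\<in>factor_perms n. qform D T (\<lambda>i. v (move (inv_into UNIV p) i))) / of_nat (card (factor_perms n))"
proof -
  have "qform D (perm_average T) v
      = (\<Sum>i<D. \<Sum>j<D. \<Sum>p\<in>factor_perms n. cnj (v i) * T $$ (move p i, move p j) * v j) / of_nat (card (factor_perms n))"
    by (simp add: qform_def perm_average_def sum_divide_distrib sum_distrib_left sum_distrib_right)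
  also have "(\<Sum>i<D. \<Sum>j<D. \<Sum>p\<in>factor_perms n. cnj (v i) * T $$ (move p i, move p j) * v j)
      = (\<Sum>p\<in>factor_perms n. \<Sum>i<D. \<Sum>j<D. cnj (v i) * T $$ (move p i, move p j) * v j)"
    by (rule trans[OF sum.cong[OF refl sum.swap] sum.swap])
  also have "\<dots> = (\<Sum>p\<in>factor_perms n. qform D T (\<lambda>i. v (move (inv_into UNIV p) i)))"
    by (intro sum.cong refl qform_perm) (simp add: factor_perms_def)
  finally show ?thesis .
qed

lemma psd_perm_average:
  assumes T: "psd D T" shows "psd D (perm_average T)"
proof (rule psdI)
  show "perm_average T \<in> carrier_mat D D" by (simp add: perm_average_def)
  fix i j assume ij: "i < D" "j < D"
  have "(\<Sum>p\<in>factor_perms n. T $$ (move p j, move p i)) = cnj (\<Sum>p\<in>factor_perms n. T $$ (move p i, move p j))"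
    unfolding cnj_sum by (intro sum.cong refl psd_hermitian[OF T] perm_pair_less)
  with ij show "perm_average T $$ (j, i) = cnj (perm_average T $$ (i, j))" by (simp add: perm_average_def)
next
  show "0 \<le> Re (qform D (perm_average T) v)" for v
    unfolding qform_perm_average Re_divide_of_nat Re_sum
    by (intro divide_nonneg_nonneg sum_nonneg psd_qform[OF T]) simp
qed

lemma ptrace_perm_average:
  assumes X: "X \<in> carrier_mat dA dA" and T: "ptrace_B (dA ^ n) (dB ^ n) T = tensor_power n X"
  shows "ptrace_B (dA ^ n) (dB ^ n) (perm_average T) = tensor_power n X"
proof (rule eq_matI)
  fix i j assume "i < dim_row (tensor_power n X)" "j < dim_col (tensor_power n X)"
  then have ij: "i < dA ^ n" "j < dA ^ n" using tensor_power_carrier[OF X, of n] by auto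
  have "ptrace_B (dA ^ n) (dB ^ n) (perm_average T) $$ (i, j)
      = (\<Sum>k<dB ^ n. \<Sum>p\<in>factor_perms n. T $$ (move p (i * dB ^ n + k), move p (j * dB ^ n + k))) / of_nat (card (factor_perms n))"
    using ij by (simp add: ptrace_B_def perm_average_def pair_index_less sum_divide_distrib)
  also have "(\<Sum>k<dB ^ n. \<Sum>p\<in>factor_perms n. T $$ (move p (i * dB ^ n + k), move p (j * dB ^ n + k)))
      = (\<Sum>p\<in>factor_perms n. \<Sum>k<dB ^ n. T $$ (move p (i * dB ^ n + k), move p (j * dB ^ n + k)))"
    by (rule sum.swap)
  also have "\<dots> = (\<Sum>p\<in>factor_perms n. tensor_power n X $$ (i, j))"
  proof (rule sum.cong[OF refl])
    fix p assume "p \<in> factor_perms n"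
    then have p: "p permutes {..<n}" by (simp add: factor_perms_def)
    have "(\<Sum>k<dB ^ n. T $$ (move p (i * dB ^ n + k), move p (j * dB ^ n + k)))
        = (\<Sum>k<dB ^ n. T $$ (perm_index dA n p i * dB ^ n + perm_index dB n p k, perm_index dA n p j * dB ^ n + perm_index dB n p k))"
      by (intro sum.cong refl) (simp add: perm_pair_index)
    also have "\<dots> = (\<Sum>k<dB ^ n. T $$ (perm_index dA n p i * dB ^ n + k, perm_index dA n p j * dB ^ n + k))"
      by (rule sum_perm_index[OF dB p])
    also have "\<dots> = ptrace_B (dA ^ n) (dB ^ n) T $$ (perm_index dA n p i, perm_index dA n p j)"
      by (simp add: ptrace_B_def perm_index_less dA)
    also have "\<dots> = tensor_power n X $$ (i, j)"
      unfolding T by (rule tensor_power_perm_invariant[OF X p ij])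
    finally show "(\<Sum>k<dB ^ n. T $$ (move p (i * dB ^ n + k), move p (j * dB ^ n + k))) = tensor_power n X $$ (i, j)" .
  qed
  finally show "ptrace_B (dA ^ n) (dB ^ n) (perm_average T) $$ (i, j) = tensor_power n X $$ (i, j)"
    using card_factor_perms_pos[of n] by simp
qed (use tensor_power_carrier[OF X, of n] in \<open>auto simp: ptrace_B_def\<close>)

text \<open>Averaging can only help: the resolvent vectors of the average are themselves invariant.\<close>

lemma log_expectation_perm_average:
  assumes T: "psd D T" and \<phi>: "\<phi> \<in> carrier_vec D"
    and inv: "\<And>p i. p permutes {..<n} \<Longrightarrow> i < D \<Longrightarrow> \<phi> $ (move p i) = \<phi> $ i"
  shows "log_expectation T \<phi> \<le> log_expectation (perm_average T) \<phi>"
proof (rule log_expectation_mono[OF psd_perm_average[OF T] T \<phi>])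
  fix x :: real and v :: "nat \<Rightarrow> complex"
  define A where "A = perm_average T"
  assume x: "x > 0" and "\<And>i. i < D \<Longrightarrow> (\<Sum>j<D. perm_average T $$ (i, j) * v j) + of_real x * v i = \<phi> $ i"
  then have v: "(\<Sum>j<D. A $$ (i, j) * v j) + of_real x * v i = \<phi> $ i" if "i < D" for i
    using that by (simp add: A_def)
  have A: "psd D A" unfolding A_def by (rule psd_perm_average[OF T])
  have v_inv: "v (move p i) = v i" if p: "p permutes {..<n}" and i: "i < D" for p i
  proof -
    \<comment> \<open>The average and \<phi> are invariant, so the difference of two solutions
      satisfies (A + x) w = 0, and positivity of A with x > 0 forces w = 0.\<close>
    define w where "w i = v (move p i) - v i" for i
    have w: "(\<Sum>j<D. A $$ (i, j) * w j) + of_real x * w i = 0" if i: "i < D" for i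
    proof -
      have "(\<Sum>j<D. A $$ (i, j) * v (move p j)) = (\<Sum>j<D. A $$ (move p i, move p j) * v (move p j))"
        unfolding A_def by (intro sum.cong refl) (simp add: perm_average_invariant[OF p i])
      also have "\<dots> = (\<Sum>j<D. A $$ (move p i, j) * v j)"
        by (rule sum_perm_pair[OF p, of "\<lambda>j. A $$ (move p i, j) * v j"])
      finally have "(\<Sum>j<D. A $$ (i, j) * v (move p j)) + of_real x * v (move p i) = \<phi> $ i"
        using v[OF perm_pair_less[of p i]] inv[OF p i] by simp
      with v[OF i] have "((\<Sum>j<D. A $$ (i, j) * v (move p j)) + of_real x * v (move p i))
          - ((\<Sum>j<D. A $$ (i, j) * v j) + of_real x * v i) = 0" by simp
      then show ?thesis by (simp add: w_def right_diff_distrib sum_subtractf algebra_simps)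
    qed
    have "qform D A w + of_real (x * (\<Sum>i<D. (norm (w i))\<^sup>2)) = (\<Sum>i<D. cnj (w i) * ((\<Sum>j<D. A $$ (i, j) * w j) + of_real x * w i))"
      unfolding of_real_mult of_real_sum_norm_square qform_def
      by (simp add: sum.distrib distrib_left sum_distrib_left mult_ac)
    also have "\<dots> = 0" by (rule sum.neutral) (simp add: w)
    finally have "Re (qform D A w) + x * (\<Sum>i<D. (norm (w i))\<^sup>2) = 0"
      by (metis Re_complex_of_real plus_complex.sel(1) zero_complex.sel(1))
    moreover have "0 \<le> (\<Sum>i<D. (norm (w i))\<^sup>2)" by (intro sum_nonneg) simp
    ultimately have "x * (\<Sum>i<D. (norm (w i))\<^sup>2) = 0"
      using psd_qform[OF A, of w] x mult_nonneg_nonneg[of x "\<Sum>i<D. (norm (w i))\<^sup>2"] by linarith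
    then have "(\<Sum>i<D. (norm (w i))\<^sup>2) = 0" using x by simp
    then show ?thesis using i by (simp add: sum_nonneg_eq_0_iff w_def)
  qed
  have "qform D (perm_average T) v = (\<Sum>p\<in>factor_perms n. qform D T v) / of_nat (card (factor_perms n))"
    unfolding qform_perm_average
    by (intro arg_cong2[of _ _ _ _ "(/)"] sum.cong refl qform_cong v_inv) (auto simp: factor_perms_def permutes_inv)
  also have "\<dots> = qform D T v" using card_factor_perms_pos[of n] by simp
  finally show "Re (qform D T v) \<le> Re (qform D (perm_average T) v)" by simp
qed

end

subsection \<open>Attainment of the maximum\<close>

lemma bounded_family_subsequence:
  fixes f :: "nat \<Rightarrow> 'i \<Rightarrow> 'a :: heine_borel"
  assumes "finite I" "\<And>i. i \<in> I \<Longrightarrow> bounded (range (\<lambda>m. f m i))"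
  shows "\<exists>r g. strict_mono (r :: nat \<Rightarrow> nat) \<and> (\<forall>i\<in>I. (\<lambda>m. f (r m) i) \<longlonglongrightarrow> g i)"
  using assms
proof (induction I rule: finite_induct)
  case empty
  show ?case by (auto intro!: exI[of _ id] simp: strict_mono_id)
next
  case (insert a I)
  then obtain r g where r: "strict_mono (r :: nat \<Rightarrow> nat)" and g: "\<And>i. i \<in> I \<Longrightarrow> (\<lambda>m. f (r m) i) \<longlonglongrightarrow> g i"
    by auto
  have "bounded (range (\<lambda>m. f (r m) a))"
    by (rule bounded_subset[OF insert.prems[of a]]) auto
  then obtain l r' where r': "strict_mono (r' :: nat \<Rightarrow> nat)" and l: "((\<lambda>m. f (r m) a) \<circ> r') \<longlonglongrightarrow> l"
    using bounded_imp_convergent_subsequence by blast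
  have "(\<lambda>m. f ((r \<circ> r') m) i) \<longlonglongrightarrow> (g(a := l)) i" if "i \<in> insert a I" for i
  proof (cases "i = a")
    case False
    with that g[of i] have "(\<lambda>m. f (r m) i) \<longlonglongrightarrow> g i" by simp
    from LIMSEQ_subseq_LIMSEQ[OF this r'] False show ?thesis by (simp add: o_def)
  qed (use l in \<open>simp add: o_def\<close>)
  moreover have "strict_mono (r \<circ> r')" using r r' by (rule strict_mono_o)
  ultimately show ?case by blast
qed

lemma spectral_mtrace:
  assumes s: "spectral d X U l" shows "mtrace X = of_real (\<Sum>k<d. l k)"
proof -
  have U: "unitary_fun d U" using s by (simp add: spectral_def)
  have "mtrace X = (\<Sum>i<d. \<Sum>k<d. of_real (l k) * (U i k * cnj (U i k)))"
    using s by (auto simp: mtrace_def spectral_def mult.assoc intro!: sum.cong)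
  also have "\<dots> = (\<Sum>k<d. of_real (l k) * (\<Sum>i<d. U i k * cnj (U i k)))"
    by (subst sum.swap) (simp add: sum_distrib_left)
  also have "\<dots> = (\<Sum>k<d. of_real (l k))"
    by (intro sum.cong refl) (simp add: unitary_fun_col[OF U])
  finally show ?thesis by simp
qed

lemma unitary_fun_bounded:
  assumes U: "unitary_fun d U" and ij: "i < d" "k < d" shows "norm (U i k) \<le> 1"
proof -
  have "complex_of_real (\<Sum>k<d. (norm (U i k))\<^sup>2) = 1"
    unfolding of_real_sum_norm_square using unitary_fun_row[OF U ij(1) ij(1)] by simp
  then have "(\<Sum>k<d. (norm (U i k))\<^sup>2) = 1" using of_real_eq_1_iff by blast
  then have "(norm (U i k))\<^sup>2 \<le> 1"
    using member_le_sum[of k "{..<d}" "\<lambda>k. (norm (U i k))\<^sup>2"] ij by simp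
  then show ?thesis by (simp add: power_le_one_iff abs_square_le_1)
qed

text \<open>Eigenvalues at most 1 make all terms nonpositive. Discarding those whose eigenvalue
  tends to 0 can only raise the sums, and the others converge.\<close>

lemma logsum_upper_semicontinuous:
  fixes y :: "nat \<Rightarrow> 'k \<Rightarrow> real" and l :: "nat \<Rightarrow> 'k \<Rightarrow> real"
  assumes K: "finite K"
    and y: "\<And>k. k \<in> K \<Longrightarrow> (\<lambda>m. y m k) \<longlonglongrightarrow> y' k" and l: "\<And>k. k \<in> K \<Longrightarrow> (\<lambda>m. l m k) \<longlonglongrightarrow> l' k"
    and y_nonneg: "\<And>m k. k \<in> K \<Longrightarrow> 0 \<le> y m k"
    and l_bounds: "\<And>m k. k \<in> K \<Longrightarrow> 0 \<le> l m k" "\<And>m k. k \<in> K \<Longrightarrow> l m k \<le> 1"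
    and ge: "\<forall>\<^sub>F m in sequentially. ereal c \<le> logsum K (y m) (l m)"
  shows "ereal c \<le> logsum K y' l'"
proof -
  have y'_nonneg: "0 \<le> y' k" if "k \<in> K" for k
    using LIMSEQ_le_const[OF y[OF that]] y_nonneg[OF that] by blast
  have l'_nonneg: "0 \<le> l' k" if "k \<in> K" for k
    using LIMSEQ_le_const[OF l[OF that]] l_bounds(1)[OF that] by blast
  have nonpos: "y m k * ln (l m k) \<le> 0" if "k \<in> K" for m k
    using y_nonneg[OF that, of m] l_bounds[OF that, of m]
    by (cases "l m k = 0") (auto intro!: mult_nonneg_nonpos)
  have sub: "\<forall>\<^sub>F m in sequentially. (\<forall>k\<in>K. y m k \<noteq> 0 \<longrightarrow> l m k > 0) \<and> (\<forall>J. J \<subseteq> K \<longrightarrow> c \<le> (\<Sum>k\<in>J. y m k * ln (l m k)))"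
    using ge
  proof eventually_elim
    case (elim m)
    then have fin: "\<forall>k\<in>K. y m k \<noteq> 0 \<longrightarrow> l m k > 0" by (auto simp: logsum_def split: if_splits)
    with elim have "c \<le> (\<Sum>k\<in>K. y m k * ln (l m k))" by (simp add: logsum_def)
    moreover have "(\<Sum>k\<in>K. y m k * ln (l m k)) \<le> (\<Sum>k\<in>J. y m k * ln (l m k))" if "J \<subseteq> K" for J
    proof -
      have "(\<Sum>k\<in>K. y m k * ln (l m k)) = (\<Sum>k\<in>K - J. y m k * ln (l m k)) + (\<Sum>k\<in>J. y m k * ln (l m k))"
        by (rule sum.subset_diff[OF that K])
      moreover have "(\<Sum>k\<in>K - J. y m k * ln (l m k)) \<le> 0" using nonpos by (intro sum_nonpos) auto
      ultimately show ?thesis by linarith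
    qed
    ultimately have "c \<le> (\<Sum>k\<in>J. y m k * ln (l m k))" if "J \<subseteq> K" for J
      using that by (meson order_trans)
    with fin show ?case by (intro conjI allI impI)
  qed
  have pos: "l' k > 0" if k: "k \<in> K" "y' k \<noteq> 0" for k
  proof -
    define e where "e = y' k / 2"
    have e: "e > 0" using y'_nonneg[OF k(1)] k(2) by (simp add: e_def)
    have "\<forall>\<^sub>F m in sequentially. e < y m k"
      by (rule order_tendstoD(1)[OF y[OF k(1)]]) (use y'_nonneg[OF k(1)] k(2) in \<open>simp add: e_def\<close>)
    \<comment> \<open>The single term at k is at least c, and its weight eventually exceeds
      \<open>e\<close>, half the limit weight; so the eigenvalue cannot approach 0.\<close>
    with sub have "\<forall>\<^sub>F m in sequentially. exp (c / e) \<le> l m k"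
    proof eventually_elim
      case (elim m)
      then have lp: "l m k > 0" using k e by auto
      have "c \<le> y m k * ln (l m k)" using elim k by (auto dest: spec[of _ "{k}"])
      also have "\<dots> \<le> e * ln (l m k)"
        using elim e lp l_bounds(2)[OF k(1), of m] by (intro mult_right_mono_neg) auto
      finally have "c / e \<le> ln (l m k)" using e by (simp add: field_simps)
      then show ?case using lp by (simp add: ln_ge_iff)
    qed
    then have "exp (c / e) \<le> l' k"
      by (intro tendsto_lowerbound[OF l[OF k(1)]]) auto
    then show ?thesis using exp_gt_zero[of "c / e"] by linarith
  qed
  define J where "J = {k\<in>K. l' k > 0}"
  have "(\<lambda>m. \<Sum>k\<in>J. y m k * ln (l m k)) \<longlonglongrightarrow> (\<Sum>k\<in>J. y' k * ln (l' k))"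
    by (intro tendsto_sum tendsto_mult tendsto_ln y l) (auto simp: J_def)
  then have "c \<le> (\<Sum>k\<in>J. y' k * ln (l' k))"
    by (rule tendsto_lowerbound) (auto intro!: eventually_mono[OF sub] simp: J_def)
  also have "\<dots> = (\<Sum>k\<in>K. y' k * ln (l' k))"
    by (rule sum.mono_neutral_left) (use K pos in \<open>auto simp: J_def\<close>)
  finally show ?thesis using pos by (auto simp: logsum_def)
qed

text \<open>The limit is taken of eigenvalues and eigenbases, in which the log expectation is
  explicit and upper semicontinuous; the entries of the matrices converge along with them. Trace 1
  keeps the eigenvalues in the unit interval.\<close>

lemma log_expectation_attains_max:
  assumes ne: "S \<noteq> {}" and S: "\<And>T. T \<in> S \<Longrightarrow> psd d T \<and> mtrace T = 1" and \<phi>: "\<phi> \<in> carrier_vec d"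
    and closed: "\<And>F T. (\<And>m. F m \<in> S) \<Longrightarrow> psd d T \<Longrightarrow>
      (\<And>i j. i < d \<Longrightarrow> j < d \<Longrightarrow> (\<lambda>m :: nat. F m $$ (i, j)) \<longlonglongrightarrow> T $$ (i, j)) \<Longrightarrow> T \<in> S"
  shows "\<exists>T\<in>S. \<forall>T'\<in>S. log_expectation T' \<phi> \<le> log_expectation T \<phi>"
proof -
  obtain s :: "nat \<Rightarrow> ereal" where s: "incseq s" "range s \<subseteq> (\<lambda>T. log_expectation T \<phi>) ` S"
    "(SUP T\<in>S. log_expectation T \<phi>) = (SUP m. s m)"
    using Sup_countable_SUP[of "(\<lambda>T. log_expectation T \<phi>) ` S"] ne by auto
  then have "\<forall>m. \<exists>T\<in>S. s m = log_expectation T \<phi>" by auto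
  then obtain F where F: "\<And>m. F m \<in> S" "\<And>m. s m = log_expectation (F m) \<phi>" by metis
  have "\<exists>U l. spectral d (F m) U l \<and> (\<forall>k<d. 0 \<le> l k)" for m
    using S[OF F(1)[of m]] psd_spectral by metis
  then obtain U l where sp: "\<And>m. spectral d (F m) (U m) (l m)" and l0: "\<And>m k. k < d \<Longrightarrow> 0 \<le> l m k" by metis
  have U: "unitary_fun d (U m)" for m using sp by (simp add: spectral_def)
  have l1: "l m k \<le> 1" if k: "k < d" for m k
  proof -
    have "complex_of_real (\<Sum>k<d. l m k) = 1" using spectral_mtrace[OF sp, of m] S[OF F(1)[of m]] by simp
    then have "(\<Sum>k<d. l m k) = 1" using of_real_eq_1_iff by blast
    then show ?thesis using member_le_sum[of k "{..<d}" "l m"] k l0 by simp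
  qed
  have "\<exists>r g. strict_mono (r :: nat \<Rightarrow> nat) \<and> (\<forall>i\<in>{..<d} \<times> {..<d}. (\<lambda>m. (case i of (i, k) \<Rightarrow> U (r m) i k)) \<longlonglongrightarrow> g i)"
    by (rule bounded_family_subsequence[of _ "\<lambda>m i. case i of (i, k) \<Rightarrow> U m i k"])
      (auto intro!: boundedI[of _ 1] unitary_fun_bounded[OF U])
  then obtain r g where r: "strict_mono (r :: nat \<Rightarrow> nat)" and g: "\<And>i k. i < d \<Longrightarrow> k < d \<Longrightarrow> (\<lambda>m. U (r m) i k) \<longlonglongrightarrow> g (i, k)"
    by auto
  have "\<exists>r' h. strict_mono (r' :: nat \<Rightarrow> nat) \<and> (\<forall>k\<in>{..<d}. (\<lambda>m. l (r (r' m)) k) \<longlonglongrightarrow> h k)"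
    by (rule bounded_family_subsequence[of _ "\<lambda>m. l (r m)"]) (use l0 l1 in \<open>auto intro!: boundedI[of _ 1]\<close>)
  then obtain r' h where r': "strict_mono (r' :: nat \<Rightarrow> nat)" and h: "\<And>k. k < d \<Longrightarrow> (\<lambda>m. l (r (r' m)) k) \<longlonglongrightarrow> h k"
    by auto
  define q where "q m = r (r' m)" for m
  define W where "W i k = g (i, k)" for i k
  have W: "(\<lambda>m. U (q m) i k) \<longlonglongrightarrow> W i k" if "i < d" "k < d" for i k
    using LIMSEQ_subseq_LIMSEQ[OF g[OF that] r'] by (simp add: o_def q_def W_def)
  have h: "(\<lambda>m. l (q m) k) \<longlonglongrightarrow> h k" if "k < d" for k using h[OF that] by (simp add: q_def)
  have W_unitary: "unitary_fun d W"
  proof (rule unitary_funI)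
    fix k l assume "k < d" "l < d"
    then have "(\<lambda>m. \<Sum>i<d. U (q m) i k * cnj (U (q m) i l)) \<longlonglongrightarrow> (\<Sum>i<d. W i k * cnj (W i l))"
      by (intro tendsto_sum tendsto_mult tendsto_cnj W) auto
    with unitary_fun_col[OF U \<open>k < d\<close> \<open>l < d\<close>] show "(\<Sum>i<d. W i k * cnj (W i l)) = (if k = l then 1 else 0)"
      by (simp add: LIMSEQ_const_iff)
  qed
  have h0: "0 \<le> h k" if "k < d" for k
    using LIMSEQ_le_const[OF h[OF that]] l0[OF that] by blast
  define T where "T = Matrix.mat d d (\<lambda>(i, j). \<Sum>k<d. of_real (h k) * W i k * cnj (W j k))"
  have sT: "spectral d T W h" using W_unitary by (simp add: spectral_def T_def)
  have "T \<in> S"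
  proof (rule closed)
    show "F (q m) \<in> S" for m by (rule F)
    show "psd d T" by (rule spectral_psd[OF sT h0])
    fix i j assume ij: "i < d" "j < d"
    have "(\<lambda>m. \<Sum>k<d. of_real (l (q m) k) * U (q m) i k * cnj (U (q m) j k)) \<longlonglongrightarrow> (\<Sum>k<d. of_real (h k) * W i k * cnj (W j k))"
      using ij by (intro tendsto_sum tendsto_mult tendsto_cnj tendsto_of_real W h) auto
    then show "(\<lambda>m. F (q m) $$ (i, j)) \<longlonglongrightarrow> T $$ (i, j)"
      using sp ij by (simp add: spectral_def T_def)
  qed
  moreover have "(SUP T\<in>S. log_expectation T \<phi>) \<le> log_expectation T \<phi>"
  proof (rule ccontr)
    assume "\<not> ?thesis"
    then have "log_expectation T \<phi> < (SUP T\<in>S. log_expectation T \<phi>)" by simp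
    then obtain c where c: "log_expectation T \<phi> < ereal c" "ereal c < (SUP m. s m)"
      using ereal_dense2 s(3) by metis
    have "(\<lambda>m. s (q m)) \<longlonglongrightarrow> (SUP m. s m)"
      using LIMSEQ_subseq_LIMSEQ[OF LIMSEQ_SUP[OF s(1)] strict_mono_o[OF r r']] by (simp add: o_def q_def)
    then have "\<forall>\<^sub>F m in sequentially. ereal c < s (q m)" using c(2) by (rule order_tendstoD(1))
    then have ev: "\<forall>\<^sub>F m in sequentially. ereal c \<le> logsum {..<d} (\<lambda>k. (norm (coef d (U (q m)) (($) \<phi>) k))\<^sup>2) (l (q m))"
    proof (rule eventually_mono)
      fix m assume "ereal c < s (q m)"
      also have "s (q m) = logsum {..<d} (\<lambda>k. (norm (coef d (U (q m)) (($) \<phi>) k))\<^sup>2) (l (q m))"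
        unfolding F(2) by (rule log_expectation_spectral[OF sp l0 \<phi>])
      finally show "ereal c \<le> logsum {..<d} (\<lambda>k. (norm (coef d (U (q m)) (($) \<phi>) k))\<^sup>2) (l (q m))" by simp
    qed
    have "ereal c \<le> logsum {..<d} (\<lambda>k. (norm (coef d W (($) \<phi>) k))\<^sup>2) h"
    proof (rule logsum_upper_semicontinuous[OF _ _ _ _ _ _ ev])
      fix k assume "k \<in> {..<d}"
      then show "(\<lambda>m. (norm (coef d (U (q m)) (($) \<phi>) k))\<^sup>2) \<longlonglongrightarrow> (norm (coef d W (($) \<phi>) k))\<^sup>2"
        unfolding coef_def by (intro tendsto_power tendsto_norm tendsto_sum tendsto_mult tendsto_cnj W tendsto_const) auto
    qed (use h l0 l1 in auto)
    with c(1) show False by (simp add: log_expectation_spectral[OF sT h0 \<phi>])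
  qed
  ultimately show ?thesis by (meson SUP_upper order_trans)
qed

lemma extension_limit:
  assumes F: "\<And>m :: nat. F m \<in> extensions dA dB n \<sigma>" and T: "psd (dA ^ n * dB ^ n) T"
    and lim: "\<And>i j. i < dA ^ n * dB ^ n \<Longrightarrow> j < dA ^ n * dB ^ n \<Longrightarrow> (\<lambda>m. F m $$ (i, j)) \<longlonglongrightarrow> T $$ (i, j)"
  shows "T \<in> extensions dA dB n \<sigma>"
proof -
  have pF: "ptrace_B (dA ^ n) (dB ^ n) (F m) = tensor_power n \<sigma>" and tF: "mtrace (F m) = 1"
    and cF: "F m \<in> carrier_mat (dA ^ n * dB ^ n) (dA ^ n * dB ^ n)" for m
    using F[of m] by (auto simp: extensions_def density_matrices_def psd_def)
  have dims: "tensor_power n \<sigma> \<in> carrier_mat (dA ^ n) (dA ^ n)" using pF[of 0] ptrace_B_carrier by metis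
  have pt: "ptrace_B (dA ^ n) (dB ^ n) T = tensor_power n \<sigma>"
  proof (rule eq_matI)
    fix i j assume "i < dim_row (tensor_power n \<sigma>)" "j < dim_col (tensor_power n \<sigma>)"
    then have ij: "i < dA ^ n" "j < dA ^ n" using dims by auto
    have "(\<lambda>m. \<Sum>k<dB ^ n. F m $$ (i * dB ^ n + k, j * dB ^ n + k)) \<longlonglongrightarrow> (\<Sum>k<dB ^ n. T $$ (i * dB ^ n + k, j * dB ^ n + k))"
      using ij by (intro tendsto_sum lim pair_index_less) auto
    moreover have "(\<Sum>k<dB ^ n. F m $$ (i * dB ^ n + k, j * dB ^ n + k)) = tensor_power n \<sigma> $$ (i, j)" for m
      using ij unfolding pF[of m, symmetric] by (simp add: ptrace_B_def)
    ultimately show "ptrace_B (dA ^ n) (dB ^ n) T $$ (i, j) = tensor_power n \<sigma> $$ (i, j)"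
      using ij by (simp add: ptrace_B_def LIMSEQ_const_iff)
  qed (use dims in \<open>auto simp: ptrace_B_def\<close>)
  have "mtrace T = mtrace (F 0)"
    unfolding mtrace_ptrace_B[OF psd_carrier[OF T], symmetric] mtrace_ptrace_B[OF cF, symmetric] pt pF ..
  then show ?thesis using T pt tF by (simp add: extensions_def density_matrices_def)
qed

section \<open>Regularized limits and the combination of the bounds\<close>

text \<open>A squeeze whose error is logarithmic in n. For K = -\<infinity> the upper bound alone
  determines X n.\<close>

lemma tendsto_regularized:
  fixes X :: "nat \<Rightarrow> ereal" and K :: ereal
  assumes K: "K \<noteq> \<infinity>" and upper: "\<And>n. n \<ge> 1 \<Longrightarrow> X n \<le> ereal (real n) * K"
    and lower: "\<And>n. n \<ge> 1 \<Longrightarrow> ereal (real n) * K \<le> X n + ereal (c * ln (real (Suc n)))"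
  shows "(\<lambda>n. ereal (1 / real n) * X n) \<longlonglongrightarrow> K"
proof (cases K)
  case (real k)
  have ev: "\<forall>\<^sub>F n in sequentially. n \<ge> (1 :: nat)" by (rule eventually_ge_at_top)
  show ?thesis
  proof (rule tendsto_sandwich)
    show "\<forall>\<^sub>F n in sequentially. ereal (k - c * ln (real (Suc n)) / real n) \<le> ereal (1 / real n) * X n"
      using ev
    proof eventually_elim
      case (elim n)
      then obtain x where x: "X n = ereal x" using upper[of n] lower[of n] by (cases "X n") (auto simp: real)
      with lower[OF elim] have "real n * k - c * ln (real (Suc n)) \<le> x" by (simp add: real)
      then have "(real n * k - c * ln (real (Suc n))) / real n \<le> x / real n" by (rule divide_right_mono) simp
      with elim x show ?case by (simp add: diff_divide_distrib)
    qed
    show "\<forall>\<^sub>F n in sequentially. ereal (1 / real n) * X n \<le> K"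
      using ev
    proof eventually_elim
      case (elim n)
      then obtain x where x: "X n = ereal x" using upper[of n] lower[of n] by (cases "X n") (auto simp: real)
      with upper[OF elim] elim show ?case by (simp add: real field_simps)
    qed
    have "(\<lambda>n. ln (real (Suc n)) / real n) \<longlonglongrightarrow> 0" by real_asymp
    from tendsto_diff[OF tendsto_const tendsto_mult_left[OF this, of c], of k]
    show "(\<lambda>n. ereal (k - c * ln (real (Suc n)) / real n)) \<longlonglongrightarrow> K"
      by (simp add: real)
  qed simp
next
  case MInf
  have "\<forall>\<^sub>F n in sequentially. ereal (1 / real n) * X n = K"
    using eventually_ge_at_top[of "1 :: nat"]
  proof eventually_elim
    case (elim n)
    then have "X n = -\<infinity>" using upper[of n] MInf by simp
    with elim show ?case by (simp add: MInf)
  qed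
  then show ?thesis by (rule tendsto_eventually)
qed (use K in simp)

lemma mtrace_tensor_power:
  assumes "X \<in> carrier_mat d d" "d > 0" shows "mtrace (tensor_power n X) = mtrace X ^ n"
proof -
  have "mtrace (tensor_power n X) = (\<Sum>i<d ^ n. \<Prod>k<n. X $$ (digit d i k, digit d i k))"
    using assms by (simp add: mtrace_def tensor_power_def)
  also have "\<dots> = (\<Prod>k<n. \<Sum>a<d. X $$ (a, a))" by (rule sum_prod_digits[OF assms(2)])
  finally show ?thesis using assms by (simp add: mtrace_def)
qed

context tensor_purified_pair
begin

abbreviation \<Psi> where "\<Psi> \<equiv> tensor_power_AB dA dB n \<psi>"

sublocale factor_permutation dA dB n
  by unfold_locales (rule dA_pos dB_pos)+

lemma sigma_carrier: "\<sigma> \<in> carrier_mat dA dA"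
  using sigma by (simp add: spectral_def)

lemma extensions_psd: "T \<in> extensions dA dB n \<sigma> \<Longrightarrow> psd D T"
  by (simp add: extensions_def density_matrices_def)

lemma rel_entropy_Psi: "psd D T \<Longrightarrow> rel_entropy (ket_bra \<Psi>) T = - log_expectation T \<Psi>"
  by (rule rel_entropy_ket_bra[OF N.psi_carrier N.psi_unit])

lemma extension_le: "T \<in> extensions dA dB n \<sigma> \<Longrightarrow> log_expectation T \<Psi> \<le> logsum N.pairs N.weight N.ratio"
  by (rule N.log_expectation_extension_le) (auto simp: extensions_def density_matrices_def)

lemma extension_exists:
  assumes "mtrace \<sigma> = 1"
  shows "\<exists>T\<in>extensions dA dB n \<sigma>. log_expectation N.Opt \<Psi> \<le> log_expectation T \<Psi>"
proof -
  have "mtrace (tensor_power n \<sigma>) = 1" using mtrace_tensor_power[OF sigma_carrier dA_pos] assms by simp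
  then show ?thesis
    by (rule N.extension_above_Opt) (auto simp: extensions_def density_matrices_def)
qed

lemma Psi_invariant: "p permutes {..<n} \<Longrightarrow> i < D \<Longrightarrow> \<Psi> $ (move p i) = \<Psi> $ i"
  by (rule product_perm_invariant[OF tensor_power_AB_entry])

lemma perm_invariant_Opt: "perm_invariant dA dB n N.Opt"
proof (rule perm_invariantI[OF N.Opt_carrier])
  fix p i j assume p: "p permutes {..<n}" and ij: "i < D" "j < D"
  have "N.phi t (move p i) = N.phi t i" if "i < D" for t i
    by (rule product_perm_invariant[OF phi_tensor p that])
  then show "N.Opt $$ (move p i, move p j) = N.Opt $$ (i, j)"
    using ij perm_pair_less by (simp add: N.Opt_def)
qed

lemma invariant_maximizer:
  assumes "mtrace \<sigma> = 1"
  obtains T where "T \<in> extensions dA dB n \<sigma>" "perm_invariant dA dB n T"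
    "\<And>T'. T' \<in> extensions dA dB n \<sigma> \<Longrightarrow> log_expectation T' \<Psi> \<le> log_expectation T \<Psi>"
proof -
  have "\<exists>T\<in>extensions dA dB n \<sigma>. \<forall>T'\<in>extensions dA dB n \<sigma>. log_expectation T' \<Psi> \<le> log_expectation T \<Psi>"
  proof (rule log_expectation_attains_max[OF _ _ N.psi_carrier])
    show "extensions dA dB n \<sigma> \<noteq> {}" using extension_exists[OF assms] by blast
    show "psd D T \<and> mtrace T = 1" if "T \<in> extensions dA dB n \<sigma>" for T
      using that by (simp add: extensions_def density_matrices_def)
    show "T \<in> extensions dA dB n \<sigma>" if "\<And>m. F m \<in> extensions dA dB n \<sigma>" "psd D T"
      "\<And>i j. i < D \<Longrightarrow> j < D \<Longrightarrow> (\<lambda>m :: nat. F m $$ (i, j)) \<longlonglongrightarrow> T $$ (i, j)" for F T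
      by (rule extension_limit[OF that])
  qed
  then obtain T where T: "T \<in> extensions dA dB n \<sigma>"
    "\<And>T'. T' \<in> extensions dA dB n \<sigma> \<Longrightarrow> log_expectation T' \<Psi> \<le> log_expectation T \<Psi>" by blast
  define A where "A = perm_average T"
  have A: "psd D A" unfolding A_def by (rule psd_perm_average[OF extensions_psd[OF T(1)]])
  have pA: "ptrace_B (dA ^ n) (dB ^ n) A = tensor_power n \<sigma>"
    unfolding A_def by (rule ptrace_perm_average[OF sigma_carrier]) (use T(1) in \<open>simp add: extensions_def\<close>)
  have "mtrace A = mtrace (tensor_power n \<sigma>)" using mtrace_ptrace_B[OF psd_carrier[OF A]] pA by simp
  then have "A \<in> extensions dA dB n \<sigma>"
    using A pA mtrace_tensor_power[OF sigma_carrier dA_pos, of n] assms by (simp add: extensions_def density_matrices_def)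
  moreover have "perm_invariant dA dB n A"
    by (rule perm_invariantI[OF psd_carrier[OF A]]) (simp add: A_def perm_average_invariant)
  moreover have "log_expectation T \<Psi> \<le> log_expectation A \<Psi>"
    unfolding A_def by (rule log_expectation_perm_average[OF extensions_psd[OF T(1)] N.psi_carrier Psi_invariant])
  ultimately show thesis using that T(2) order_trans by metis
qed

text \<open>If the eigenvalue of \<rho> along a string vanishes, it vanishes at some position; there
  the eigenvalue of \<sigma> is nonzero, so the overlap at that position is 0 and with it the whole
  product.\<close>

lemma Opt_extension:
  assumes "mtrace \<sigma> = 1" and sub: "supp \<sigma> \<subseteq> supp \<rho>"
  shows "N.Opt \<in> extensions dA dB n \<sigma>"
proof -
  have ov: "overlap a j = 0" if l: "a < dA" "j < dA" "\<nu> j = 0" "\<mu> a \<noteq> 0" for a j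
  proof -
    define v where "v = Matrix.vec dA (\<lambda>x. V x a)"
    have cv: "coef dA W (($) v) k = coef dA W (\<lambda>x. V x a) k" for W k
      by (rule coef_cong) (simp add: v_def)
    have "v \<in> supp \<sigma>"
      unfolding supp_spectral[OF sigma] cv using coef_column[OF unitary_V _ l(1)] l(4) by (auto simp: v_def)
    with sub have "v \<in> supp \<rho>" by blast
    then have "coef dA U (\<lambda>x. V x a) j = 0" unfolding supp_spectral[OF rho] cv using l by auto
    moreover have "overlap a j = cnj (coef dA U (\<lambda>x. V x a) j)"
      by (simp add: overlap_def coef_def mult.commute)
    ultimately show ?thesis by simp
  qed
  have "ptrace_B (dA ^ n) (dB ^ n) N.Opt = tensor_power n \<sigma>"
  proof (rule N.ptrace_Opt_eq)
    fix a j assume z: "tensor_eigenvalue dA n \<nu> j = 0" "tensor_eigenvalue dA n \<mu> a \<noteq> 0"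
    then obtain k where k: "k < n" "\<nu> (digit dA j k) = 0" by (auto simp: tensor_eigenvalue_def)
    moreover have "\<mu> (digit dA a k) \<noteq> 0" using z(2) k(1) by (auto simp: tensor_eigenvalue_def)
    ultimately have "overlap (digit dA a k) (digit dA j k) = 0" by (intro ov) (auto simp: dA_pos)
    with k(1) show "N.overlap a j = 0" unfolding overlap_tensor by (intro prod_zero) auto
  qed
  moreover have "mtrace N.Opt = 1"
    using mtrace_ptrace_B[OF N.Opt_carrier] calculation mtrace_tensor_power[OF sigma_carrier dA_pos, of n] assms(1) by simp
  ultimately show ?thesis using N.Opt_psd by (simp add: extensions_def density_matrices_def)
qed

text \<open>The error ln N is at most 2 dA ln (n + 1), which division by n makes vanish.\<close>

lemma Opt_lower:
  assumes "n \<ge> 1"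
  shows "ereal (real n) * logsum pairs weight ratio \<le> log_expectation N.Opt \<Psi> + ereal (2 * real dA * ln (real (Suc n)))"
proof -
  have "N.pairs \<noteq> {}" using N.sum_weight by auto
  then have "0 < card (N.ratio ` N.pairs)" using N.finite_pairs by (simp add: card_gt_0_iff)
  then have "ln (real (card (N.ratio ` N.pairs))) \<le> ln (real (Suc n ^ (2 * dA)))"
    using card_ratio_le by (subst ln_le_cancel_iff) (auto simp del: of_nat_power)
  also have "\<dots> = 2 * real dA * ln (real (Suc n))"
    by (simp add: ln_realpow del: of_nat_Suc)
  finally have "ereal (ln (real (card (N.ratio ` N.pairs)))) \<le> ereal (2 * real dA * ln (real (Suc n)))" by simp
  with N.log_expectation_Opt_ge show ?thesis
    unfolding logsum_tensor[OF assms, symmetric] by (meson add_left_mono order_trans)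
qed

end

theorem mainTheorem7:
  fixes dA dB :: nat and \<rho> \<sigma> :: "complex mat" and \<psi> :: "complex vec"
  assumes "\<rho> \<in> density_matrices dA" and "\<sigma> \<in> density_matrices dA"
    and "purification dA dB \<psi> \<rho>"
  shows
    \<comment> \<open>the extrema are attained, and a common optimizer can be chosen permutation-invariant\<close>
    "(\<forall>n\<ge>1. \<exists>\<omega>. perm_invariant dA dB n \<omega> \<and>
        is_arg_min (\<lambda>\<tau>. rel_entropy (ket_bra (tensor_power_AB dA dB n \<psi>)) \<tau>)
          (\<lambda>\<tau>. \<tau> \<in> extensions dA dB n \<sigma>) \<omega> \<and>
        is_arg_max (\<lambda>\<tau>. log_expectation \<tau> (tensor_power_AB dA dB n \<psi>))
          (\<lambda>\<tau>. \<tau> \<in> extensions dA dB n \<sigma>) \<omega>) \<and>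
     (\<lambda>n. ereal (1 / real n) *
        (INF \<tau>\<in>extensions dA dB n \<sigma>. rel_entropy (ket_bra (tensor_power_AB dA dB n \<psi>)) \<tau>))
        \<longlonglongrightarrow> rel_entropy \<rho> \<sigma> \<and>
     (\<lambda>n. ereal (1 / real n) *
        (SUP \<tau>\<in>extensions dA dB n \<sigma>. log_expectation \<tau> (tensor_power_AB dA dB n \<psi>)))
        \<longlonglongrightarrow> - rel_entropy \<rho> \<sigma> \<and>
     (\<forall>n\<ge>1. psd (dA ^ n * dB ^ n) (opt_state dA dB n \<rho> \<sigma> \<psi>) \<and>
        perm_invariant dA dB n (opt_state dA dB n \<rho> \<sigma> \<psi>)) \<and>
     (supp \<sigma> \<subseteq> supp \<rho> \<longrightarrow>
        (\<forall>n\<ge>1. opt_state dA dB n \<rho> \<sigma> \<psi> \<in> extensions dA dB n \<sigma>)) \<and>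
     (\<lambda>n. ereal (1 / real n) *
        rel_entropy (ket_bra (tensor_power_AB dA dB n \<psi>)) (opt_state dA dB n \<rho> \<sigma> \<psi>))
        \<longlonglongrightarrow> rel_entropy \<rho> \<sigma>"
proof -
  have psd: "psd dA \<rho>" "psd dA \<sigma>" and tr: "mtrace \<sigma> = 1"
    using assms by (auto simp: density_matrices_def)
  obtain U \<nu> where rho: "spectral dA \<rho> U \<nu>" "\<And>k. k < dA \<Longrightarrow> 0 \<le> \<nu> k" using psd_spectral[OF psd(1)] by blast
  obtain V \<mu> where sigma: "spectral dA \<sigma> V \<mu>" "\<And>k. k < dA \<Longrightarrow> 0 \<le> \<mu> k" using psd_spectral[OF psd(2)] by blast
  interpret purified_pair dA dB \<rho> \<sigma> \<psi> U V \<nu> \<mu>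
    by unfold_locales (fact rho sigma assms(3))+
  have TP: "tensor_purified_pair dA dB \<rho> \<sigma> \<psi> U V \<nu> \<mu>"
    by (simp add: tensor_purified_pair_def purified_pair_axioms)
  let ?\<Psi> = "\<lambda>n. tensor_power_AB dA dB n \<psi>"
  let ?E = "\<lambda>n. extensions dA dB n \<sigma>"
  let ?O = "\<lambda>n. opt_state dA dB n \<rho> \<sigma> \<psi>"
  define K where "K = logsum pairs weight ratio"
  have K: "K \<noteq> \<infinity>" by (simp add: K_def logsum_def)
  have D: "rel_entropy \<rho> \<sigma> = - K" unfolding K_def by (rule rel_entropy_logsum)
  have rel: "rel_entropy (ket_bra (?\<Psi> n)) T = - log_expectation T (?\<Psi> n)" if "psd (dA ^ n * dB ^ n) T" for n T
    by (rule tensor_purified_pair.rel_entropy_Psi[OF TP that])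
  have relE: "rel_entropy (ket_bra (?\<Psi> n)) T = - log_expectation T (?\<Psi> n)" if "T \<in> ?E n" for n T
    by (rule rel[OF tensor_purified_pair.extensions_psd[OF TP that]])
  have opt_psd: "psd (dA ^ n * dB ^ n) (?O n)" and opt_inv: "perm_invariant dA dB n (?O n)" for n
  proof -
    interpret T: tensor_purified_pair dA dB \<rho> \<sigma> \<psi> U V \<nu> \<mu> n by (rule TP)
    show "psd (dA ^ n * dB ^ n) (?O n)" unfolding T.opt_state_eq by (rule T.N.Opt_psd)
    show "perm_invariant dA dB n (?O n)" unfolding T.opt_state_eq by (rule T.perm_invariant_Opt)
  qed
  have opt_ext: "?O n \<in> ?E n" if "supp \<sigma> \<subseteq> supp \<rho>" for n
  proof -
    interpret T: tensor_purified_pair dA dB \<rho> \<sigma> \<psi> U V \<nu> \<mu> n by (rule TP)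
    show ?thesis unfolding T.opt_state_eq by (rule T.Opt_extension[OF tr that])
  qed
  have lims: "(\<lambda>n. ereal (1 / real n) * log_expectation (?O n) (?\<Psi> n)) \<longlonglongrightarrow> K"
    "(\<lambda>n. ereal (1 / real n) * (SUP \<tau>\<in>?E n. log_expectation \<tau> (?\<Psi> n))) \<longlonglongrightarrow> K"
  proof -
    \<comment> \<open>The optimizer lies below the supremum, both lie below n K, and the optimizer
      is within a logarithmic error of n K. This squeezes both sequences.\<close>
    have b: "log_expectation (?O n) (?\<Psi> n) \<le> ereal (real n) * K"
      "(SUP \<tau>\<in>?E n. log_expectation \<tau> (?\<Psi> n)) \<le> ereal (real n) * K"
      "ereal (real n) * K \<le> log_expectation (?O n) (?\<Psi> n) + ereal (2 * real dA * ln (real (Suc n)))"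
      "log_expectation (?O n) (?\<Psi> n) \<le> (SUP \<tau>\<in>?E n. log_expectation \<tau> (?\<Psi> n))" if n: "n \<ge> 1" for n
    proof -
      interpret T: tensor_purified_pair dA dB \<rho> \<sigma> \<psi> U V \<nu> \<mu> n by (rule TP)
      show "log_expectation (?O n) (?\<Psi> n) \<le> ereal (real n) * K"
        unfolding T.opt_state_eq K_def T.logsum_tensor[OF n, symmetric] by (rule T.N.log_expectation_Opt_le)
      show "(SUP \<tau>\<in>?E n. log_expectation \<tau> (?\<Psi> n)) \<le> ereal (real n) * K"
        unfolding K_def T.logsum_tensor[OF n, symmetric] by (rule SUP_least) (rule T.extension_le)
      show "ereal (real n) * K \<le> log_expectation (?O n) (?\<Psi> n) + ereal (2 * real dA * ln (real (Suc n)))"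
        unfolding T.opt_state_eq K_def by (rule T.Opt_lower[OF n])
      show "log_expectation (?O n) (?\<Psi> n) \<le> (SUP \<tau>\<in>?E n. log_expectation \<tau> (?\<Psi> n))"
        unfolding T.opt_state_eq using T.extension_exists[OF tr] by (meson SUP_upper2)
    qed
    show "(\<lambda>n. ereal (1 / real n) * log_expectation (?O n) (?\<Psi> n)) \<longlonglongrightarrow> K"
      by (rule tendsto_regularized[OF K b(1) b(3)])
    show "(\<lambda>n. ereal (1 / real n) * (SUP \<tau>\<in>?E n. log_expectation \<tau> (?\<Psi> n))) \<longlonglongrightarrow> K"
      by (rule tendsto_regularized[OF K b(2) order_trans[OF b(3) add_right_mono[OF b(4)]]])
  qed
  have "\<exists>\<omega>. perm_invariant dA dB n \<omega> \<and> is_arg_min (\<lambda>\<tau>. rel_entropy (ket_bra (?\<Psi> n)) \<tau>) (\<lambda>\<tau>. \<tau> \<in> ?E n) \<omega> \<and>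
      is_arg_max (\<lambda>\<tau>. log_expectation \<tau> (?\<Psi> n)) (\<lambda>\<tau>. \<tau> \<in> ?E n) \<omega>" for n
  proof -
    obtain \<omega> where w: "\<omega> \<in> ?E n" "perm_invariant dA dB n \<omega>"
      "\<And>\<tau>. \<tau> \<in> ?E n \<Longrightarrow> log_expectation \<tau> (?\<Psi> n) \<le> log_expectation \<omega> (?\<Psi> n)"
      using tensor_purified_pair.invariant_maximizer[OF TP tr] by blast
    then have "is_arg_min (\<lambda>\<tau>. rel_entropy (ket_bra (?\<Psi> n)) \<tau>) (\<lambda>\<tau>. \<tau> \<in> ?E n) \<omega>"
      "is_arg_max (\<lambda>\<tau>. log_expectation \<tau> (?\<Psi> n)) (\<lambda>\<tau>. \<tau> \<in> ?E n) \<omega>"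
      by (auto simp: is_arg_min_def is_arg_max_def relE not_less)
    with w(2) show ?thesis by blast
  qed
  moreover have "(\<lambda>n. ereal (1 / real n) * (INF \<tau>\<in>?E n. rel_entropy (ket_bra (?\<Psi> n)) \<tau>)) \<longlonglongrightarrow> rel_entropy \<rho> \<sigma>"
  proof -
    have "(INF \<tau>\<in>?E n. rel_entropy (ket_bra (?\<Psi> n)) \<tau>) = - (SUP \<tau>\<in>?E n. log_expectation \<tau> (?\<Psi> n))" for n
      using relE ereal_INF_uminus_eq[of "\<lambda>\<tau>. log_expectation \<tau> (?\<Psi> n)" "?E n"] by simp
    then show ?thesis using tendsto_uminus_ereal[OF lims(2)] by (simp add: D)
  qed
  moreover have "(\<lambda>n. ereal (1 / real n) * rel_entropy (ket_bra (?\<Psi> n)) (?O n)) \<longlonglongrightarrow> rel_entropy \<rho> \<sigma>"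
    using tendsto_uminus_ereal[OF lims(1)] by (simp add: D rel[OF opt_psd])
  ultimately show ?thesis
    using lims(2) opt_psd opt_inv opt_ext by (simp add: D)
qed

end
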